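(* Let $(M,g,J)$ be a compact locally conformally Kähler manifold which is not Kähler, and suppose that $M=G/H$ is homogeneous, i.e. $G$ is a compact connected Lie group acting effectively and transitively on $M$ and preserving both $g$ and $J$. Let $\mathfrak{z}$ be the center of the Lie algebra $\mathfrak{g}$ of $G$. Then $\dim\mathfrak{z}\leq 2$.
   Context: A Hermitian manifold $(M,g,J)$ ($J$ an integrable complex structure, skew-symmetric with respect to $g$) is called locally conformally Kähler (LCK) if its fundamental 2-form $\omega:=g(J\cdot,\cdot)$ satisfies $d\omega=-2\theta\wedge\omega$ for some closed 1-form $\theta$ on $M$, called the Lee form. "Not Kähler" means $d\omega\neq 0$ (so in particular $\theta\neq 0$ and $\dim_{\mathbb{C}}M\geq 2$); in this situation $G$ also preserves $\omega$ and $\theta$. *)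

theory Defs
  imports
    "HOL-Analysis.Analysis"
    "HOL-Algebra.Group_Action"
    "HOL-Library.Function_Algebras"
begin

section \<open>Smooth maps between Euclidean spaces\<close>

text \<open>Intended for open sets \<open>S\<close> only: derivatives are taken at \<open>x\<close>, not within \<open>S\<close>.\<close>

primrec k_smooth_on ::
    "nat \<Rightarrow> 'a::euclidean_space set \<Rightarrow> ('a \<Rightarrow> 'b::real_normed_vector) \<Rightarrow> bool" where
  "k_smooth_on 0 S f \<longleftrightarrow> continuous_on S f"
| "k_smooth_on (Suc k) S f \<longleftrightarrow>
     (\<forall>x\<in>S. f differentiable (at x)) \<and>
     (\<forall>v. k_smooth_on k S (\<lambda>x. frechet_derivative f (at x) v))"

definition smooth_on ::
    "'a::euclidean_space set \<Rightarrow> ('a \<Rightarrow> 'b::real_normed_vector) \<Rightarrow> bool" where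
  "smooth_on S f \<longleftrightarrow> (\<forall>k. k_smooth_on k S f)"

section \<open>Smooth manifolds\<close>

type_synonym ('m, 'e) chart = "'m set \<times> ('m \<Rightarrow> 'e)"

abbreviation cdom :: "('m, 'e) chart \<Rightarrow> 'm set" where
  "cdom \<equiv> fst"

abbreviation cmap :: "('m, 'e) chart \<Rightarrow> 'm \<Rightarrow> 'e" where
  "cmap \<equiv> snd"

definition cinv :: "('m, 'e) chart \<Rightarrow> 'e \<Rightarrow> 'm" where
  "cinv c = inv_into (cdom c) (cmap c)"

definition is_chart :: "'m topology \<Rightarrow> ('m, 'e::euclidean_space) chart \<Rightarrow> bool" where
  "is_chart X c \<longleftrightarrow>
     openin X (cdom c) \<and> open (cmap c ` cdom c) \<and>
     homeomorphic_map (subtopology X (cdom c)) (top_of_set (cmap c ` cdom c)) (cmap c)"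

definition smooth_transition ::
    "('m, 'e::euclidean_space) chart \<Rightarrow> ('m, 'e) chart \<Rightarrow> bool" where
  "smooth_transition c d \<longleftrightarrow> smooth_on (cmap c ` (cdom c \<inter> cdom d)) (cmap d \<circ> cinv c)"

record ('m, 'e) manifold =
  mtop :: "'m topology"
  matlas :: "('m, 'e) chart set"

abbreviation points :: "('m, 'e) manifold \<Rightarrow> 'm set" where
  "points M \<equiv> topspace (mtop M)"

definition smooth_manifold :: "('m, 'e::euclidean_space) manifold \<Rightarrow> bool" where
  "smooth_manifold M \<longleftrightarrow>
     Hausdorff_space (mtop M) \<and> second_countable (mtop M) \<and>
     (\<forall>c\<in>matlas M. is_chart (mtop M) c) \<and>
     (\<Union>c\<in>matlas M. cdom c) = points M \<and>
     (\<forall>c\<in>matlas M. \<forall>d\<in>matlas M. smooth_transition c d)"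

definition maximal_atlas :: "('m, 'e::euclidean_space) manifold \<Rightarrow> ('m, 'e) chart set" where
  "maximal_atlas M = {c. is_chart (mtop M) c \<and>
     (\<forall>d\<in>matlas M. smooth_transition c d \<and> smooth_transition d c)}"

definition prod_manifold ::
    "('m, 'e::euclidean_space) manifold \<Rightarrow> ('n, 'f::euclidean_space) manifold
      \<Rightarrow> ('m \<times> 'n, 'e \<times> 'f) manifold" where
  "prod_manifold M N =
     \<lparr>mtop = prod_topology (mtop M) (mtop N),
      matlas = (\<lambda>(c, d). (cdom c \<times> cdom d, map_prod (cmap c) (cmap d))) ` (matlas M \<times> matlas N)\<rparr>"

definition smooth_map ::
    "('m, 'e::euclidean_space) manifold \<Rightarrow> ('n, 'f::euclidean_space) manifold
      \<Rightarrow> ('m \<Rightarrow> 'n) \<Rightarrow> bool" where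
  "smooth_map M N F \<longleftrightarrow>
     continuous_map (mtop M) (mtop N) F \<and>
     (\<forall>c\<in>matlas M. \<forall>d\<in>matlas N.
        smooth_on (cmap c ` {p \<in> cdom c. F p \<in> cdom d}) (cmap d \<circ> F \<circ> cinv c))"

text \<open>
  Functions on \<open>M\<close> are represented by functions on the whole type that vanish off \<open>M\<close>,
  so that equality of representatives is equality on \<open>M\<close>.
\<close>

definition zero_off :: "('m, 'e) manifold \<Rightarrow> ('m \<Rightarrow> 'a::zero) \<Rightarrow> 'm \<Rightarrow> 'a" where
  "zero_off M f = (\<lambda>p. if p \<in> points M then f p else 0)"

definition smooth_funs :: "('m, 'e::euclidean_space) manifold \<Rightarrow> ('m \<Rightarrow> real) set" where
  "smooth_funs M = {f. (\<forall>p. p \<notin> points M \<longrightarrow> f p = 0) \<and>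
     (\<forall>c\<in>matlas M. smooth_on (cmap c ` cdom c) (f \<circ> cinv c))}"

section \<open>Tangent vectors and vector fields\<close>

text \<open>Pointwise scalar multiplication; the pointwise additive structure is that of
  \<^theory>\<open>HOL-Library.Function_Algebras\<close>.\<close>

instantiation "fun" :: (type, real_vector) real_vector
begin

definition scaleR_fun :: "real \<Rightarrow> ('a \<Rightarrow> 'b) \<Rightarrow> 'a \<Rightarrow> 'b" where
  "scaleR_fun a f = (\<lambda>x. a *\<^sub>R f x)"

instance
  by standard
    (simp_all add: scaleR_fun_def plus_fun_def fun_eq_iff scaleR_add_right scaleR_add_left)

end

definition linear_on_subspace ::
    "'a::real_vector set \<Rightarrow> ('a \<Rightarrow> 'b::real_vector) \<Rightarrow> bool" where
  "linear_on_subspace V f \<longleftrightarrow>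
     (\<forall>u\<in>V. \<forall>v\<in>V. f (u + v) = f u + f v) \<and> (\<forall>a. \<forall>u\<in>V. f (a *\<^sub>R u) = a *\<^sub>R f u)"

type_synonym 'm tvec = "('m \<Rightarrow> real) \<Rightarrow> real"

type_synonym 'm vfield = "'m \<Rightarrow> 'm tvec"

text \<open>The derivations of \<open>C\<^sup>\<infinity>(M)\<close> at \<open>p\<close>, extended by 0 to non-smooth functions.\<close>

definition tangent_space :: "('m, 'e::euclidean_space) manifold \<Rightarrow> 'm \<Rightarrow> 'm tvec set" where
  "tangent_space M p = {v.
     linear_on_subspace (smooth_funs M) v \<and>
     (\<forall>f\<in>smooth_funs M. \<forall>h\<in>smooth_funs M. v (f * h) = f p * v h + h p * v f) \<and>
     (\<forall>f. f \<notin> smooth_funs M \<longrightarrow> v f = 0)}"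

definition differential ::
    "('m, 'e::euclidean_space) manifold \<Rightarrow> ('n, 'f::euclidean_space) manifold
      \<Rightarrow> ('m \<Rightarrow> 'n) \<Rightarrow> 'm tvec \<Rightarrow> 'n tvec" where
  "differential M N F v =
     (\<lambda>h. if h \<in> smooth_funs N then v (zero_off M (h \<circ> F)) else 0)"

text \<open>The tangent vector at \<open>q \<in> cdom c\<close> with coordinate vector \<open>w\<close> in the chart \<open>c\<close>,
  i.e. \<open>\<Sum>\<^sub>i w\<^sub>i \<partial>/\<partial>x\<^sub>i\<close> at \<open>q\<close>.\<close>

definition coord_vector ::
    "('m, 'e::euclidean_space) manifold \<Rightarrow> ('m, 'e) chart \<Rightarrow> 'm \<Rightarrow> 'e \<Rightarrow> 'm tvec" where
  "coord_vector M c q w =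
     (\<lambda>f. if f \<in> smooth_funs M then frechet_derivative (f \<circ> cinv c) (at (cmap c q)) w else 0)"

definition act_on_fun :: "'m vfield \<Rightarrow> ('m \<Rightarrow> real) \<Rightarrow> 'm \<Rightarrow> real" where
  "act_on_fun X f = (\<lambda>p. X p f)"

definition vector_fields :: "('m, 'e::euclidean_space) manifold \<Rightarrow> 'm vfield set" where
  "vector_fields M = {X.
     (\<forall>p\<in>points M. X p \<in> tangent_space M p) \<and>
     (\<forall>p. p \<notin> points M \<longrightarrow> X p = 0) \<and>
     (\<forall>f\<in>smooth_funs M. act_on_fun X f \<in> smooth_funs M)}"

definition lie_bracket :: "'m vfield \<Rightarrow> 'm vfield \<Rightarrow> 'm vfield" where
  "lie_bracket X Y = (\<lambda>p f. X p (act_on_fun Y f) - Y p (act_on_fun X f))"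

section \<open>Tensor fields and differential forms\<close>

type_synonym 'm form1 = "'m \<Rightarrow> 'm tvec \<Rightarrow> real"

type_synonym 'm form2 = "'m \<Rightarrow> 'm tvec \<Rightarrow> 'm tvec \<Rightarrow> real"

type_synonym 'm endo = "'m \<Rightarrow> 'm tvec \<Rightarrow> 'm tvec"

definition eval1 ::
    "('m, 'e) manifold \<Rightarrow> 'm form1 \<Rightarrow> 'm vfield \<Rightarrow> 'm \<Rightarrow> real" where
  "eval1 M \<theta> X = zero_off M (\<lambda>p. \<theta> p (X p))"

definition eval2 ::
    "('m, 'e) manifold \<Rightarrow> 'm form2 \<Rightarrow> 'm vfield \<Rightarrow> 'm vfield \<Rightarrow> 'm \<Rightarrow> real" where
  "eval2 M \<omega> X Y = zero_off M (\<lambda>p. \<omega> p (X p) (Y p))"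

definition smooth_1form :: "('m, 'e::euclidean_space) manifold \<Rightarrow> 'm form1 \<Rightarrow> bool" where
  "smooth_1form M \<theta> \<longleftrightarrow>
     (\<forall>p\<in>points M. linear_on_subspace (tangent_space M p) (\<theta> p)) \<and>
     (\<forall>X\<in>vector_fields M. eval1 M \<theta> X \<in> smooth_funs M)"

definition smooth_bilinear :: "('m, 'e::euclidean_space) manifold \<Rightarrow> 'm form2 \<Rightarrow> bool" where
  "smooth_bilinear M b \<longleftrightarrow>
     (\<forall>p\<in>points M. \<forall>u\<in>tangent_space M p.
        linear_on_subspace (tangent_space M p) (\<lambda>v. b p u v) \<and>
        linear_on_subspace (tangent_space M p) (\<lambda>v. b p v u)) \<and>
     (\<forall>X\<in>vector_fields M. \<forall>Y\<in>vector_fields M. eval2 M b X Y \<in> smooth_funs M)"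

text \<open>Invariant formulas for the exterior derivative of 1-forms and 2-forms, and the
  matching (shuffle) normalisation of the wedge product.\<close>

definition ext_deriv1 ::
    "('m, 'e::euclidean_space) manifold \<Rightarrow> 'm form1 \<Rightarrow> 'm vfield \<Rightarrow> 'm vfield \<Rightarrow> 'm \<Rightarrow> real" where
  "ext_deriv1 M \<theta> X Y =
     act_on_fun X (eval1 M \<theta> Y) - act_on_fun Y (eval1 M \<theta> X) - eval1 M \<theta> (lie_bracket X Y)"

definition ext_deriv2 ::
    "('m, 'e::euclidean_space) manifold \<Rightarrow> 'm form2
      \<Rightarrow> 'm vfield \<Rightarrow> 'm vfield \<Rightarrow> 'm vfield \<Rightarrow> 'm \<Rightarrow> real" where
  "ext_deriv2 M \<omega> X Y Z =
     act_on_fun X (eval2 M \<omega> Y Z) - act_on_fun Y (eval2 M \<omega> X Z) + act_on_fun Z (eval2 M \<omega> X Y)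
     - eval2 M \<omega> (lie_bracket X Y) Z + eval2 M \<omega> (lie_bracket X Z) Y
     - eval2 M \<omega> (lie_bracket Y Z) X"

definition wedge12 ::
    "('m, 'e::euclidean_space) manifold \<Rightarrow> 'm form1 \<Rightarrow> 'm form2
      \<Rightarrow> 'm vfield \<Rightarrow> 'm vfield \<Rightarrow> 'm vfield \<Rightarrow> 'm \<Rightarrow> real" where
  "wedge12 M \<theta> \<omega> X Y Z =
     eval1 M \<theta> X * eval2 M \<omega> Y Z - eval1 M \<theta> Y * eval2 M \<omega> X Z + eval1 M \<theta> Z * eval2 M \<omega> X Y"

definition closed_1form :: "('m, 'e::euclidean_space) manifold \<Rightarrow> 'm form1 \<Rightarrow> bool" where
  "closed_1form M \<theta> \<longleftrightarrow>
     smooth_1form M \<theta> \<and>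
     (\<forall>X\<in>vector_fields M. \<forall>Y\<in>vector_fields M. ext_deriv1 M \<theta> X Y = 0)"

section \<open>Hermitian, Kaehler and locally conformally Kaehler manifolds\<close>

definition riemannian_metric :: "('m, 'e::euclidean_space) manifold \<Rightarrow> 'm form2 \<Rightarrow> bool" where
  "riemannian_metric M g \<longleftrightarrow>
     smooth_bilinear M g \<and>
     (\<forall>p\<in>points M. \<forall>u\<in>tangent_space M p. \<forall>v\<in>tangent_space M p. g p u v = g p v u) \<and>
     (\<forall>p\<in>points M. \<forall>u\<in>tangent_space M p. u \<noteq> 0 \<longrightarrow> g p u u > 0)"

definition almost_complex_structure ::
    "('m, 'e::euclidean_space) manifold \<Rightarrow> 'm endo \<Rightarrow> bool" where
  "almost_complex_structure M J \<longleftrightarrow>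
     (\<forall>p\<in>points M. linear_on_subspace (tangent_space M p) (J p) \<and>
        (\<forall>v\<in>tangent_space M p. J p v \<in> tangent_space M p \<and> J p (J p v) = - v)) \<and>
     (\<forall>X\<in>vector_fields M. zero_off M (\<lambda>p. J p (X p)) \<in> vector_fields M)"

text \<open>
  Integrability: around every point there are coordinates in which \<open>J\<close> is a constant linear
  endomorphism \<open>J0\<close> of the model space.  Then \<open>J0\<close> squares to \<open>-1\<close>, and after a linear change
  of coordinates it is multiplication by \<open>\<i>\<close>; these charts form a holomorphic atlas inducing \<open>J\<close>.
\<close>

definition integrable_structure ::
    "('m, 'e::euclidean_space) manifold \<Rightarrow> 'm endo \<Rightarrow> bool" where
  "integrable_structure M J \<longleftrightarrow>
     (\<forall>p\<in>points M. \<exists>c\<in>maximal_atlas M. p \<in> cdom c \<and>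
        (\<exists>J0. linear J0 \<and>
           (\<forall>q\<in>cdom c. \<forall>w. J q (coord_vector M c q w) = coord_vector M c q (J0 w))))"

definition hermitian_manifold ::
    "('m, 'e::euclidean_space) manifold \<Rightarrow> 'm form2 \<Rightarrow> 'm endo \<Rightarrow> bool" where
  "hermitian_manifold M g J \<longleftrightarrow>
     smooth_manifold M \<and> riemannian_metric M g \<and>
     almost_complex_structure M J \<and> integrable_structure M J \<and>
     (\<forall>p\<in>points M. \<forall>u\<in>tangent_space M p. \<forall>v\<in>tangent_space M p.
        g p (J p u) v = - g p u (J p v))"

definition fundamental_form :: "'m form2 \<Rightarrow> 'm endo \<Rightarrow> 'm form2" where
  "fundamental_form g J = (\<lambda>p u v. g p (J p u) v)"

definition lck_manifold ::
    "('m, 'e::euclidean_space) manifold \<Rightarrow> 'm form2 \<Rightarrow> 'm endo \<Rightarrow> bool" where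
  "lck_manifold M g J \<longleftrightarrow>
     hermitian_manifold M g J \<and>
     (\<exists>\<theta>. closed_1form M \<theta> \<and>
        (\<forall>X\<in>vector_fields M. \<forall>Y\<in>vector_fields M. \<forall>Z\<in>vector_fields M.
           ext_deriv2 M (fundamental_form g J) X Y Z
             = - 2 *\<^sub>R wedge12 M \<theta> (fundamental_form g J) X Y Z))"

definition kaehler_manifold ::
    "('m, 'e::euclidean_space) manifold \<Rightarrow> 'm form2 \<Rightarrow> 'm endo \<Rightarrow> bool" where
  "kaehler_manifold M g J \<longleftrightarrow>
     hermitian_manifold M g J \<and>
     (\<forall>X\<in>vector_fields M. \<forall>Y\<in>vector_fields M. \<forall>Z\<in>vector_fields M.
        ext_deriv2 M (fundamental_form g J) X Y Z = 0)"

section \<open>Lie groups and their actions\<close>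

definition lie_group :: "('g, 'k) monoid_scheme \<Rightarrow> ('g, 'b::euclidean_space) manifold \<Rightarrow> bool" where
  "lie_group G N \<longleftrightarrow>
     group G \<and> smooth_manifold N \<and> points N = carrier G \<and>
     smooth_map (prod_manifold N N) N (\<lambda>(a, b). a \<otimes>\<^bsub>G\<^esub> b) \<and>
     smooth_map N N (\<lambda>a. inv\<^bsub>G\<^esub> a)"

definition lie_algebra ::
    "('g, 'k) monoid_scheme \<Rightarrow> ('g, 'b::euclidean_space) manifold \<Rightarrow> 'g vfield set" where
  "lie_algebra G N = {X \<in> vector_fields N.
     \<forall>a\<in>carrier G. \<forall>b\<in>carrier G.
       differential N N (\<lambda>x. a \<otimes>\<^bsub>G\<^esub> x) (X b) = X (a \<otimes>\<^bsub>G\<^esub> b)}"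

definition lie_center ::
    "('g, 'k) monoid_scheme \<Rightarrow> ('g, 'b::euclidean_space) manifold \<Rightarrow> 'g vfield set" where
  "lie_center G N = {X \<in> lie_algebra G N. \<forall>Y\<in>lie_algebra G N. lie_bracket X Y = 0}"

definition smooth_action ::
    "('g, 'k) monoid_scheme \<Rightarrow> ('g, 'b::euclidean_space) manifold
      \<Rightarrow> ('m, 'e::euclidean_space) manifold \<Rightarrow> ('g \<Rightarrow> 'm \<Rightarrow> 'm) \<Rightarrow> bool" where
  "smooth_action G N M \<phi> \<longleftrightarrow>
     group_action G (points M) \<phi> \<and> smooth_map (prod_manifold N M) M (\<lambda>(a, p). \<phi> a p)"

definition preserves_metric ::
    "('g, 'k) monoid_scheme \<Rightarrow> ('m, 'e::euclidean_space) manifold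
      \<Rightarrow> ('g \<Rightarrow> 'm \<Rightarrow> 'm) \<Rightarrow> 'm form2 \<Rightarrow> bool" where
  "preserves_metric G M \<phi> g \<longleftrightarrow>
     (\<forall>a\<in>carrier G. \<forall>p\<in>points M. \<forall>u\<in>tangent_space M p. \<forall>v\<in>tangent_space M p.
        g (\<phi> a p) (differential M M (\<phi> a) u) (differential M M (\<phi> a) v) = g p u v)"

definition preserves_endo ::
    "('g, 'k) monoid_scheme \<Rightarrow> ('m, 'e::euclidean_space) manifold
      \<Rightarrow> ('g \<Rightarrow> 'm \<Rightarrow> 'm) \<Rightarrow> 'm endo \<Rightarrow> bool" where
  "preserves_endo G M \<phi> J \<longleftrightarrow>
     (\<forall>a\<in>carrier G. \<forall>p\<in>points M. \<forall>v\<in>tangent_space M p.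
        differential M M (\<phi> a) (J p v) = J (\<phi> a p) (differential M M (\<phi> a) v))"

end

theory Submission
  imports Defs
begin

text \<open>
  Let \<open>\<omega>\<close> be the fundamental form, \<open>\<theta>\<close> the Lee form, and let \<open>C\<close> be the fundamental field of a central
  element of the Lie algebra. Since \<open>G\<close> is connected, \<open>C\<close> is \<open>G\<close>-invariant, so it commutes with all
  fundamental fields \<open>A\<close>, \<open>B\<close>; as these preserve \<open>\<omega>\<close>, the form \<open>d\<omega>\<close> satisfies
  \<open>d\<omega>(A, B, C) = \<omega>([A, B], C) = A (\<omega>(B, C))\<close>. The functions \<open>\<theta>(B)\<close> and \<open>\<theta>(C)\<close> are constant because
  \<open>\<theta>\<close> is closed and invariant. If both vanish, then \<open>d\<omega> = -2 \<theta> \<and> \<omega>\<close> gives \<open>A f = -2 \<theta>(A) f\<close> for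
  \<open>f = \<omega>(B, C)\<close>, and evaluating this at the extrema of \<open>f\<close> on the compact manifold shows \<open>f = 0\<close>.
  Hence, if \<open>\<theta>(C) = 0\<close>, then \<open>\<omega>(\<cdot>, C)\<close> is a multiple of \<open>\<theta>\<close> at each point. As \<open>C\<close> is determined by its
  value at one point and the action is effective, the center embeds into the plane via
  \<open>\<theta>(C)\<close> and \<open>\<omega>(v, C)\<close>, where \<open>v\<close> is a fixed vector with \<open>\<theta>(v) \<noteq> 0\<close>.
\<close>

section \<open>Calculus of smooth maps\<close>

text \<open>The invariance of \<open>\<theta>\<close> is no hypothesis. It is recovered from that of
  d\<omega>: wedging 1-forms with \<omega> is injective in real dimension above 2, and d\<omega>
  \<noteq> 0 forces such a dimension. Two facts that one usually reads off from M = G/H and the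
  exponential map account for much of the length. The fundamental fields span every tangent space:
  this rests on transitivity and on compactness of \<open>G\<close>, since an orbit map of deficient
  rank would have a nowhere dense piece, finitely many translates of which cover \<open>M\<close>. A
  central element with vanishing fundamental field is zero: this rests on effectiveness, since along
  a nonzero field the orbit functions could not separate group elements. Flows and one-parameter
  subgroups are replaced by a family of diffeomorphisms parametrised by one chart of the group at
  the identity. Infinitesimal statements are derivatives of this family at the identity, and
  brackets are derivatives of pulled-back fields along it. Tangent vectors are derivations of the
  global smooth functions, so Hadamard's lemma and bump functions are the bridge to
  coordinates.\<close>

lemma frechet_derivative_cong_open:
  assumes "open S" "x \<in> S" "\<And>y. y \<in> S \<Longrightarrow> f y = g y"
  shows "frechet_derivative f (at x) = frechet_derivative g (at x)"
proof -
  have "(f has_derivative D) (at x) \<longleftrightarrow> (g has_derivative D) (at x)" for D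
    using has_derivative_transform_within_open[of f D x UNIV S g]
      has_derivative_transform_within_open[of g D x UNIV S f] assms by auto
  then show ?thesis by (simp add: frechet_derivative_def)
qed

lemma frechet_derivative_eqI: "(f has_derivative D) (at x) \<Longrightarrow> frechet_derivative f (at x) = D"
  by (metis frechet_derivative_at)

section \<open>Maps of class C^k\<close>

lemma k_smooth_on_cong:
  assumes "open S" "\<And>x. x \<in> S \<Longrightarrow> f x = g x" "k_smooth_on k S f"
  shows "k_smooth_on k S g"
  using assms(2,3)
proof (induction k arbitrary: f g)
  case 0
  then show ?case by (simp add: continuous_on_eq)
next
  case (Suc k)
  have "g differentiable (at x)" if "x \<in> S" for x
    using Suc.prems that assms(1) has_derivative_transform_within_open[of f _ x UNIV S g]
    unfolding differentiable_def k_smooth_on.simps by meson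
  moreover have "k_smooth_on k S (\<lambda>x. frechet_derivative g (at x) v)" for v
  proof (rule Suc.IH)
    show "frechet_derivative f (at x) v = frechet_derivative g (at x) v" if "x \<in> S" for x
      using frechet_derivative_cong_open[OF assms(1) that, of f g] Suc.prems(1) by simp
    show "k_smooth_on k S (\<lambda>x. frechet_derivative f (at x) v)" using Suc.prems(2) by simp
  qed
  ultimately show ?case by simp
qed

lemma k_smooth_on_SucI:
  assumes "open S" "\<And>x. x \<in> S \<Longrightarrow> (f has_derivative D x) (at x)"
    "\<And>v. k_smooth_on k S (\<lambda>x. D x v)"
  shows "k_smooth_on (Suc k) S f"
proof -
  have "k_smooth_on k S (\<lambda>x. frechet_derivative f (at x) v)" for v
    by (rule k_smooth_on_cong[OF assms(1) _ assms(3)[of v]])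
      (simp add: frechet_derivative_eqI[OF assms(2)])
  then show ?thesis using assms(2) by (auto simp: differentiable_def)
qed

lemma k_smooth_on_SucD:
  assumes "k_smooth_on (Suc k) S f"
  shows "x \<in> S \<Longrightarrow> (f has_derivative frechet_derivative f (at x)) (at x)"
    and "k_smooth_on k S (\<lambda>x. frechet_derivative f (at x) v)"
  using assms frechet_derivative_works by auto

lemma k_smooth_on_subset: "k_smooth_on k T f \<Longrightarrow> S \<subseteq> T \<Longrightarrow> k_smooth_on k S f"
  by (induction k arbitrary: f) (auto intro: continuous_on_subset)

lemma k_smooth_on_Suc_imp: "k_smooth_on (Suc k) S f \<Longrightarrow> k_smooth_on k S f"
proof (induction k arbitrary: f)
  case 0
  then show ?case
    by (auto intro!: continuous_at_imp_continuous_on differentiable_imp_continuous_within)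
next
  case (Suc k)
  show ?case unfolding k_smooth_on.simps
    using Suc.IH Suc.prems unfolding k_smooth_on.simps(2)[of "Suc k"] by blast
qed

lemma k_smooth_on_const: "open S \<Longrightarrow> k_smooth_on k S (\<lambda>x. c)"
proof (induction k arbitrary: c)
  case (Suc k)
  then show ?case by (intro k_smooth_on_SucI[where D = "\<lambda>_ _. 0"]) auto
qed simp

lemma k_smooth_on_bounded_linear:
  assumes "open S" "bounded_linear L"
  shows "k_smooth_on k S f \<Longrightarrow> k_smooth_on k S (\<lambda>x. L (f x))"
proof (induction k arbitrary: f)
  case 0
  then show ?case using bounded_linear.continuous_on[OF assms(2)] by simp
next
  case (Suc k)
  show ?case
  proof (rule k_smooth_on_SucI[where D = "\<lambda>x v. L (frechet_derivative f (at x) v)"])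
    show "k_smooth_on k S (\<lambda>x. L (frechet_derivative f (at x) v))" for v
      by (intro Suc.IH k_smooth_on_SucD(2) Suc.prems)
  qed (use assms in \<open>auto intro!: bounded_linear.has_derivative[OF assms(2)]
      k_smooth_on_SucD(1)[OF Suc.prems] simp del: k_smooth_on.simps\<close>)
qed

lemma k_smooth_on_add:
  assumes "open S"
  shows "k_smooth_on k S f \<Longrightarrow> k_smooth_on k S g \<Longrightarrow> k_smooth_on k S (\<lambda>x. f x + g x)"
proof (induction k arbitrary: f g)
  case 0
  then show ?case by (auto intro: continuous_on_add)
next
  case (Suc k)
  show ?case
  proof (rule k_smooth_on_SucI[where
        D = "\<lambda>x v. frechet_derivative f (at x) v + frechet_derivative g (at x) v"])
    show "k_smooth_on k S (\<lambda>x. frechet_derivative f (at x) v + frechet_derivative g (at x) v)" for v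
      by (intro Suc.IH k_smooth_on_SucD(2) Suc.prems)
  qed (use assms in \<open>auto intro!: has_derivative_add k_smooth_on_SucD(1)[OF Suc.prems(1)]
      k_smooth_on_SucD(1)[OF Suc.prems(2)] simp del: k_smooth_on.simps\<close>)
qed

lemma k_smooth_on_bilinear:
  assumes "open S" and B: "bounded_bilinear B"
  shows "k_smooth_on k S f \<Longrightarrow> k_smooth_on k S g \<Longrightarrow> k_smooth_on k S (\<lambda>x. B (f x) (g x))"
proof (induction k arbitrary: f g)
  case 0
  then show ?case using bounded_bilinear.continuous_on[OF B] by auto
next
  case (Suc k)
  let ?f = "\<lambda>x. frechet_derivative f (at x)" and ?g = "\<lambda>x. frechet_derivative g (at x)"
  show ?case
  proof (rule k_smooth_on_SucI[where D = "\<lambda>x v. B (f x) (?g x v) + B (?f x v) (g x)"])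
    show "k_smooth_on k S (\<lambda>x. B (f x) (?g x v) + B (?f x v) (g x))" for v
      by (intro k_smooth_on_add assms(1) Suc.IH k_smooth_on_SucD(2) Suc.prems
          k_smooth_on_Suc_imp[OF Suc.prems(1)] k_smooth_on_Suc_imp[OF Suc.prems(2)])
  qed (use assms in \<open>auto intro!: bounded_bilinear.FDERIV[OF B]
      k_smooth_on_SucD(1)[OF Suc.prems(1)] k_smooth_on_SucD(1)[OF Suc.prems(2)]
      simp del: k_smooth_on.simps\<close>)
qed

lemma k_smooth_on_sum:
  assumes "open S" "finite I" "\<And>i. i \<in> I \<Longrightarrow> k_smooth_on k S (f i)"
  shows "k_smooth_on k S (\<lambda>x. \<Sum>i\<in>I. f i x)"
  using assms(2,3)
  by (induction I) (auto intro: k_smooth_on_const k_smooth_on_add assms(1))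

text \<open>By the chain rule the derivative of \<open>g\<close> is taken at a moving point in a
  moving direction. Expanding the direction in the basis separates the two: each summand is a
  coordinate of the derivative of \<open>f\<close> times a partial derivative of \<open>g\<close>
  composed with \<open>f\<close>, and the induction hypothesis covers the latter.\<close>

lemma k_smooth_on_compose:
  fixes f :: "'a::euclidean_space \<Rightarrow> 'b::euclidean_space"
  assumes "open S"
  shows "k_smooth_on k S f \<Longrightarrow> k_smooth_on k T g \<Longrightarrow> f ` S \<subseteq> T \<Longrightarrow> k_smooth_on k S (\<lambda>x. g (f x))"
proof (induction k arbitrary: g)
  case 0
  then show ?case by (auto intro: continuous_on_compose2)
next
  case (Suc k)
  let ?f = "\<lambda>x. frechet_derivative f (at x)" and ?g = "\<lambda>x. frechet_derivative g (at x)"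
  have dg: "(g has_derivative ?g (f x)) (at (f x))" if "x \<in> S" for x
    using k_smooth_on_SucD(1)[OF Suc.prems(2)] Suc.prems(3) that by blast
  have expand: "?g (f x) w = (\<Sum>i\<in>Basis. (w \<bullet> i) *\<^sub>R ?g (f x) i)" if "x \<in> S" for x w
  proof -
    have lin: "linear (?g (f x))" using has_derivative_linear[OF dg[OF that]] .
    have "?g (f x) w = ?g (f x) (\<Sum>i\<in>Basis. (w \<bullet> i) *\<^sub>R i)" by (simp only: euclidean_representation)
    also have "\<dots> = (\<Sum>i\<in>Basis. (w \<bullet> i) *\<^sub>R ?g (f x) i)"
      by (simp only: linear_sum[OF lin] linear_scale[OF lin])
    finally show ?thesis .
  qed
  show ?case
  proof (rule k_smooth_on_SucI[where D = "\<lambda>x v. \<Sum>i\<in>Basis. (?f x v \<bullet> i) *\<^sub>R ?g (f x) i"])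
    fix x assume x: "x \<in> S"
    have "((\<lambda>x. g (f x)) has_derivative (\<lambda>v. ?g (f x) (?f x v))) (at x)"
      using diff_chain_at[OF k_smooth_on_SucD(1)[OF Suc.prems(1) x] dg[OF x]] by (simp add: comp_def)
    then show "((\<lambda>x. g (f x)) has_derivative (\<lambda>v. \<Sum>i\<in>Basis. (?f x v \<bullet> i) *\<^sub>R ?g (f x) i)) (at x)"
      by (subst expand[OF x, symmetric])
  next
    fix v
    show "k_smooth_on k S (\<lambda>x. \<Sum>i\<in>Basis. (?f x v \<bullet> i) *\<^sub>R ?g (f x) i)"
    proof (rule k_smooth_on_sum[OF assms finite_Basis])
      fix i :: 'b
      have "k_smooth_on k S (\<lambda>x. ?f x v \<bullet> i)"
        by (rule k_smooth_on_bounded_linear[OF assms bounded_linear_inner_left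
              k_smooth_on_SucD(2)[OF Suc.prems(1)]])
      moreover have "k_smooth_on k S (\<lambda>x. ?g (f x) i)"
        by (rule Suc.IH[OF k_smooth_on_Suc_imp[OF Suc.prems(1)] k_smooth_on_SucD(2)[OF Suc.prems(2)] Suc.prems(3)])
      ultimately show "k_smooth_on k S (\<lambda>x. (?f x v \<bullet> i) *\<^sub>R ?g (f x) i)"
        by (rule k_smooth_on_bilinear[OF assms bounded_bilinear_scaleR])
    qed
  qed (fact assms)
qed

section \<open>Smooth maps\<close>

lemma smooth_on_cong:
  "open S \<Longrightarrow> smooth_on S f \<Longrightarrow> (\<And>x. x \<in> S \<Longrightarrow> f x = g x) \<Longrightarrow> smooth_on S g"
  unfolding smooth_on_def using k_smooth_on_cong by blast

lemma smooth_on_subset: "smooth_on T f \<Longrightarrow> S \<subseteq> T \<Longrightarrow> smooth_on S f"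
  unfolding smooth_on_def using k_smooth_on_subset by blast

lemma smooth_on_const: "open S \<Longrightarrow> smooth_on S (\<lambda>x. c)"
  by (simp add: smooth_on_def k_smooth_on_const)

lemma smooth_on_has_derivative:
  "smooth_on S f \<Longrightarrow> x \<in> S \<Longrightarrow> (f has_derivative frechet_derivative f (at x)) (at x)"
  unfolding smooth_on_def by (rule k_smooth_on_SucD(1)[of 0]) auto

lemma smooth_on_frechet_derivative:
  "smooth_on S f \<Longrightarrow> smooth_on S (\<lambda>x. frechet_derivative f (at x) v)"
  unfolding smooth_on_def by (intro allI k_smooth_on_SucD(2)) blast

lemma smooth_on_linear_derivative:
  "smooth_on S f \<Longrightarrow> x \<in> S \<Longrightarrow> linear (frechet_derivative f (at x))"
  using smooth_on_has_derivative has_derivative_linear by blast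

lemma smooth_on_continuous_on: "smooth_on S f \<Longrightarrow> continuous_on S f"
  unfolding smooth_on_def by (metis k_smooth_on.simps(1))

lemma smooth_on_isCont: "smooth_on S f \<Longrightarrow> x \<in> S \<Longrightarrow> isCont f x"
  using smooth_on_has_derivative has_derivative_continuous by blast

lemma smooth_on_bounded_linear:
  "open S \<Longrightarrow> bounded_linear L \<Longrightarrow> smooth_on S f \<Longrightarrow> smooth_on S (\<lambda>x. L (f x))"
  unfolding smooth_on_def by (rule allI, rule k_smooth_on_bounded_linear[of S L _ f]) auto

lemma smooth_on_add:
  "open S \<Longrightarrow> smooth_on S f \<Longrightarrow> smooth_on S g \<Longrightarrow> smooth_on S (\<lambda>x. f x + g x)"
  unfolding smooth_on_def by (rule allI, rule k_smooth_on_add) auto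

lemma smooth_on_scaleR:
  "open S \<Longrightarrow> smooth_on S f \<Longrightarrow> smooth_on S g \<Longrightarrow> smooth_on S (\<lambda>x. f x *\<^sub>R g x)"
  unfolding smooth_on_def by (rule allI, rule k_smooth_on_bilinear[OF _ bounded_bilinear_scaleR]) auto

lemma smooth_on_mult:
  fixes f g :: "_ \<Rightarrow> real"
  shows "open S \<Longrightarrow> smooth_on S f \<Longrightarrow> smooth_on S g \<Longrightarrow> smooth_on S (\<lambda>x. f x * g x)"
  unfolding smooth_on_def by (rule allI, rule k_smooth_on_bilinear[OF _ bounded_bilinear_mult]) auto

lemma smooth_on_inner:
  "open S \<Longrightarrow> smooth_on S f \<Longrightarrow> smooth_on S g \<Longrightarrow> smooth_on S (\<lambda>x. f x \<bullet> g x)"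
  unfolding smooth_on_def by (rule allI, rule k_smooth_on_bilinear[OF _ bounded_bilinear_inner]) auto

lemma smooth_on_sum:
  "open S \<Longrightarrow> finite I \<Longrightarrow> (\<And>i. i \<in> I \<Longrightarrow> smooth_on S (f i)) \<Longrightarrow> smooth_on S (\<lambda>x. \<Sum>i\<in>I. f i x)"
  unfolding smooth_on_def by (rule allI, rule k_smooth_on_sum) auto

lemma smooth_on_minus:
  assumes "open S" "smooth_on S f" "smooth_on S g"
  shows "smooth_on S (\<lambda>x. f x - g x)"
proof -
  have "smooth_on S (\<lambda>x. - 1 *\<^sub>R g x)"
    by (rule smooth_on_scaleR[OF assms(1) smooth_on_const[OF assms(1)] assms(3)])
  then have "smooth_on S (\<lambda>x. f x + - 1 *\<^sub>R g x)" by (rule smooth_on_add[OF assms(1,2)])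
  then show ?thesis by simp
qed

lemma smooth_on_compose:
  fixes f :: "'a::euclidean_space \<Rightarrow> 'b::euclidean_space"
  shows "open S \<Longrightarrow> smooth_on S f \<Longrightarrow> smooth_on T g \<Longrightarrow> f ` S \<subseteq> T \<Longrightarrow> smooth_on S (\<lambda>x. g (f x))"
  unfolding smooth_on_def by (rule allI, rule k_smooth_on_compose[of S _ f T g]) auto

lemma smooth_on_id: "open S \<Longrightarrow> smooth_on S (\<lambda>x. x)"
proof -
  assume S: "open S"
  have "k_smooth_on k S (\<lambda>x. x)" for k
  proof (cases k)
    case (Suc j)
    then show ?thesis using S
      by (auto intro!: k_smooth_on_SucI[where D = "\<lambda>_ v. v"] k_smooth_on_const simp del: k_smooth_on.simps)
  qed simp
  then show ?thesis by (simp add: smooth_on_def)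
qed

lemma smooth_on_linear: "open S \<Longrightarrow> bounded_linear L \<Longrightarrow> smooth_on S L"
  using smooth_on_bounded_linear[of S L "\<lambda>x. x"] smooth_on_id[of S] by simp

lemma smooth_on_Pair:
  fixes f :: "'a::euclidean_space \<Rightarrow> 'b::real_normed_vector" and g :: "'a \<Rightarrow> 'c::real_normed_vector"
  assumes "open S" "smooth_on S f" "smooth_on S g"
  shows "smooth_on S (\<lambda>x. (f x, g x))"
proof -
  have "bounded_linear (\<lambda>x::'b. (x, 0::'c))" "bounded_linear (\<lambda>y::'c. (0::'b, y))"
    by (auto intro!: bounded_linear_Pair bounded_linear_ident bounded_linear_zero)
  then have "smooth_on S (\<lambda>x. (f x, 0::'c) + (0::'b, g x))"
    by (intro smooth_on_add smooth_on_bounded_linear[OF assms(1) _ assms(2)]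
        smooth_on_bounded_linear[OF assms(1) _ assms(3)] assms)
  then show ?thesis by simp
qed

lemma smooth_on_local:
  assumes "\<And>x. x \<in> S \<Longrightarrow> \<exists>T. open T \<and> x \<in> T \<and> smooth_on T f"
  shows "smooth_on S f"
proof -
  have "k_smooth_on k S f" if "\<And>x. x \<in> S \<Longrightarrow> \<exists>T. open T \<and> x \<in> T \<and> k_smooth_on k T f" for k
    using that
  proof (induction k arbitrary: f)
    case 0
    have "isCont f x" if "x \<in> S" for x
      using 0 that by (metis continuous_on_eq_continuous_at k_smooth_on.simps(1))
    then show ?case by (simp add: continuous_at_imp_continuous_on)
  next
    case (Suc k)
    show ?case unfolding k_smooth_on.simps
    proof (intro conjI ballI allI)
      show "f differentiable (at x)" if "x \<in> S" for x using Suc.prems[OF that] by auto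
      show "k_smooth_on k S (\<lambda>x. frechet_derivative f (at x) v)" for v
      proof (rule Suc.IH)
        fix x assume "x \<in> S"
        then obtain T where "open T" "x \<in> T" "k_smooth_on (Suc k) T f" using Suc.prems by blast
        then show "\<exists>T. open T \<and> x \<in> T \<and> k_smooth_on k T (\<lambda>x. frechet_derivative f (at x) v)"
          using k_smooth_on_SucD(2) by blast
      qed
    qed
  qed
  then show ?thesis using assms unfolding smooth_on_def by blast
qed

text \<open>The derivative of \<open>inverse\<close> is a polynomial in \<open>inverse\<close>
  itself, so an induction on the order closes.\<close>

lemma smooth_on_inverse:
  fixes f :: "'a::euclidean_space \<Rightarrow> real"
  assumes "open S" "smooth_on S f" "\<And>x. x \<in> S \<Longrightarrow> f x \<noteq> 0"
  shows "smooth_on S (\<lambda>x. inverse (f x))"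
proof -
  have op: "open (- {0::real})" by auto
  have "k_smooth_on k (- {0}) (inverse :: real \<Rightarrow> real)" for k
  proof (induction k)
    case 0
    then show ?case by (auto intro!: continuous_intros)
  next
    case (Suc k)
    show ?case
    proof (rule k_smooth_on_SucI[OF op, where D = "\<lambda>x v. (- v) * (inverse x * inverse x)"])
      show "(inverse has_derivative (\<lambda>v. - v * (inverse x * inverse x))) (at x)"
        if "x \<in> - {0}" for x :: real
        using has_derivative_inverse'[of x UNIV] that by (simp add: mult.commute mult.left_commute)
      show "k_smooth_on k (- {0}) (\<lambda>x::real. - v * (inverse x * inverse x))" for v
        by (intro k_smooth_on_bilinear[OF op bounded_bilinear_mult] Suc k_smooth_on_const op)
    qed
  qed
  then have "smooth_on (- {0}) (inverse :: real \<Rightarrow> real)" by (simp add: smooth_on_def)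
  then show ?thesis by (rule smooth_on_compose[OF assms(1,2)]) (use assms(3) in auto)
qed

text \<open>Two applications of the mean value theorem: to the increment of \<open>f\<close> along
  \<open>v\<close> as a function of the position along \<open>u\<close>, then to the resulting
  increment of the \<open>u\<close>-derivative along \<open>v\<close>.\<close>

lemma second_difference:
  fixes f :: "'a::euclidean_space \<Rightarrow> real"
  assumes f: "smooth_on S f" and h: "h > 0"
    and sub: "\<And>r s. 0 \<le> r \<Longrightarrow> r \<le> h \<Longrightarrow> 0 \<le> s \<Longrightarrow> s \<le> h \<Longrightarrow> x + r *\<^sub>R u + s *\<^sub>R v \<in> S"
  obtains r s where "0 < r" "r < h" "0 < s" "s < h"
    "f (x + h *\<^sub>R u + h *\<^sub>R v) - f (x + h *\<^sub>R u) - f (x + h *\<^sub>R v) + f x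
      = h * h * frechet_derivative (\<lambda>y. frechet_derivative f (at y) u) (at (x + r *\<^sub>R u + s *\<^sub>R v)) v"
proof -
  let ?D = "\<lambda>y. frechet_derivative f (at y)"
  have line: "((\<lambda>r. k (p r)) has_real_derivative frechet_derivative k (at (p r)) w) (at r)"
    if "smooth_on S k" "p r \<in> S" "(p has_derivative (\<lambda>t. t *\<^sub>R w)) (at r)"
    for k :: "'a \<Rightarrow> real" and p r w
  proof -
    have "((\<lambda>r. k (p r)) has_derivative (\<lambda>t. frechet_derivative k (at (p r)) (t *\<^sub>R w))) (at r)"
      using diff_chain_at[OF that(3) smooth_on_has_derivative[OF that(1,2)]] by (simp add: comp_def)
    moreover have "frechet_derivative k (at (p r)) (t *\<^sub>R w) = frechet_derivative k (at (p r)) w * t" for t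
      using linear_scale[OF smooth_on_linear_derivative[OF that(1,2)]] by simp
    ultimately show ?thesis by (simp add: has_field_derivative_def)
  qed
  have p1: "((\<lambda>r. x + r *\<^sub>R u + s *\<^sub>R v) has_derivative (\<lambda>t. t *\<^sub>R u)) (at r)" for r s
    by (auto intro!: derivative_eq_intros)
  have p2: "((\<lambda>s. x + r *\<^sub>R u + s *\<^sub>R v) has_derivative (\<lambda>t. t *\<^sub>R v)) (at s)" for r s
    by (auto intro!: derivative_eq_intros)
  \<comment> \<open>The summand \<open>0 *\<^sub>R v\<close> makes both terms instances of the path
    in \<open>p1\<close>.\<close>
  define G where "G r = f (x + r *\<^sub>R u + h *\<^sub>R v) - f (x + r *\<^sub>R u + 0 *\<^sub>R v)" for r
  have "\<exists>r. 0 < r \<and> r < h \<and> G h - G 0 = (h - 0) * (?D (x + r *\<^sub>R u + h *\<^sub>R v) u - ?D (x + r *\<^sub>R u + 0 *\<^sub>R v) u)"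
    unfolding G_def
    by (rule MVT2[OF h]) (intro DERIV_diff line[OF f _ p1] sub, use h in auto)
  then obtain r where r: "0 < r" "r < h"
    and G: "G h - G 0 = h * (?D (x + r *\<^sub>R u + h *\<^sub>R v) u - ?D (x + r *\<^sub>R u + 0 *\<^sub>R v) u)" by auto
  have "\<exists>s. 0 < s \<and> s < h \<and> ?D (x + r *\<^sub>R u + h *\<^sub>R v) u - ?D (x + r *\<^sub>R u + 0 *\<^sub>R v) u
     = (h - 0) * frechet_derivative (\<lambda>y. ?D y u) (at (x + r *\<^sub>R u + s *\<^sub>R v)) v"
    by (rule MVT2[OF h]) (intro line[OF smooth_on_frechet_derivative[OF f] _ p2] sub, use r in auto)
  then obtain s where s: "0 < s" "s < h" "?D (x + r *\<^sub>R u + h *\<^sub>R v) u - ?D (x + r *\<^sub>R u + 0 *\<^sub>R v) u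
     = h * frechet_derivative (\<lambda>y. ?D y u) (at (x + r *\<^sub>R u + s *\<^sub>R v)) v" by auto
  show thesis by (rule that[OF r s(1,2)]) (use G s(3) in \<open>simp add: G_def algebra_simps\<close>)
qed

text \<open>The second difference over the parallelogram spanned by \<open>h *\<^sub>R u\<close> and
  \<open>h *\<^sub>R v\<close> is symmetric in \<open>u\<close> and \<open>v\<close>. So the two
  mixed derivatives take a common value at two points near \<open>x\<close>, which continuity
  forbids if they differ at \<open>x\<close>.\<close>

lemma mixed_partials:
  fixes f :: "'a::euclidean_space \<Rightarrow> real"
  assumes S: "open S" "x \<in> S" and f: "smooth_on S f"
  shows "frechet_derivative (\<lambda>y. frechet_derivative f (at y) u) (at x) v
    = frechet_derivative (\<lambda>y. frechet_derivative f (at y) v) (at x) u"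
proof (rule ccontr)
  let ?A = "\<lambda>y. frechet_derivative (\<lambda>y. frechet_derivative f (at y) u) (at y) v"
  let ?B = "\<lambda>y. frechet_derivative (\<lambda>y. frechet_derivative f (at y) v) (at y) u"
  assume "?A x \<noteq> ?B x"
  \<comment> \<open>Half the gap: values closer than \<open>?e\<close> to \<open>?A x\<close> and to
    \<open>?B x\<close> cannot coincide.\<close>
  then have e: "\<bar>?A x - ?B x\<bar> / 2 > 0" (is "?e > 0") by simp
  have "isCont ?A x" "isCont ?B x"
    using smooth_on_isCont[OF smooth_on_frechet_derivative[OF smooth_on_frechet_derivative[OF f]] S(2)] by auto
  then have cA: "\<exists>a>0. \<forall>y. dist y x < a \<longrightarrow> dist (?A y) (?A x) < ?e"
    and cB: "\<exists>a>0. \<forall>y. dist y x < a \<longrightarrow> dist (?B y) (?B x) < ?e"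
    using e unfolding continuous_at_eps_delta by blast+
  obtain a where a: "a > 0" "\<And>y. dist y x < a \<Longrightarrow> dist (?A y) (?A x) < ?e" using cA by blast
  obtain b where b: "b > 0" "\<And>y. dist y x < b \<Longrightarrow> dist (?B y) (?B x) < ?e" using cB by blast
  obtain c where c: "c > 0" "ball x c \<subseteq> S" using S open_contains_ball by blast
  define d where "d = min a (min b c)"
  \<comment> \<open>Steps of length at most \<open>h\<close> along \<open>u\<close> and
    \<open>v\<close> then move \<open>x\<close> by at most \<open>d / 2\<close>; the summand 1 keeps
    \<open>m\<close> positive when both vectors vanish.\<close>
  define m where "m = norm u + norm v + 1"
  define h where "h = d / (2 * m)"
  have d: "d > 0" using a b c by (simp add: d_def)
  have pos: "m > 0" by (simp add: m_def add_nonneg_pos)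
  have h: "h > 0" using d pos by (simp add: h_def)
  have near: "dist (x + r *\<^sub>R u + s *\<^sub>R v) x < d" if "0 \<le> r" "r \<le> h" "0 \<le> s" "s \<le> h" for r s
  proof -
    have "dist (x + r *\<^sub>R u + s *\<^sub>R v) x \<le> norm (r *\<^sub>R u) + norm (s *\<^sub>R v)"
      by (metis add.assoc add_diff_cancel_left' dist_norm norm_triangle_ineq)
    also have "\<dots> \<le> h * norm u + h * norm v" using that by (intro add_mono) (auto intro: mult_right_mono)
    also have "\<dots> \<le> h * m" using h by (simp add: m_def algebra_simps)
    also have "\<dots> = d / 2" using pos by (simp add: h_def)
    also have "\<dots> < d" using d by simp
    finally show ?thesis .
  qed
  have near': "dist (x + s *\<^sub>R v + r *\<^sub>R u) x < d" if "0 \<le> r" "r \<le> h" "0 \<le> s" "s \<le> h" for r s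
    using near[OF that] by (simp add: algebra_simps)
  have in_S: "y \<in> S" if "dist y x < d" for y using that c(2) by (auto simp: d_def dist_commute)
  obtain r s where rs: "0 < r" "r < h" "0 < s" "s < h"
    "f (x + h *\<^sub>R u + h *\<^sub>R v) - f (x + h *\<^sub>R u) - f (x + h *\<^sub>R v) + f x = h * h * ?A (x + r *\<^sub>R u + s *\<^sub>R v)"
    using second_difference[OF f h, of x u v] in_S near by metis
  obtain r' s' where rs': "0 < r'" "r' < h" "0 < s'" "s' < h"
    "f (x + h *\<^sub>R v + h *\<^sub>R u) - f (x + h *\<^sub>R v) - f (x + h *\<^sub>R u) + f x = h * h * ?B (x + r' *\<^sub>R v + s' *\<^sub>R u)"
    using second_difference[OF f h, of x v u] in_S near' by metis
  have "h * h * ?A (x + r *\<^sub>R u + s *\<^sub>R v) = h * h * ?B (x + r' *\<^sub>R v + s' *\<^sub>R u)"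
    using rs(5) rs'(5) by (simp add: algebra_simps)
  then have "?A (x + r *\<^sub>R u + s *\<^sub>R v) = ?B (x + r' *\<^sub>R v + s' *\<^sub>R u)" using h by simp
  moreover have "dist (?A (x + r *\<^sub>R u + s *\<^sub>R v)) (?A x) < ?e"
    by (rule a(2)) (use near[of r s] rs in \<open>simp add: d_def\<close>)
  moreover have "dist (?B (x + r' *\<^sub>R v + s' *\<^sub>R u)) (?B x) < ?e"
    by (rule b(2)) (use near'[of s' r'] rs' in \<open>simp add: d_def\<close>)
  ultimately show False unfolding dist_real_def by argo
qed

text \<open>Product rule for a parameter that occurs twice. It later splits the derivative of a
  pulled-back field into the two halves of a bracket.\<close>

lemma frechet_derivative_diagonal:
  fixes F :: "'a::euclidean_space \<times> 'a \<Rightarrow> real"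
  assumes "F differentiable (at (a, a))"
  shows "frechet_derivative (\<lambda>x. F (x, x)) (at a) w
    = frechet_derivative (\<lambda>x. F (x, a)) (at a) w + frechet_derivative (\<lambda>x. F (a, x)) (at a) w"
proof -
  let ?D = "frechet_derivative F (at (a, a))"
  have D: "(F has_derivative ?D) (at (a, a))" using assms frechet_derivative_works by blast
  have "((\<lambda>x. (x, x)) has_derivative (\<lambda>v. (v, v))) (at a)"
    "((\<lambda>x. (x, a)) has_derivative (\<lambda>v. (v, 0))) (at a)"
    "((\<lambda>x. (a, x)) has_derivative (\<lambda>v. (0, v))) (at a)"
    by (auto intro!: derivative_eq_intros)
  then have "frechet_derivative (\<lambda>x. F (x, x)) (at a) = (\<lambda>v. ?D (v, v))"
    "frechet_derivative (\<lambda>x. F (x, a)) (at a) = (\<lambda>v. ?D (v, 0))"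
    "frechet_derivative (\<lambda>x. F (a, x)) (at a) = (\<lambda>v. ?D (0, v))"
    using diff_chain_at[where g = F and g' = ?D and x = a] D
    by (auto intro!: frechet_derivative_eqI simp: comp_def)
  moreover have "?D (w, w) = ?D (w, 0) + ?D (0, w)"
    using linear_add[OF has_derivative_linear[OF D], of "(w, 0)" "(0, w)"] by simp
  ultimately show ?thesis by simp
qed

lemma frechet_derivative_partial:
  fixes F :: "'a::euclidean_space \<times> 'b::euclidean_space \<Rightarrow> real"
  assumes "F differentiable (at (a, b))"
  shows "frechet_derivative (\<lambda>x. F (x, b)) (at a) = (\<lambda>v. frechet_derivative F (at (a, b)) (v, 0))"
    and "frechet_derivative (\<lambda>y. F (a, y)) (at b) = (\<lambda>v. frechet_derivative F (at (a, b)) (0, v))"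
proof -
  let ?D = "frechet_derivative F (at (a, b))"
  have D: "(F has_derivative ?D) (at (a, b))" using assms frechet_derivative_works by blast
  have "((\<lambda>x. (x, b)) has_derivative (\<lambda>v. (v, 0))) (at a)"
    "((\<lambda>x. (a, x)) has_derivative (\<lambda>v. (0, v))) (at b)"
    by (auto intro!: derivative_eq_intros)
  then show "frechet_derivative (\<lambda>x. F (x, b)) (at a) = (\<lambda>v. ?D (v, 0))"
    "frechet_derivative (\<lambda>y. F (a, y)) (at b) = (\<lambda>v. ?D (0, v))"
    using diff_chain_at[where g = F and g' = ?D] D
    by (auto intro!: frechet_derivative_eqI simp: comp_def)
qed

section \<open>Hadamard's lemma and bump functions\<close>

text \<open>Differentiation under the integral sign reproduces an integral of the same shape, with a
  partial derivative as integrand, so it can be iterated.\<close>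

lemma k_smooth_on_integral:
  fixes F :: "'a::euclidean_space \<times> real \<Rightarrow> real"
  shows "k_smooth_on k UNIV F \<Longrightarrow> k_smooth_on k UNIV (\<lambda>x. integral {0..1} (\<lambda>t. F (x, t)))"
proof (induction k arbitrary: F)
  case 0
  then have "continuous_on (UNIV \<times> cbox 0 1) (\<lambda>(x, t). F (x, t))"
    by (auto intro: continuous_on_subset)
  from integral_continuous_on_param[OF this] show ?case by (simp add: cbox_interval)
next
  case (Suc k)
  let ?D = "\<lambda>p v. frechet_derivative F (at p) (v, 0)"
  note dF = k_smooth_on_SucD(1)[OF Suc.prems, OF UNIV_I]
  have contF: "continuous_on UNIV F"
    using k_smooth_on_subset k_smooth_on_Suc_imp Suc.prems
    by (metis differentiable_imp_continuous_on differentiable_on_def differentiable_at_withinI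
        k_smooth_on.simps(2))
  have part: "((\<lambda>x. F (x, t)) has_derivative ?D (x, t)) (at x)" for x t
  proof -
    have "((\<lambda>x. (x, t)) has_derivative (\<lambda>v. (v, 0))) (at x)" by (auto intro!: derivative_eq_intros)
    from diff_chain_at[OF this dF] show ?thesis by (simp add: comp_def)
  qed
  have bl: "bounded_linear (?D p)" for p
    using has_derivative_bounded_linear[OF part[of "snd p" "fst p"]] by simp
  \<comment> \<open>The Leibniz rule wants the partial derivative as a continuous family of bounded
    linear maps. In finite dimension continuity on each basis vector suffices.\<close>
  define B where "B = (\<lambda>x t. Blinfun (?D (x, t)))"
  have B: "blinfun_apply (B x t) = ?D (x, t)" for x t by (simp add: B_def bounded_linear_Blinfun_apply bl)
  have contD: "continuous_on UNIV (\<lambda>p. ?D p v)" for v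
  proof -
    have "k_smooth_on 0 UNIV (\<lambda>p. ?D p v)"
      using k_smooth_on_SucD(2)[OF Suc.prems, of "(v, 0)"]
      by (induction k) (use k_smooth_on_Suc_imp in blast)+
    then show ?thesis by simp
  qed
  have "continuous_on UNIV (\<lambda>p. B (fst p) (snd p))"
    unfolding continuous_on_eq_continuous_within
  proof (intro ballI continuous_blinfun_componentwiseI1)
    show "continuous (at p) (\<lambda>p. blinfun_apply (B (fst p) (snd p)) i)" for p i
      using contD[of i] by (cases p) (simp add: B continuous_on_eq_continuous_within)
  qed
  then have contB: "continuous_on (UNIV \<times> cbox 0 1) (\<lambda>(x, t). B x t)"
    by (auto simp: case_prod_beta intro: continuous_on_subset)
  have "((\<lambda>x. integral (cbox 0 1) (\<lambda>t. F (x, t))) has_derivative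
      blinfun_apply (integral (cbox 0 1) (B x))) (at x within UNIV)" for x
  proof (rule leibniz_rule[OF _ _ contB])
    show "((\<lambda>x. F (x, t)) has_derivative blinfun_apply (B x t)) (at x within UNIV)" for x t
      using part by (simp add: B)
    show "(\<lambda>t. F (x, t)) integrable_on cbox 0 1" for x
      by (intro integrable_continuous continuous_on_compose2[OF contF] continuous_intros) auto
  qed auto
  moreover have "blinfun_apply (integral (cbox 0 1) (B x)) v = integral {0..1} (\<lambda>t. ?D (x, t) v)" for x v
  proof -
    have "B x integrable_on cbox 0 1"
      by (rule integrable_continuous)
        (use continuous_on_compose2[OF contB, of "cbox 0 1" "\<lambda>t. (x, t)"]
          continuous_on_Pair[OF continuous_on_const continuous_on_id, of "{0..1::real}" x] in
          \<open>auto simp: image_subset_iff cbox_interval\<close>)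
    then show ?thesis by (simp add: blinfun_apply_integral B cbox_interval)
  qed
  ultimately have "((\<lambda>x. integral {0..1} (\<lambda>t. F (x, t))) has_derivative
      (\<lambda>v. integral {0..1} (\<lambda>t. ?D (x, t) v))) (at x)" for x
    by (metis (no_types, lifting) box_real(2) ext)
  then show ?case
    by (rule k_smooth_on_SucI[OF open_UNIV])
      (rule Suc.IH[OF k_smooth_on_SucD(2)[OF Suc.prems]])
qed

text \<open>The function \<open>G i\<close> is the mean of the partial derivative in direction
  \<open>i\<close> over the segment from \<open>a\<close> to \<open>x\<close>; the identity is the
  fundamental theorem of calculus along that segment.\<close>

lemma hadamard:
  fixes f :: "'a::euclidean_space \<Rightarrow> real"
  assumes f: "smooth_on UNIV f"
  obtains G where "\<And>i. smooth_on UNIV (G i)"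
    "\<And>x. f x = f a + (\<Sum>i\<in>Basis. ((x - a) \<bullet> i) * G i x)"
proof
  define F where "F i = (\<lambda>p::'a \<times> real. frechet_derivative f (at (a + snd p *\<^sub>R (fst p - a))) i)" for i
  define G where "G i = (\<lambda>x. integral {0..1} (\<lambda>t. F i (x, t)))" for i
  have "smooth_on UNIV (\<lambda>p::'a \<times> real. a + snd p *\<^sub>R (fst p - a))"
    by (intro smooth_on_add smooth_on_scaleR smooth_on_minus smooth_on_const smooth_on_linear
        bounded_linear_fst bounded_linear_snd open_UNIV)
  then have "smooth_on UNIV (F i)" for i unfolding F_def
    by (rule smooth_on_compose[OF open_UNIV _ smooth_on_frechet_derivative[OF f]]) simp
  then show "smooth_on UNIV (G i)" for i
    unfolding smooth_on_def G_def using k_smooth_on_integral by blast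
  show "f x = f a + (\<Sum>i\<in>Basis. ((x - a) \<bullet> i) * G i x)" for x
  proof -
    have "((\<lambda>t. f (a + t *\<^sub>R (x - a))) has_vector_derivative (\<Sum>i\<in>Basis. ((x - a) \<bullet> i) * F i (x, t)))
        (at t within {0..1})" for t
    proof -
      let ?p = "a + t *\<^sub>R (x - a)"
      let ?D = "frechet_derivative f (at ?p)"
      have lin: "linear ?D" using smooth_on_linear_derivative[OF f] by simp
      have "((\<lambda>t. a + t *\<^sub>R (x - a)) has_derivative (\<lambda>s. s *\<^sub>R (x - a))) (at t within {0..1})"
        by (auto intro!: derivative_eq_intros)
      from has_derivative_compose[OF this smooth_on_has_derivative[OF f UNIV_I]]
      have "((\<lambda>t. f (a + t *\<^sub>R (x - a))) has_derivative (\<lambda>s. ?D (s *\<^sub>R (x - a)))) (at t within {0..1})" .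
      moreover have "?D (s *\<^sub>R (x - a)) = s *\<^sub>R (\<Sum>i\<in>Basis. ((x - a) \<bullet> i) * F i (x, t))" for s
      proof -
        have "?D (x - a) = ?D (\<Sum>i\<in>Basis. ((x - a) \<bullet> i) *\<^sub>R i)" by (simp only: euclidean_representation)
        also have "\<dots> = (\<Sum>i\<in>Basis. ((x - a) \<bullet> i) * F i (x, t))"
          by (simp add: linear_sum[OF lin] linear_scale[OF lin] F_def)
        finally show ?thesis by (simp add: linear_scale[OF lin])
      qed
      ultimately show ?thesis by (simp add: has_vector_derivative_def)
    qed
    then have "((\<lambda>t. \<Sum>i\<in>Basis. ((x - a) \<bullet> i) * F i (x, t)) has_integral
        f (a + 1 *\<^sub>R (x - a)) - f (a + 0 *\<^sub>R (x - a))) {0..1}"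
      by (intro fundamental_theorem_of_calculus) auto
    moreover have "((\<lambda>t. \<Sum>i\<in>Basis. ((x - a) \<bullet> i) * F i (x, t)) has_integral
        (\<Sum>i\<in>Basis. ((x - a) \<bullet> i) * G i x)) {0..1}"
    proof (intro has_integral_sum has_integral_mult_right finite_Basis)
      fix i :: 'a
      have "continuous_on {0..1} (\<lambda>t. F i (x, t))"
        by (rule continuous_on_compose2[OF smooth_on_continuous_on[OF \<open>smooth_on UNIV (F i)\<close>]])
          (auto intro!: continuous_intros)
      then show "((\<lambda>t. F i (x, t)) has_integral G i x) {0..1}"
        unfolding G_def by (intro integrable_integral integrable_continuous_real)
    qed
    ultimately have "f (a + 1 *\<^sub>R (x - a)) - f (a + 0 *\<^sub>R (x - a)) = (\<Sum>i\<in>Basis. ((x - a) \<bullet> i) * G i x)"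
      by (rule has_integral_unique)
    then show ?thesis by simp
  qed
qed

text \<open>The power of \<open>inverse t\<close> yields a family closed under differentiation: the
  derivative of member \<open>n\<close> combines members \<open>n + 1\<close> and
  \<open>n + 2\<close>, so one induction proves all members smooth.\<close>

definition flat_fun :: "nat \<Rightarrow> real \<Rightarrow> real" where
  "flat_fun n t = (if t \<le> 0 then 0 else inverse t ^ n * exp (- inverse t))"

lemma flat_fun_tendsto: "((\<lambda>t. flat_fun n t) \<longlongrightarrow> 0) (at_right 0)"
proof -
  have "((\<lambda>y::real. y ^ n / exp y) \<longlongrightarrow> 0) at_top" by (rule tendsto_power_div_exp_0)
  then have "((\<lambda>t::real. inverse t ^ n / exp (inverse t)) \<longlongrightarrow> 0) (at_right 0)"
    by (rule filterlim_compose[OF _ filterlim_inverse_at_top_right])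
  moreover have "eventually (\<lambda>t. inverse t ^ n / exp (inverse t) = flat_fun n t) (at_right 0)"
    by (auto simp: eventually_at_filter flat_fun_def exp_minus field_simps)
  ultimately show ?thesis by (rule Lim_transform_eventually)
qed

lemma flat_fun_deriv:
  "(flat_fun n has_real_derivative (- real n * flat_fun (Suc n) t + flat_fun (Suc (Suc n)) t)) (at t)"
proof -
  consider "t < 0" | "t > 0" | "t = 0" by linarith
  then show ?thesis
  proof cases
    case 1
    have "(flat_fun n has_real_derivative 0) (at t)"
      by (rule DERIV_cong[OF has_field_derivative_transform_within_open[of "\<lambda>_. 0" 0 t "{..<0}"]])
        (use 1 in \<open>auto simp: flat_fun_def\<close>)
    then show ?thesis using 1 by (simp add: flat_fun_def)
  next
    case 2
    consider "n = 0" | m where "n = Suc m" by (cases n) auto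
    then have "((\<lambda>t. inverse t ^ n * exp (- inverse t)) has_real_derivative
        (- real n * flat_fun (Suc n) t + flat_fun (Suc (Suc n)) t)) (at t)"
    proof cases
      case 1
      then show ?thesis using \<open>t > 0\<close>
        by (auto intro!: derivative_eq_intros simp: flat_fun_def power2_eq_square)
    next
      case (2 m)
      have "((\<lambda>t. inverse t ^ Suc m * exp (- inverse t)) has_real_derivative
          real (Suc m) * inverse t ^ m * (- (inverse t * inverse t)) * exp (- inverse t)
          + inverse t ^ Suc m * (exp (- inverse t) * (inverse t * inverse t))) (at t)"
      proof -
        have inv: "(inverse has_real_derivative - (inverse t * inverse t)) (at t)"
          using DERIV_inverse[of t UNIV] \<open>t > 0\<close> by (simp add: power2_eq_square)
        have "((\<lambda>t. exp (- inverse t)) has_real_derivative exp (- inverse t) * (inverse t * inverse t)) (at t)"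
          by (rule DERIV_cong[OF DERIV_fun_exp[OF DERIV_minus[OF inv]]]) simp
        from DERIV_mult[OF DERIV_power_Suc[OF inv, of m] this] show ?thesis
          by (rule DERIV_cong) (simp add: algebra_simps)
      qed
      then show ?thesis using \<open>t > 0\<close> by (simp add: 2 flat_fun_def algebra_simps)
    qed
    then show ?thesis
      by (rule has_field_derivative_transform_within_open[of _ _ _ "{0<..}"])
        (use 2 in \<open>auto simp: flat_fun_def\<close>)
  next
    case 3
    \<comment> \<open>At 0 the difference quotient from the right is \<open>flat_fun (Suc n)\<close>
      itself, and the one from the left is 0.\<close>
    have "((\<lambda>y. (flat_fun n y - flat_fun n 0) / (y - 0)) \<longlongrightarrow> 0) (at_right 0)"
    proof (rule Lim_transform_eventually[OF flat_fun_tendsto[of "Suc n"]])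
      show "\<forall>\<^sub>F x in at_right 0. flat_fun (Suc n) x = (flat_fun n x - flat_fun n 0) / (x - 0)"
        by (auto simp: eventually_at_filter flat_fun_def divide_inverse)
    qed
    moreover have "((\<lambda>y. (flat_fun n y - flat_fun n 0) / (y - 0)) \<longlongrightarrow> 0) (at_left 0)"
      by (rule Lim_transform_eventually[OF tendsto_const[of 0]])
        (auto simp: eventually_at_filter flat_fun_def)
    ultimately have "(flat_fun n has_real_derivative 0) (at 0)"
      unfolding has_field_derivative_iff filterlim_at_split[of _ _ 0] by simp
    then show ?thesis using 3 by (simp add: flat_fun_def)
  qed
qed

lemma smooth_on_flat_fun: "smooth_on UNIV (flat_fun n)"
proof -
  have "k_smooth_on k UNIV (flat_fun n)" for k
  proof (induction k arbitrary: n)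
    case 0
    have "isCont (flat_fun n) t" for t using flat_fun_deriv DERIV_isCont by blast
    then show ?case by (simp add: continuous_at_imp_continuous_on)
  next
    case (Suc k)
    show ?case
    proof (rule k_smooth_on_SucI[OF open_UNIV])
      show "(flat_fun n has_derivative
          (\<lambda>v. (- real n * flat_fun (Suc n) t + flat_fun (Suc (Suc n)) t) * v)) (at t)" for t
        using flat_fun_deriv[of n t] by (simp add: has_field_derivative_def)
      show "k_smooth_on k UNIV (\<lambda>t. (- real n * flat_fun (Suc n) t + flat_fun (Suc (Suc n)) t) * v)" for v
        by (intro k_smooth_on_bilinear[OF open_UNIV bounded_bilinear_mult] k_smooth_on_add
            k_smooth_on_const open_UNIV Suc)
    qed
  qed
  then show ?thesis by (simp add: smooth_on_def)
qed

lemma plateau_function: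
  fixes a :: "'a::euclidean_space"
  assumes r: "r > 0"
  obtains \<rho> :: "'a \<Rightarrow> real" where "smooth_on UNIV \<rho>"
    "\<And>x. dist a x \<le> r \<Longrightarrow> \<rho> x = 1" "\<And>x. dist a x > 2 * r \<Longrightarrow> \<rho> x = 0"
proof
  \<comment> \<open>A smooth step, 1 for t \<le> 1 and 0 for t \<ge> 2; its denominator is positive
    because \<open>2 - t\<close> or \<open>t - 1\<close> is. It is fed with the squared distance in
    units of \<open>r\<close>, which is smooth at \<open>a\<close>. Distances above
    \<open>2 * r\<close> give values of at least 4, beyond the threshold 2.\<close>
  define s where "s t = flat_fun 0 (2 - t) * inverse (flat_fun 0 (2 - t) + flat_fun 0 (t - 1))" for t
  define q where "q = (\<lambda>x. ((x - a) \<bullet> (x - a)) * inverse (r\<^sup>2))"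
  have pos: "flat_fun 0 (2 - t) + flat_fun 0 (t - 1) > 0" for t
    by (auto simp: flat_fun_def add_pos_pos)
  have lin: "smooth_on UNIV (\<lambda>t. flat_fun 0 (2 - t))" "smooth_on UNIV (\<lambda>t. flat_fun 0 (t - 1))"
    by (rule smooth_on_compose[OF open_UNIV _ smooth_on_flat_fun];
        (intro smooth_on_minus smooth_on_const smooth_on_id open_UNIV)?; simp)+
  have s: "smooth_on UNIV s" unfolding s_def
    by (intro smooth_on_mult smooth_on_inverse smooth_on_add lin open_UNIV) (metis pos less_irrefl)
  have q: "smooth_on UNIV q" unfolding q_def
    by (intro smooth_on_mult smooth_on_inner smooth_on_minus smooth_on_const smooth_on_id open_UNIV)
  show "smooth_on UNIV (\<lambda>x. s (q x))" by (rule smooth_on_compose[OF open_UNIV q s]) simp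
  have qd: "q x = (dist a x / r)\<^sup>2" for x
    by (simp add: q_def dist_norm norm_minus_commute power_divide dot_square_norm
        divide_inverse power_inverse power_mult_distrib)
  show "s (q x) = 1" if "dist a x \<le> r" for x
  proof -
    have "q x \<le> 1" using that r by (simp add: qd power_le_one)
    then show ?thesis using pos[of "q x"] by (simp add: s_def flat_fun_def)
  qed
  show "s (q x) = 0" if "dist a x > 2 * r" for x
  proof -
    have "dist a x / r \<ge> 2" using that r by (simp add: field_simps)
    then have "q x \<ge> 2\<^sup>2" unfolding qd by (rule power_mono) simp
    then show ?thesis by (simp add: s_def flat_fun_def)
  qed
qed

section \<open>Functions killed by a vector field, and maps of constant rank\<close>

text \<open>A substitute for the flow of \<open>\<zeta>\<close>: a continuous induction on the height produces points at
  height \<open>\<epsilon>\<close> at which finitely many of the functions have almost not changed.\<close>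

lemma killed_functions_almost_constant:
  fixes \<eta> :: "'a::euclidean_space \<Rightarrow> 'a"
  assumes K: "finite K" and e: "e > 0" and \<delta>: "\<delta> > 0" and L: "L > 0"
    and \<eta>: "\<And>x. x \<in> cball a \<delta> \<Longrightarrow> \<eta> x \<bullet> z = 1" "\<And>x. x \<in> cball a \<delta> \<Longrightarrow> norm (\<eta> x) \<le> L"
    and k: "\<And>k x. k \<in> K \<Longrightarrow> x \<in> cball a \<delta> \<Longrightarrow> (k has_derivative k' k x) (at x)"
      "\<And>k x. k \<in> K \<Longrightarrow> x \<in> cball a \<delta> \<Longrightarrow> k' k x (\<eta> x) = (0::real)"
  shows "\<exists>x\<in>cball a \<delta>. (x - a) \<bullet> z = \<delta> / L \<and> (\<forall>k\<in>K. \<bar>k x - k a\<bar> \<le> e)"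
proof -
  define l where "l x = (x - a) \<bullet> z" for x
  define \<epsilon> where "\<epsilon> = \<delta> / L"
  define e' where "e' = e / \<epsilon>"
  have \<epsilon>: "\<epsilon> > 0" and e': "e' > 0" using \<delta> L e by (auto simp: \<epsilon>_def e'_def)
  \<comment> \<open>The points up to height \<epsilon> whose errors are in proportion to their
    height \<open>l x\<close>. The bound \<open>L * l x\<close> keeps them in the ball, and
    \<open>e'\<close> is scaled so that the error allowed at height \<epsilon> is
    \<open>e\<close>.\<close>
  define C where "C = {x \<in> cball a \<delta>. 0 \<le> l x \<and> l x \<le> \<epsilon> \<and> norm (x - a) \<le> L * l x \<and>
    (\<forall>k\<in>K. \<bar>k x - k a\<bar> \<le> e' * l x)}"
  have contk: "continuous_on (cball a \<delta>) k" if "k \<in> K" for k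
    using k(1)[OF that] has_derivative_continuous continuous_at_imp_continuous_on by blast
  have contl: "continuous_on (cball a \<delta>) l" unfolding l_def by (intro continuous_intros)
  have "C = (cball a \<delta> \<inter> {x \<in> cball a \<delta>. 0 \<le> l x} \<inter> {x \<in> cball a \<delta>. l x \<le> \<epsilon>}
      \<inter> {x \<in> cball a \<delta>. norm (x - a) \<le> L * l x})
      \<inter> (\<Inter>k\<in>K. {x \<in> cball a \<delta>. \<bar>k x - k a\<bar> \<le> e' * l x})"
    unfolding C_def by auto
  moreover have "closed {x \<in> cball a \<delta>. 0 \<le> l x}" "closed {x \<in> cball a \<delta>. l x \<le> \<epsilon>}"
    "closed {x \<in> cball a \<delta>. norm (x - a) \<le> L * l x}"
    "\<And>k. k \<in> K \<Longrightarrow> closed {x \<in> cball a \<delta>. \<bar>k x - k a\<bar> \<le> e' * l x}"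
    by (intro continuous_on_closed_Collect_le continuous_intros contl contk closed_cball; assumption)+
  ultimately have "closed C" by (auto intro!: closed_Int closed_INT)
  moreover have "C \<subseteq> cball a \<delta>" by (auto simp: C_def)
  ultimately have "compact C" by (meson bounded_cball bounded_subset compact_eq_bounded_closed)
  moreover have "a \<in> C" using \<delta> \<epsilon> by (simp add: C_def l_def)
  ultimately obtain x where x: "x \<in> C" and max: "\<And>y. y \<in> C \<Longrightarrow> l y \<le> l x"
    using continuous_attains_sup[of C l] continuous_on_subset[OF contl \<open>C \<subseteq> cball a \<delta>\<close>] by blast
  have xb: "x \<in> cball a \<delta>" using x by (simp add: C_def)
  \<comment> \<open>A highest point below \<epsilon> could still be moved a little along \<eta>: the
    height grows at unit rate, while each \<open>k\<close> changes by less than \<open>e'\<close>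
    times the step, so the new point stays in \<open>C\<close>.\<close>
  have "l x = \<epsilon>"
  proof (rule ccontr)
    assume "l x \<noteq> \<epsilon>"
    then have gap: "l x < \<epsilon>" using x by (simp add: C_def)
    have "\<forall>\<^sub>F h in at_right 0. \<bar>k (x + h *\<^sub>R \<eta> x) - k x\<bar> \<le> e' * h" if "k \<in> K" for k
    proof -
      have "((\<lambda>h. x + h *\<^sub>R \<eta> x) has_derivative (\<lambda>h. h *\<^sub>R \<eta> x)) (at 0)"
        by (auto intro!: derivative_eq_intros)
      moreover have "(k has_derivative k' k x) (at (x + 0 *\<^sub>R \<eta> x))" using k(1)[OF that xb] by simp
      ultimately have "((\<lambda>h. k (x + h *\<^sub>R \<eta> x)) has_derivative (\<lambda>h. k' k x (h *\<^sub>R \<eta> x))) (at 0)"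
        using diff_chain_at by (force simp: comp_def)
      moreover have "k' k x (h *\<^sub>R \<eta> x) = 0 * h" for h
        using linear_scale[OF has_derivative_linear[OF k(1)[OF that xb]], of h] k(2)[OF that xb] by simp
      ultimately have "((\<lambda>h. k (x + h *\<^sub>R \<eta> x)) has_real_derivative 0) (at 0)"
        unfolding has_field_derivative_def by (auto elim!: has_derivative_eq_rhs)
      then have "((\<lambda>h. (k (x + h *\<^sub>R \<eta> x) - k x) / h) \<longlongrightarrow> 0) (at 0)"
        by (simp add: has_field_derivative_iff)
      then have "\<forall>\<^sub>F h in at 0. dist ((k (x + h *\<^sub>R \<eta> x) - k x) / h) 0 < e'"
        using e' by (rule tendstoD)
      then have "\<forall>\<^sub>F h in at_right 0. dist ((k (x + h *\<^sub>R \<eta> x) - k x) / h) 0 < e'"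
        by (rule filter_leD[OF at_le, rotated]) simp
      then show ?thesis
        by (rule eventually_rev_mp) (auto simp: eventually_at_filter field_simps abs_if split: if_splits)
    qed
    then have "\<forall>\<^sub>F h in at_right 0. \<forall>k\<in>K. \<bar>k (x + h *\<^sub>R \<eta> x) - k x\<bar> \<le> e' * h"
      using K by (simp add: eventually_ball_finite)
    moreover have "\<forall>\<^sub>F h in at_right 0. h \<in> {0<..<\<epsilon> - l x}"
      using gap by (intro eventually_at_right_real) simp
    ultimately have "\<forall>\<^sub>F h in at_right 0. (\<forall>k\<in>K. \<bar>k (x + h *\<^sub>R \<eta> x) - k x\<bar> \<le> e' * h) \<and> h \<in> {0<..<\<epsilon> - l x}"
      by (rule eventually_conj)
    from eventually_happens'[OF trivial_limit_at_right_real this]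
    obtain h where h: "h > 0" "h < \<epsilon> - l x" "\<And>k. k \<in> K \<Longrightarrow> \<bar>k (x + h *\<^sub>R \<eta> x) - k x\<bar> \<le> e' * h"
      by auto
    let ?y = "x + h *\<^sub>R \<eta> x"
    have ly: "l ?y = l x + h" using \<eta>(1)[OF xb] by (simp add: l_def algebra_simps inner_add_left inner_diff_left)
    have ny: "norm (?y - a) \<le> L * l ?y"
    proof -
      have "norm (?y - a) \<le> norm (x - a) + norm (h *\<^sub>R \<eta> x)"
        by (metis add_diff_eq add.commute norm_triangle_ineq)
      also have "\<dots> \<le> L * l x + h * L"
        using x h(1) \<eta>(2)[OF xb] by (intro add_mono) (auto simp: C_def)
      finally show ?thesis by (simp add: ly algebra_simps)
    qed
    moreover have "L * l ?y \<le> L * \<epsilon>" using L h(2) ly by simp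
    ultimately have "?y \<in> cball a \<delta>" using L by (simp add: \<epsilon>_def dist_norm norm_minus_commute)
    moreover have "\<bar>k ?y - k a\<bar> \<le> e' * l ?y" if "k \<in> K" for k
    proof -
      have "\<bar>k x - k a\<bar> \<le> e' * l x" using x that by (auto simp: C_def)
      then show ?thesis using h(3)[OF that] by (simp add: ly algebra_simps)
    qed
    ultimately have "?y \<in> C" using h ly ny x by (simp add: C_def)
    then show False using max[of ?y] ly h(1) by simp
  qed
  moreover have "\<bar>k x - k a\<bar> \<le> e" if "k \<in> K" for k
    using x that \<open>l x = \<epsilon>\<close> \<epsilon> by (auto simp: C_def e'_def)
  ultimately show ?thesis using xb by (auto simp: l_def \<epsilon>_def)
qed

text \<open>An integral curve of \<open>\<zeta>\<close> through \<open>a\<close> would lie in a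
  common level set of \<open>K\<close>. A single further point is enough, and compactness supplies
  it: on the slice \<open>P\<close> of fixed positive height any finite part of \<open>K\<close> can
  be brought arbitrarily close to its values at \<open>a\<close>, and the finite intersection
  property removes the error for all of \<open>K\<close>.\<close>

lemma killed_functions_not_separating:
  fixes \<zeta> :: "'a::euclidean_space \<Rightarrow> 'a" and K :: "('a \<Rightarrow> real) set"
  assumes U: "open U" "a \<in> U" and \<zeta>: "continuous_on U \<zeta>" "\<zeta> a \<noteq> 0"
    and K: "\<And>k x. k \<in> K \<Longrightarrow> x \<in> U \<Longrightarrow> k differentiable (at x)"
      "\<And>k x. k \<in> K \<Longrightarrow> x \<in> U \<Longrightarrow> frechet_derivative k (at x) (\<zeta> x) = 0"
  obtains x where "x \<in> U" "x \<noteq> a" "\<And>k. k \<in> K \<Longrightarrow> k x = k a"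
proof -
  define z where "z = \<zeta> a"
  define c where "c = (z \<bullet> z) / 2"
  have c: "c > 0" using \<zeta>(2) by (simp add: c_def z_def)
  have "continuous (at a) \<zeta>" using \<zeta>(1) U by (simp add: continuous_on_eq_continuous_at)
  then have lim: "((\<lambda>x. \<zeta> x \<bullet> z) \<longlongrightarrow> z \<bullet> z) (at a)" "((\<lambda>x. norm (\<zeta> x)) \<longlongrightarrow> norm z) (at a)"
    unfolding isCont_def z_def by (auto intro: tendsto_intros)
  have "c < z \<bullet> z" using c by (simp add: c_def)
  then have "\<forall>\<^sub>F x in at a. c < \<zeta> x \<bullet> z" by (rule order_tendstoD(1)[OF lim(1)])
  moreover have "\<forall>\<^sub>F x in at a. norm (\<zeta> x) < norm z + 1" by (rule order_tendstoD(2)[OF lim(2)]) simp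
  moreover have "\<forall>\<^sub>F x in at a. x \<in> U" using U eventually_at_topological by blast
  ultimately have "\<forall>\<^sub>F x in at a. c < \<zeta> x \<bullet> z \<and> norm (\<zeta> x) < norm z + 1 \<and> x \<in> U"
    by (intro eventually_conj)
  then obtain d where d: "d > 0"
    "\<And>x. x \<noteq> a \<Longrightarrow> dist x a < d \<Longrightarrow> c < \<zeta> x \<bullet> z \<and> norm (\<zeta> x) < norm z + 1 \<and> x \<in> U"
    unfolding eventually_at by blast
  define \<delta> where "\<delta> = d / 2"
  have near: "c < \<zeta> x \<bullet> z \<and> norm (\<zeta> x) < norm z + 1 \<and> x \<in> U" if "x \<in> cball a \<delta>" for x
  proof (cases "x = a")
    case True
    then show ?thesis using c U by (simp add: c_def z_def)
  next
    case False
    then show ?thesis using d that by (auto simp: \<delta>_def dist_commute)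
  qed
  have \<delta>: "\<delta> > 0" using d by (simp add: \<delta>_def)
  \<comment> \<open>Rescaled to gain height at unit rate. The lower bound \<open>c\<close> on the
    denominator, half of its value at \<open>a\<close>, yields the bound \<open>L\<close> on the
    length.\<close>
  define \<eta> where "\<eta> x = inverse (\<zeta> x \<bullet> z) *\<^sub>R \<zeta> x" for x
  define L where "L = (norm z + 1) / c"
  have L: "L > 0" using c by (simp add: L_def add_nonneg_pos)
  have \<eta>1: "\<eta> x \<bullet> z = 1" if "x \<in> cball a \<delta>" for x
    using near[OF that] c by (simp add: \<eta>_def)
  have \<eta>2: "norm (\<eta> x) \<le> L" if "x \<in> cball a \<delta>" for x
  proof -
    have "norm (\<eta> x) = norm (\<zeta> x) / (\<zeta> x \<bullet> z)"
      using near[OF that] c by (simp add: \<eta>_def divide_inverse)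
    also have "\<dots> \<le> (norm z + 1) / c" using near[OF that] c by (intro frac_le) auto
    finally show ?thesis by (simp add: L_def)
  qed
  have dk: "(k has_derivative frechet_derivative k (at x)) (at x)" if "k \<in> K" "x \<in> cball a \<delta>" for k x
    using K(1)[OF that(1)] near[OF that(2)] frechet_derivative_works by blast
  have k0: "frechet_derivative k (at x) (\<eta> x) = 0" if "k \<in> K" "x \<in> cball a \<delta>" for k x
    using K(2)[OF that(1)] near[OF that(2)] linear_scale[OF has_derivative_linear[OF dk[OF that]]]
    by (simp add: \<eta>_def)
  define P where "P = {x \<in> cball a \<delta>. (x - a) \<bullet> z = \<delta> / L}"
  have "compact P"
  proof -
    have "closed P" unfolding P_def
      by (intro continuous_closed_preimage_constant[of "cball a \<delta>" "\<lambda>x. (x - a) \<bullet> z"] continuous_intros closed_cball)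
    moreover have "P \<subseteq> cball a \<delta>" by (auto simp: P_def)
    ultimately show ?thesis by (meson bounded_cball bounded_subset compact_eq_bounded_closed)
  qed
  define T where "T p = {x \<in> cball a \<delta>. \<bar>fst p x - fst p a\<bar> \<le> inverse (real (Suc (snd p)))}"
    for p :: "('a \<Rightarrow> real) \<times> nat"
  have "P \<inter> (\<Inter>p \<in> K \<times> UNIV. T p) \<noteq> {}"
  proof (rule compact_imp_fip_image[OF \<open>compact P\<close>])
    show "closed (T p)" if "p \<in> K \<times> UNIV" for p
    proof -
      have "continuous_on (cball a \<delta>) (fst p)"
        using dk that has_derivative_continuous continuous_at_imp_continuous_on
        by (metis mem_Times_iff)
      then show ?thesis unfolding T_def
        by (intro continuous_on_closed_Collect_le continuous_intros closed_cball)
    qed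
    fix I' assume I': "finite I'" "I' \<subseteq> K \<times> (UNIV :: nat set)"
    obtain N where N: "\<And>p. p \<in> I' \<Longrightarrow> snd p \<le> N"
      using finite_imageI[OF I'(1), of snd] by (metis finite_nat_set_iff_bounded_le imageI)
    have "\<exists>x\<in>cball a \<delta>. (x - a) \<bullet> z = \<delta> / L \<and> (\<forall>k\<in>fst ` I'. \<bar>k x - k a\<bar> \<le> inverse (real (Suc N)))"
      by (rule killed_functions_almost_constant[where \<eta> = \<eta> and k' = "\<lambda>k x. frechet_derivative k (at x)"])
        (use I' \<delta> L \<eta>1 \<eta>2 dk k0 in auto)
    then obtain x where x: "x \<in> P" "\<And>p. p \<in> I' \<Longrightarrow> \<bar>fst p x - fst p a\<bar> \<le> inverse (real (Suc N))"
      unfolding P_def by blast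
    have N': "inverse (real (Suc N)) \<le> inverse (real (Suc (snd p)))" if "p \<in> I'" for p
      using N[OF that] by (intro le_imp_inverse_le) auto
    then have "x \<in> T p" if "p \<in> I'" for p
      using order_trans[OF x(2)[OF that] N'[OF that]] x(1) by (simp add: T_def P_def)
    then show "P \<inter> \<Inter> (T ` I') \<noteq> {}" using x(1) by blast
  qed
  then obtain x where x: "x \<in> P" and xT: "x \<in> (\<Inter>p \<in> K \<times> UNIV. T p)" by blast
  have x2: "\<bar>k x - k a\<bar> \<le> inverse (real (Suc n))" if "k \<in> K" for k n
  proof -
    have "x \<in> T (k, n)" using xT that by blast
    then show ?thesis by (simp add: T_def)
  qed
  have "k x = k a" if "k \<in> K" for k
  proof (rule ccontr)
    assume "k x \<noteq> k a"
    then obtain n where "inverse (real (Suc n)) < \<bar>k x - k a\<bar>"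
      using reals_Archimedean[of "\<bar>k x - k a\<bar>"] by auto
    then show False using x2[OF that, of n] by simp
  qed
  moreover have "x \<noteq> a" using x \<delta> L by (auto simp: P_def)
  moreover have "x \<in> U" using x near by (auto simp: P_def)
  ultimately show thesis using that by blast
qed

text \<open>The hypothesis on \<open>A\<close> expresses that the rank of \<open>f'\<close> does not increase. With a section \<open>\<sigma>\<close> of
  \<open>f' a\<close>, the map \<open>x + \<sigma> (f x) - \<sigma> (f' a x)\<close> is a local chart in which the fibres of the projection of
  \<open>f\<close> to the range of \<open>f' a\<close> are convex, and \<open>f\<close> is constant on those.\<close>

lemma constant_rank_image_interior_empty:
  fixes f :: "'a::euclidean_space \<Rightarrow> 'e::euclidean_space"
  assumes S: "open S" "a \<in> S"
    and f: "\<And>x. x \<in> S \<Longrightarrow> (f has_derivative f' x) (at x)" "\<And>v. continuous_on S (\<lambda>x. f' x v)"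
    and nonsurj: "range (f' a) \<noteq> UNIV"
    and A: "\<And>x. x \<in> S \<Longrightarrow> linear (A x)" "\<And>w. continuous_on S (\<lambda>x. A x w)" "\<And>w. A a w = w"
    and sub: "\<And>x v. x \<in> S \<Longrightarrow> \<exists>w. f' x v = A x (f' a w)"
  obtains U where "open U" "a \<in> U" "U \<subseteq> S" "interior (f ` U) = {}"
proof -
  define L where "L = f' a"
  have linL: "linear L" using f(1)[OF S(2)] has_derivative_linear by (auto simp: L_def)
  obtain \<sigma> where \<sigma>: "linear \<sigma>" "\<And>y. y \<in> range L \<Longrightarrow> L (\<sigma> y) = y"
    using linear_exists_right_inverse_on[OF linL subspace_UNIV] by auto
  \<comment> \<open>A projection onto the range of \<open>L\<close>.\<close>
  define P where "P = (\<lambda>y. L (\<sigma> y))"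
  have linP: "linear P" unfolding P_def using linear_compose[OF \<sigma>(1) linL] by (simp add: comp_def)
  have PL: "P (L v) = L v" for v by (simp add: P_def \<sigma>)
  define Ab where "Ab x = Blinfun (A x)" for x
  have Ab: "blinfun_apply (Ab x) = A x" if "x \<in> S" for x
    using A(1)[OF that] by (simp add: Ab_def bounded_linear_Blinfun_apply linear_conv_bounded_linear)
  define fb where "fb x = Blinfun (f' x)" for x
  have fb: "blinfun_apply (fb x) = f' x" if "x \<in> S" for x
    using has_derivative_bounded_linear[OF f(1)[OF that]] by (simp add: fb_def bounded_linear_Blinfun_apply)
  have cont_blinfun: "continuous_on S Fb" if "\<And>x. x \<in> S \<Longrightarrow> blinfun_apply (Fb x) = F x"
    "\<And>v. continuous_on S (\<lambda>x. F x v)"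
    for Fb :: "'a \<Rightarrow> 'c::euclidean_space \<Rightarrow>\<^sub>L 'd::euclidean_space" and F
    unfolding continuous_on_eq_continuous_within
  proof (intro ballI continuous_blinfun_componentwiseI1)
    fix x i assume "x \<in> S"
    have "continuous_on S (\<lambda>x. blinfun_apply (Fb x) i)"
      using that by (simp cong: continuous_on_cong)
    then show "continuous (at x within S) (\<lambda>x. blinfun_apply (Fb x) i)"
      using \<open>x \<in> S\<close> by (simp add: continuous_on_eq_continuous_within)
  qed
  have contA: "continuous_on S Ab" using cont_blinfun[OF Ab A(2)] .
  have contf: "continuous_on S fb" using cont_blinfun[OF fb f(2)] .
  define Pb where "Pb = Blinfun P"
  have Pb: "blinfun_apply Pb = P"
    using linP by (simp add: Pb_def bounded_linear_Blinfun_apply linear_conv_bounded_linear)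
  define \<sigma>b where "\<sigma>b = Blinfun \<sigma>"
  have \<sigma>b: "blinfun_apply \<sigma>b = \<sigma>"
    using \<sigma>(1) by (simp add: \<sigma>b_def bounded_linear_Blinfun_apply linear_conv_bounded_linear)
  define Lb where "Lb = Blinfun L"
  have Lb: "blinfun_apply Lb = L"
    using linL by (simp add: Lb_def bounded_linear_Blinfun_apply linear_conv_bounded_linear)
  have "Ab a = id_blinfun" by (rule blinfun_eqI) (simp add: Ab S A(3))
  have "continuous_on S (\<lambda>x. norm (Pb o\<^sub>L (Ab x - id_blinfun)))"
    by (intro continuous_intros contA)
  then have "open (S \<inter> (\<lambda>x. norm (Pb o\<^sub>L (Ab x - id_blinfun))) -` {..<1})"
    using S(1) by (intro continuous_open_preimage) auto
  moreover define S' where "S' = S \<inter> (\<lambda>x. norm (Pb o\<^sub>L (Ab x - id_blinfun))) -` {..<1}"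
  ultimately have S': "open S'" "a \<in> S'" "S' \<subseteq> S"
    using S \<open>Ab a = id_blinfun\<close> by (auto simp: S'_def)
  \<comment> \<open>With \<open>f' x v = A x (L w)\<close>, the assumption says that
    \<open>P \<circ> (A x - id)\<close> maps \<open>L w\<close> to \<open>- L w\<close>. Its
    operator norm is below 1 on \<open>S'\<close>, so \<open>L w = 0\<close>. Thus \<open>P\<close>
    is injective on the range of \<open>f' x\<close>.\<close>
  have inj: "f' x v = 0" if x: "x \<in> S'" and 0: "P (f' x v) = 0" for x v
  proof -
    have xS: "x \<in> S" using x S' by blast
    have small: "norm (Pb o\<^sub>L (Ab x - id_blinfun)) < 1" using x by (simp add: S'_def)
    obtain w where w: "f' x v = A x (L w)" using sub[OF xS] by (auto simp: L_def)
    have "blinfun_apply (Pb o\<^sub>L (Ab x - id_blinfun)) (L w) = P (A x (L w)) - P (L w)"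
      by (simp add: Pb Ab xS minus_blinfun.rep_eq linear_diff[OF linP])
    then have "norm (L w) \<le> norm (Pb o\<^sub>L (Ab x - id_blinfun)) * norm (L w)"
      using norm_blinfun[of "Pb o\<^sub>L (Ab x - id_blinfun)" "L w"] 0 w PL by simp
    then have "norm (L w) \<le> 0" using small by (simp add: mult_le_cancel_right1 not_le[symmetric])
    then have "L w = 0" by simp
    then show ?thesis using w linear_0[OF A(1)[OF xS]] by simp
  qed
  define \<psi> where "\<psi> x = x + \<sigma> (f x) - \<sigma> (L x)" for x
  define \<psi>' where "\<psi>' x = id_blinfun + (\<sigma>b o\<^sub>L fb x) - (\<sigma>b o\<^sub>L Lb)" for x
  have bl\<sigma>: "bounded_linear \<sigma>" and blL: "bounded_linear L"
    using \<sigma>(1) linL linear_conv_bounded_linear by auto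
  have d\<psi>: "(\<psi> has_derivative blinfun_apply (\<psi>' x)) (at x)" if "x \<in> S'" for x
  proof -
    have xS: "x \<in> S" using that S' by blast
    have "(\<psi> has_derivative (\<lambda>v. v + \<sigma> (f' x v) - \<sigma> (L v))) (at x)"
      unfolding \<psi>_def
      by (intro has_derivative_add has_derivative_diff has_derivative_ident
          bounded_linear.has_derivative[OF bl\<sigma>] bounded_linear.has_derivative[OF blL] f(1)[OF xS])
    moreover have "blinfun_apply (\<psi>' x) = (\<lambda>v. v + \<sigma> (f' x v) - \<sigma> (L v))"
      by (auto simp: \<psi>'_def plus_blinfun.rep_eq minus_blinfun.rep_eq \<sigma>b Lb fb xS)
    ultimately show ?thesis by simp
  qed
  have cont\<psi>: "continuous_on S' \<psi>'" unfolding \<psi>'_def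
    by (intro continuous_intros continuous_on_subset[OF contf S'(3)])
  have "\<psi>' a = id_blinfun"
    by (rule blinfun_eqI)
      (simp add: \<psi>'_def plus_blinfun.rep_eq minus_blinfun.rep_eq \<sigma>b Lb fb S L_def)
  then have inv: "id_blinfun o\<^sub>L \<psi>' a = id_blinfun" by (auto intro: blinfun_eqI)
  obtain U' V h h' where U': "open U'" "U' \<subseteq> S'" "a \<in> U'" and V: "open V" "\<psi> a \<in> V"
    and hom: "homeomorphism U' V \<psi> h" and dh: "\<And>y. y \<in> V \<Longrightarrow> (h has_derivative h' y) (at y)"
    by (rule inverse_function_theorem[OF S'(1) d\<psi> cont\<psi> S'(2) inv]) (assumption, rule that, assumption+)
  obtain r where r: "r > 0" "ball (\<psi> a) r \<subseteq> V" using V open_contains_ball by blast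
  define U where "U = U' \<inter> \<psi> -` ball (\<psi> a) r"
  have "continuous_on U' \<psi>" using hom by (simp add: homeomorphism_def)
  then have "open U" unfolding U_def using U'(1) by (intro continuous_open_preimage) auto
  \<comment> \<open>In the coordinates given by \<open>\<psi>\<close>, the map
    \<open>P \<circ> f\<close> is the linear map \<open>L\<close>; its fibres are affine, hence
    convex within the ball.\<close>
  have Lpsi: "L (\<psi> x) = P (f x)" for x
    by (simp add: \<psi>_def linear_add[OF linL] linear_diff[OF linL] P_def \<sigma>)
  have Pf: "P (f (h y)) = L y" if "y \<in> V" for y
    using Lpsi[of "h y"] hom that by (simp add: homeomorphism_def)
  have hV: "h y \<in> S'" if "y \<in> V" for y using hom that U' by (auto simp: homeomorphism_def)
  have dfh: "((\<lambda>y. f (h y)) has_derivative (\<lambda>v. f' (h y) (h' y v))) (at y)" if "y \<in> V" for y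
    using diff_chain_at[OF dh[OF that] f(1)] hV[OF that] S' by (auto simp: comp_def)
  have kill: "f' (h y) (h' y v) = 0" if "y \<in> V" "L v = 0" for y v
  proof (rule inj[OF hV[OF that(1)]])
    have "((\<lambda>y. P (f (h y))) has_derivative (\<lambda>v. P (f' (h y) (h' y v)))) (at y)"
      by (rule bounded_linear.has_derivative[OF _ dfh[OF that(1)]])
        (use linP linear_conv_bounded_linear in blast)
    moreover have "((\<lambda>y. P (f (h y))) has_derivative L) (at y)"
      using has_derivative_transform_within_open[OF bounded_linear_imp_has_derivative[OF blL] V(1) that(1)]
        Pf by simp
    ultimately have "(\<lambda>v. P (f' (h y) (h' y v))) = L" by (rule has_derivative_unique)
    then show "P (f' (h y) (h' y v)) = 0" using that(2) by metis
  qed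
  have fibre: "f x = f x'" if x: "x \<in> U" and x': "x' \<in> U" and eq: "P (f x) = P (f x')" for x x'
  proof -
    define d where "d = \<psi> x' - \<psi> x"
    have Ld: "L d = 0" by (simp add: d_def linear_diff[OF linL] Lpsi eq)
    have seg: "\<psi> x + t *\<^sub>R d \<in> V" if "t \<in> {0..1}" for t
    proof -
      have "(1 - t) *\<^sub>R \<psi> x + t *\<^sub>R \<psi> x' \<in> ball (\<psi> a) r"
        using x x' that convex_ball[of "\<psi> a" r] by (intro convexD) (auto simp: U_def)
      moreover have "(1 - t) *\<^sub>R \<psi> x + t *\<^sub>R \<psi> x' = \<psi> x + t *\<^sub>R d" by (simp add: d_def algebra_simps)
      ultimately show ?thesis using r by auto
    qed
    have "((\<lambda>t. f (h (\<psi> x + t *\<^sub>R d))) has_derivative (\<lambda>_. 0)) (at t within {0..1})"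
      if t: "t \<in> {0..1}" for t
    proof -
      have "((\<lambda>t. \<psi> x + t *\<^sub>R d) has_derivative (\<lambda>s. s *\<^sub>R d)) (at t within {0..1})"
        by (auto intro!: derivative_eq_intros)
      from has_derivative_compose[OF this dfh[OF seg[OF t]]]
      have "((\<lambda>t. f (h (\<psi> x + t *\<^sub>R d))) has_derivative
          (\<lambda>s. f' (h (\<psi> x + t *\<^sub>R d)) (h' (\<psi> x + t *\<^sub>R d) (s *\<^sub>R d)))) (at t within {0..1})" .
      moreover have "f' (h (\<psi> x + t *\<^sub>R d)) (h' (\<psi> x + t *\<^sub>R d) (s *\<^sub>R d)) = 0" for s
        by (rule kill[OF seg[OF t]]) (simp add: linear_scale[OF linL] Ld)
      ultimately show ?thesis by simp
    qed
    from has_derivative_zero_unique[OF convex_real_interval(5) this, of 0 1]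
    have "f (h (\<psi> x)) = f (h (\<psi> x'))" by (simp add: d_def)
    then show ?thesis using x x' hom by (auto simp: U_def homeomorphism_def)
  qed
  have "interior (f ` U) = {}"
  proof (rule ccontr)
    assume "interior (f ` U) \<noteq> {}"
    then obtain y e where e: "e > 0" "ball y e \<subseteq> f ` U" by (metis all_not_in_conv mem_interior)
    \<comment> \<open>An interior point of the image leaves room for a step along the kernel of
      \<open>P\<close>. This produces two distinct image points with the same value under
      \<open>P\<close>, against \<open>fibre\<close>.\<close>
    have "\<not> surj P" using nonsurj by (auto simp: P_def L_def surj_def)
    then have "\<not> inj P" using linear_injective_imp_surjective[OF linP] by blast
    then obtain u where u: "u \<noteq> 0" "P u = 0" using linear_injective_0[OF linP] by blast
    define s where "s = e / (2 * norm u)"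
    have s: "s > 0" "s * norm u < e" using e u by (auto simp: s_def)
    have "y \<in> ball y e" "y + s *\<^sub>R u \<in> ball y e" using e(1) s by (simp_all add: dist_norm)
    then have "y \<in> f ` U" "y + s *\<^sub>R u \<in> f ` U" using e(2) by blast+
    then obtain x x' where x: "x \<in> U" "x' \<in> U" and y: "y = f x" "y + s *\<^sub>R u = f x'"
      by (elim imageE)
    have "P (f x) = P (f x')" unfolding y(2)[symmetric] y(1)[symmetric]
      by (simp add: linear_add[OF linP] linear_scale[OF linP] u)
    from fibre[OF x this] show False using y u s by simp
  qed
  moreover have "a \<in> U" using U'(3) r by (simp add: U_def)
  moreover have "U \<subseteq> S" using U' S' by (auto simp: U_def)
  ultimately show thesis using that \<open>open U\<close> by blast
qed

section \<open>Smooth functions and tangent vectors on manifolds\<close>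

abbreviation cim :: "('m, 'e) chart \<Rightarrow> 'e set" where
  "cim c \<equiv> cmap c ` cdom c"

definition lift_fun :: "('m, 'e) chart \<Rightarrow> ('e \<Rightarrow> real) \<Rightarrow> 'm \<Rightarrow> real" where
  "lift_fun c u = (\<lambda>q. if q \<in> cdom c then u (cmap c q) else 0)"

lemma sum_fun_apply: "(\<Sum>i\<in>I. F i) q = (\<Sum>i\<in>I. F i q)" for F :: "'i \<Rightarrow> 'a \<Rightarrow> 'b::comm_monoid_add"
  by (induction I rule: infinite_finite_induct) auto

locale smooth_mfd =
  fixes M :: "('m, 'e::euclidean_space) manifold"
  assumes smooth_manifold: "smooth_manifold M"
begin

section \<open>Charts and the algebra of smooth functions\<close>

lemma chart: "c \<in> matlas M \<Longrightarrow> is_chart (mtop M) c"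
  using smooth_manifold by (simp add: smooth_manifold_def)

lemma cdom_subset: "c \<in> matlas M \<Longrightarrow> q \<in> cdom c \<Longrightarrow> q \<in> points M"
  by (meson chart is_chart_def openin_subset subsetD)

lemma chart_at: assumes "p \<in> points M" obtains c where "c \<in> matlas M" "p \<in> cdom c"
  using assms smooth_manifold unfolding smooth_manifold_def by blast

lemma homeo: "c \<in> matlas M \<Longrightarrow> homeomorphic_map (subtopology (mtop M) (cdom c)) (top_of_set (cim c)) (cmap c)"
  using chart by (simp add: is_chart_def)

lemma open_cim: "c \<in> matlas M \<Longrightarrow> open (cim c)"
  using chart by (simp add: is_chart_def)

lemma openin_cdom: "c \<in> matlas M \<Longrightarrow> openin (mtop M) (cdom c)"
  using chart by (simp add: is_chart_def)

lemma topspace_cdom: "c \<in> matlas M \<Longrightarrow> topspace (subtopology (mtop M) (cdom c)) = cdom c"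
  using cdom_subset[of c] by (auto simp del: split_paired_All)

lemma inj_on_cmap: "c \<in> matlas M \<Longrightarrow> inj_on (cmap c) (cdom c)"
  using homeomorphic_imp_injective_map[OF homeo] topspace_cdom by metis

lemma cinv_cmap: "c \<in> matlas M \<Longrightarrow> q \<in> cdom c \<Longrightarrow> cinv c (cmap c q) = q"
  using inj_on_cmap by (simp add: cinv_def)

lemma cmap_cinv: "x \<in> cim c \<Longrightarrow> cmap c (cinv c x) = x"
  by (simp add: cinv_def f_inv_into_f)

lemma cinv_in: "x \<in> cim c \<Longrightarrow> cinv c x \<in> cdom c"
  by (simp add: cinv_def inv_into_into)

lemma open_cmap_image:
  assumes "c \<in> matlas M" "openin (mtop M) V"
  shows "open (cmap c ` (cdom c \<inter> V))"
proof -
  have "openin (subtopology (mtop M) (cdom c)) (cdom c \<inter> V)"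
    using assms(2) by (simp add: openin_subtopology_Int2)
  then have "openin (top_of_set (cim c)) (cmap c ` (cdom c \<inter> V))"
    using homeomorphic_imp_open_map[OF homeo[OF assms(1)]] by (simp add: open_map_def)
  then show ?thesis using open_cim[OF assms(1)] openin_open_eq by blast
qed

lemma openin_cmap_preimage:
  assumes c: "c \<in> matlas M" and W: "open W"
  shows "openin (mtop M) {q \<in> cdom c. cmap c q \<in> W}"
proof -
  have "openin (top_of_set (cim c)) (cim c \<inter> W)" using W by (simp add: openin_open_Int)
  from openin_continuous_map_preimage[OF homeomorphic_imp_continuous_map[OF homeo[OF c]] this]
  have "openin (subtopology (mtop M) (cdom c)) {q \<in> cdom c. cmap c q \<in> cim c \<inter> W}"
    by (simp only: topspace_cdom[OF c])
  moreover have "{q \<in> cdom c. cmap c q \<in> cim c \<inter> W} = {q \<in> cdom c. cmap c q \<in> W}" by auto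
  ultimately show ?thesis using openin_trans_full openin_cdom[OF c] by metis
qed

lemma smooth_funsD:
  assumes "f \<in> smooth_funs M"
  shows "q \<notin> points M \<Longrightarrow> f q = 0" and "c \<in> matlas M \<Longrightarrow> smooth_on (cim c) (\<lambda>x. f (cinv c x))"
  using assms by (auto simp: smooth_funs_def comp_def)

lemma smooth_funsI:
  assumes "\<And>q. q \<notin> points M \<Longrightarrow> f q = 0" "\<And>c. c \<in> matlas M \<Longrightarrow> smooth_on (cim c) (\<lambda>x. f (cinv c x))"
  shows "f \<in> smooth_funs M"
  using assms by (auto simp: smooth_funs_def comp_def)

lemma smooth_funs_add:
  assumes f: "f \<in> smooth_funs M" and h: "h \<in> smooth_funs M"
  shows "f + h \<in> smooth_funs M"
proof (rule smooth_funsI)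
  fix c assume c: "c \<in> matlas M"
  show "smooth_on (cim c) (\<lambda>x. (f + h) (cinv c x))"
    using smooth_on_add[OF open_cim[OF c] smooth_funsD(2)[OF f c] smooth_funsD(2)[OF h c]] by simp
qed (simp add: smooth_funsD(1)[OF f] smooth_funsD(1)[OF h])

lemma smooth_funs_mult:
  assumes f: "f \<in> smooth_funs M" and h: "h \<in> smooth_funs M"
  shows "f * h \<in> smooth_funs M"
proof (rule smooth_funsI)
  fix c assume c: "c \<in> matlas M"
  show "smooth_on (cim c) (\<lambda>x. (f * h) (cinv c x))"
    using smooth_on_mult[OF open_cim[OF c] smooth_funsD(2)[OF f c] smooth_funsD(2)[OF h c]] by simp
qed (simp add: smooth_funsD(1)[OF f] smooth_funsD(1)[OF h])

lemma smooth_funs_const: "zero_off M (\<lambda>_. k) \<in> smooth_funs M"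
proof (rule smooth_funsI)
  show "smooth_on (cim c) (\<lambda>x. zero_off M (\<lambda>_. k) (cinv c x))" if c: "c \<in> matlas M" for c
    by (rule smooth_on_cong[OF open_cim[OF c] smooth_on_const[OF open_cim[OF c]], of k])
      (simp add: zero_off_def cdom_subset[OF c cinv_in])
qed (simp add: zero_off_def)

lemma smooth_funs_scaleR:
  assumes f: "f \<in> smooth_funs M"
  shows "a *\<^sub>R f \<in> smooth_funs M"
proof (rule smooth_funsI)
  fix c assume c: "c \<in> matlas M"
  show "smooth_on (cim c) (\<lambda>x. (a *\<^sub>R f) (cinv c x))"
    using smooth_on_scaleR[OF open_cim[OF c] smooth_on_const[OF open_cim[OF c]] smooth_funsD(2)[OF f c]]
    by (simp add: scaleR_fun_def)
qed (simp add: smooth_funsD(1)[OF f] scaleR_fun_def)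

lemma smooth_funs_zero: "0 \<in> smooth_funs M"
  by (rule smooth_funsI) (auto intro!: smooth_on_const open_cim)

lemma smooth_funs_minus:
  assumes f: "f \<in> smooth_funs M" and h: "h \<in> smooth_funs M"
  shows "f - h \<in> smooth_funs M"
proof (rule smooth_funsI)
  fix c assume c: "c \<in> matlas M"
  show "smooth_on (cim c) (\<lambda>x. (f - h) (cinv c x))"
    using smooth_on_minus[OF open_cim[OF c] smooth_funsD(2)[OF f c] smooth_funsD(2)[OF h c]] by simp
qed (simp add: smooth_funsD(1)[OF f] smooth_funsD(1)[OF h])

lemma smooth_funs_sum:
  "finite I \<Longrightarrow> (\<And>i. i \<in> I \<Longrightarrow> f i \<in> smooth_funs M) \<Longrightarrow> (\<Sum>i\<in>I. f i) \<in> smooth_funs M"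
  by (induction I rule: finite_induct) (auto intro: smooth_funs_zero smooth_funs_add)

text \<open>In a Hausdorff space compact sets are closed in the whole space, not just in the chart.
  Extension by zero beyond the chart depends on this.\<close>

lemma closedin_cinv_image:
  assumes c: "c \<in> matlas M" and K: "compact K" "K \<subseteq> cim c"
  shows "closedin (mtop M) (cinv c ` K)"
proof -
  let ?C = "cinv c ` K"
  have CK: "cmap c ` ?C = K"
    using K(2) by (simp add: image_image cmap_cinv subset_iff cong: image_cong)
  have Cc: "?C \<subseteq> cdom c" using cinv_in[OF subsetD[OF K(2)]] by (simp add: image_subset_iff)
  have "?C \<subseteq> topspace (subtopology (mtop M) (cdom c))" by (simp only: topspace_cdom[OF c] Cc)
  from homeomorphic_map_compactness[OF homeo[OF c] this] K
  have "compactin (subtopology (mtop M) (cdom c)) ?C"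
    unfolding CK by (simp add: compactin_subtopology)
  then have "compactin (mtop M) ?C" by (simp add: compactin_subtopology)
  then show ?thesis
    using compactin_imp_closedin smooth_manifold by (auto simp: smooth_manifold_def)
qed

lemma lift_fun_smooth:
  assumes c: "c \<in> matlas M" and u: "smooth_on UNIV u" and K: "compact K" "K \<subseteq> cim c"
    and off: "\<And>x. x \<notin> K \<Longrightarrow> u x = 0"
  shows "lift_fun c u \<in> smooth_funs M"
proof (rule smooth_funsI)
  show "lift_fun c u q = 0" if "q \<notin> points M" for q
    using that cdom_subset[OF c] by (auto simp: lift_fun_def)
next
  fix d assume d: "d \<in> matlas M"
  let ?C = "cinv c ` K"
  have Cc: "?C \<subseteq> cdom c" using cinv_in[OF subsetD[OF K(2)]] by (simp add: image_subset_iff)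
  have "closedin (mtop M) ?C" by (rule closedin_cinv_image[OF c K])
  then have opV: "openin (mtop M) (points M - ?C)" by blast
  show "smooth_on (cim d) (\<lambda>x. lift_fun c u (cinv d x))"
  proof (rule smooth_on_local)
    fix x assume x: "x \<in> cim d"
    let ?q = "cinv d x"
    have qd: "?q \<in> cdom d" "cmap d ?q = x" using cinv_in[OF x] cmap_cinv[OF x] by auto
    show "\<exists>T. open T \<and> x \<in> T \<and> smooth_on T (\<lambda>x. lift_fun c u (cinv d x))"
    proof (cases "?q \<in> cdom c")
      case True
      let ?T = "cmap d ` (cdom d \<inter> cdom c)"
      have T: "open ?T" "x \<in> ?T"
        using open_cmap_image[OF d openin_cdom[OF c]] True qd by (auto intro: image_eqI[of _ _ ?q])
      have "smooth_on ?T (\<lambda>x. cmap c (cinv d x))"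
        using smooth_manifold c d by (simp add: smooth_manifold_def smooth_transition_def comp_def)
      then have "smooth_on ?T (\<lambda>x. u (cmap c (cinv d x)))"
        by (rule smooth_on_compose[OF T(1) _ u]) simp
      then have "smooth_on ?T (\<lambda>x. lift_fun c u (cinv d x))"
        by (rule smooth_on_cong[OF T(1)]) (auto simp: lift_fun_def cinv_cmap[OF d])
      then show ?thesis using T by blast
    next
      case False
      let ?T = "cmap d ` (cdom d \<inter> (points M - ?C))"
      have T: "open ?T" using open_cmap_image[OF d opV] .
      have "x \<in> ?T" using False Cc qd cdom_subset[OF d] by (auto intro!: image_eqI[of _ _ ?q])
      have "smooth_on ?T (\<lambda>x. lift_fun c u (cinv d x))"
      proof (rule smooth_on_cong[OF T smooth_on_const[OF T], of 0])
        fix y assume "y \<in> ?T"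
        then obtain q where q: "q \<in> cdom d" "q \<notin> ?C" "y = cmap d q" by blast
        have "u (cmap c q) = 0" if "q \<in> cdom c"
          using off q(2) cinv_cmap[OF c that] by (metis image_eqI)
        then show "0 = lift_fun c u (cinv d y)" by (simp add: q cinv_cmap[OF d] lift_fun_def)
      qed
      then show ?thesis using T \<open>x \<in> ?T\<close> by blast
    qed
  qed
qed

section \<open>Bump functions\<close>

lemma plateau:
  assumes c: "c \<in> matlas M" and V: "openin (mtop M) V" and p: "p \<in> cdom c" "p \<in> V"
  obtains r W K where "smooth_on UNIV r" "open W" "cmap c p \<in> W" "W \<subseteq> K" "compact K"
    "K \<subseteq> cmap c ` (cdom c \<inter> V)" "\<And>x. x \<in> W \<Longrightarrow> r x = (1::real)" "\<And>x. x \<notin> K \<Longrightarrow> r x = 0"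
proof -
  let ?a = "cmap c p"
  have "open (cmap c ` (cdom c \<inter> V))" "?a \<in> cmap c ` (cdom c \<inter> V)"
    using open_cmap_image[OF c V] p by auto
  then obtain e where e: "e > 0" "cball ?a e \<subseteq> cmap c ` (cdom c \<inter> V)"
    using open_contains_cball by blast
  obtain r where r: "smooth_on UNIV r" "\<And>x. dist ?a x \<le> e / 2 \<Longrightarrow> r x = (1::real)"
    "\<And>x. dist ?a x > 2 * (e / 2) \<Longrightarrow> r x = 0"
    using plateau_function[of "e / 2" ?a] e(1) by auto
  show thesis
    by (rule that[of r "ball ?a (e / 2)" "cball ?a e"]) (use r e in auto)
qed

lemma bump:
  assumes V: "openin (mtop M) V" and p: "p \<in> V"
  obtains \<rho> where "\<rho> \<in> smooth_funs M" "\<rho> p = 1" "\<And>q. \<rho> q \<noteq> 0 \<Longrightarrow> q \<in> V"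
proof -
  obtain c where c: "c \<in> matlas M" "p \<in> cdom c"
    using chart_at[of p] p openin_subset[OF V] by blast
  obtain r W K where r: "smooth_on UNIV r" "open W" "cmap c p \<in> W" "W \<subseteq> K" "compact K"
    "K \<subseteq> cmap c ` (cdom c \<inter> V)" "\<And>x. x \<in> W \<Longrightarrow> r x = (1::real)" "\<And>x. x \<notin> K \<Longrightarrow> r x = 0"
    using plateau[OF c(1) V c(2) p] by metis
  show thesis
  proof (rule that)
    show "lift_fun c r \<in> smooth_funs M" using lift_fun_smooth[OF c(1) r(1,5)] r(6,8) by blast
    show "lift_fun c r p = 1" using r(3,7) c(2) by (simp add: lift_fun_def)
    fix q assume "lift_fun c r q \<noteq> 0"
    then have q: "q \<in> cdom c" "r (cmap c q) \<noteq> 0" by (auto simp: lift_fun_def split: if_splits)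
    then obtain q' where "q' \<in> cdom c \<inter> V" "cmap c q = cmap c q'" using r(6,8) by blast
    then show "q \<in> V" using q(1) cinv_cmap[OF c(1)] by (metis IntE)
  qed
qed

lemma smooth_funs_separate:
  assumes "p \<in> points M" "q \<in> points M" "\<And>f. f \<in> smooth_funs M \<Longrightarrow> f p = f q"
  shows "p = q"
proof (rule ccontr)
  assume "p \<noteq> q"
  then obtain V where "openin (mtop M) V" "p \<in> V" "q \<notin> V"
    using smooth_manifold assms unfolding smooth_manifold_def Hausdorff_space_def disjnt_def by blast
  then show False using bump assms(3) by (metis zero_neq_one)
qed

section \<open>Tangent vectors as derivations, and their coordinates\<close>

lemma tangentD:
  assumes "v \<in> tangent_space M p"
  shows "f \<in> smooth_funs M \<Longrightarrow> h \<in> smooth_funs M \<Longrightarrow> v (f + h) = v f + v h"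
    and "f \<in> smooth_funs M \<Longrightarrow> v (a *\<^sub>R f) = a * v f"
    and "f \<in> smooth_funs M \<Longrightarrow> h \<in> smooth_funs M \<Longrightarrow> v (f * h) = f p * v h + h p * v f"
    and "f \<notin> smooth_funs M \<Longrightarrow> v f = 0"
  using assms by (auto simp: tangent_space_def linear_on_subspace_def)

lemma tangentI:
  assumes "\<And>f h. f \<in> smooth_funs M \<Longrightarrow> h \<in> smooth_funs M \<Longrightarrow> v (f + h) = v f + v h"
    "\<And>a f. f \<in> smooth_funs M \<Longrightarrow> v (a *\<^sub>R f) = a * v f"
    "\<And>f h. f \<in> smooth_funs M \<Longrightarrow> h \<in> smooth_funs M \<Longrightarrow> v (f * h) = f p * v h + h p * v f"
    "\<And>f. f \<notin> smooth_funs M \<Longrightarrow> v f = 0"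
  shows "v \<in> tangent_space M p"
  using assms by (auto simp: tangent_space_def linear_on_subspace_def)

lemma tangent_eqI:
  assumes "v \<in> tangent_space M p" "w \<in> tangent_space M p'" "\<And>f. f \<in> smooth_funs M \<Longrightarrow> v f = w f"
  shows "v = w"
  using assms tangentD(4) by (metis ext)

lemma tangent_zero: "0 \<in> tangent_space M p"
  by (rule tangentI) auto

lemma tangent_add: "v \<in> tangent_space M p \<Longrightarrow> w \<in> tangent_space M p \<Longrightarrow> v + w \<in> tangent_space M p"
  by (rule tangentI) (auto simp: tangentD algebra_simps)

lemma tangent_scaleR: "v \<in> tangent_space M p \<Longrightarrow> a *\<^sub>R v \<in> tangent_space M p"
  by (rule tangentI) (auto simp: tangentD scaleR_fun_def[of a v] algebra_simps)

lemma tangent_apply_zero: "v \<in> tangent_space M p \<Longrightarrow> v 0 = 0"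
  using tangentD(2)[of v p 0 0] smooth_funs_zero by (simp add: scaleR_fun_def zero_fun_def)

lemma tangent_apply_minus:
  assumes "v \<in> tangent_space M p" "f \<in> smooth_funs M" "h \<in> smooth_funs M"
  shows "v (f - h) = v f - v h"
proof -
  have eq: "f - h = f + (-1) *\<^sub>R h" by (auto simp: scaleR_fun_def)
  show ?thesis
    by (subst eq, subst tangentD(1)[OF assms(1,2) smooth_funs_scaleR[OF assms(3)]],
        subst tangentD(2)[OF assms(1,3)]) simp
qed

lemma tangent_apply_sum:
  assumes "v \<in> tangent_space M p"
  shows "finite I \<Longrightarrow> (\<And>i. i \<in> I \<Longrightarrow> f i \<in> smooth_funs M) \<Longrightarrow> v (\<Sum>i\<in>I. f i) = (\<Sum>i\<in>I. v (f i))"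
  by (induction I rule: finite_induct) (auto simp: tangent_apply_zero[OF assms] tangentD(1)[OF assms] smooth_funs_sum)

lemma tangent_apply_const:
  assumes "v \<in> tangent_space M p" "p \<in> points M"
  shows "v (zero_off M (\<lambda>_. k)) = 0"
proof -
  let ?one = "zero_off M (\<lambda>_. 1::real)"
  have "v (?one * ?one) = v ?one + v ?one"
    using tangentD(3)[OF assms(1) smooth_funs_const smooth_funs_const] assms(2) by (simp add: zero_off_def)
  moreover have "?one * ?one = ?one" by (rule ext) (simp add: zero_off_def)
  ultimately have "v ?one = 0" by simp
  moreover have "zero_off M (\<lambda>_. k) = k *\<^sub>R ?one"
    by (rule ext) (simp add: zero_off_def scaleR_fun_def)
  ultimately show ?thesis using tangentD(2)[OF assms(1) smooth_funs_const] by simp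
qed

lemma chart_has_derivative:
  assumes "c \<in> matlas M" "q \<in> cdom c" "f \<in> smooth_funs M"
  shows "((\<lambda>x. f (cinv c x)) has_derivative frechet_derivative (\<lambda>x. f (cinv c x)) (at (cmap c q))) (at (cmap c q))"
  using smooth_on_has_derivative[OF smooth_funsD(2)[OF assms(3,1)]] assms(2) by blast

lemma coord_vector_apply:
  "f \<in> smooth_funs M \<Longrightarrow> coord_vector M c q w f = frechet_derivative (\<lambda>x. f (cinv c x)) (at (cmap c q)) w"
  by (simp add: coord_vector_def comp_def)

lemma coord_vector_apply_eq:
  assumes "f \<in> smooth_funs M" "((\<lambda>x. f (cinv c x)) has_derivative D) (at (cmap c q))"
  shows "coord_vector M c q w f = D w"
  using assms frechet_derivative_eqI coord_vector_apply by metis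

lemma coord_vector_tangent:
  assumes c: "c \<in> matlas M" and q: "q \<in> cdom c"
  shows "coord_vector M c q w \<in> tangent_space M q"
proof (rule tangentI)
  fix f h assume f: "f \<in> smooth_funs M" and h: "h \<in> smooth_funs M"
  note df = chart_has_derivative[OF c q f] and dh = chart_has_derivative[OF c q h]
  show "coord_vector M c q w (f + h) = coord_vector M c q w f + coord_vector M c q w h"
    using coord_vector_apply_eq[OF smooth_funs_add[OF f h]] has_derivative_add[OF df dh]
    by (simp add: coord_vector_apply f h)
  show "coord_vector M c q w (f * h) = f q * coord_vector M c q w h + h q * coord_vector M c q w f"
    using coord_vector_apply_eq[OF smooth_funs_mult[OF f h]] has_derivative_mult[OF df dh]
    by (simp add: coord_vector_apply f h cinv_cmap[OF c q] mult.commute)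
next
  fix a f assume f: "f \<in> smooth_funs M"
  note df = chart_has_derivative[OF c q f]
  show "coord_vector M c q w (a *\<^sub>R f) = a * coord_vector M c q w f"
  proof (subst coord_vector_apply_eq[OF smooth_funs_scaleR[OF f]])
    show "((\<lambda>x. (a *\<^sub>R f) (cinv c x)) has_derivative
        (\<lambda>w. a *\<^sub>R frechet_derivative (\<lambda>x. f (cinv c x)) (at (cmap c q)) w)) (at (cmap c q))"
      using has_derivative_scaleR_right[OF df] by (simp add: scaleR_fun_def)
  qed (simp add: coord_vector_apply f)
qed (simp add: coord_vector_def)

lemma coord_vector_linear:
  assumes c: "c \<in> matlas M" and q: "q \<in> cdom c"
  shows "coord_vector M c q (w + w') = coord_vector M c q w + coord_vector M c q w'"
    and "coord_vector M c q (a *\<^sub>R w) = a *\<^sub>R coord_vector M c q w"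
  using has_derivative_linear[OF chart_has_derivative[OF c q]]
  by (auto simp: coord_vector_def comp_def scaleR_fun_def linear_add linear_scale)

text \<open>Hadamard's lemma, applied in the chart.\<close>

lemma tangent_determined:
  assumes c: "c \<in> matlas M" and p: "p \<in> cdom c"
    and r: "smooth_on UNIV r" "compact K" "K \<subseteq> cim c" "r (cmap c p) = 1" "\<And>x. x \<notin> K \<Longrightarrow> r x = 0"
    and v: "v \<in> tangent_space M p" and w: "w \<in> tangent_space M p"
    and eq: "\<And>i. i \<in> Basis \<Longrightarrow> v (lift_fun c (\<lambda>x. r x * ((x - cmap c p) \<bullet> i)))
      = w (lift_fun c (\<lambda>x. r x * ((x - cmap c p) \<bullet> i)))"
  shows "v = w"
proof (rule tangent_eqI[OF v w])
  fix f assume f: "f \<in> smooth_funs M"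
  let ?a = "cmap c p"
  have pM: "p \<in> points M" using cdom_subset[OF c p] .
  \<comment> \<open>The cut-off turns \<open>f\<close> in the chart into a function smooth on the
    whole Euclidean space, as \<open>hadamard\<close> demands.\<close>
  define F where "F x = r x * (f (cinv c x) - f p)" for x
  have "smooth_on UNIV F"
  proof (rule smooth_on_local)
    fix x :: 'e
    show "\<exists>T. open T \<and> x \<in> T \<and> smooth_on T F"
    proof (cases "x \<in> cim c")
      case True
      have "smooth_on (cim c) F" unfolding F_def
        by (intro smooth_on_mult smooth_on_minus smooth_on_const smooth_funsD(2) f c open_cim
            smooth_on_subset[OF r(1)] subset_UNIV)
      then show ?thesis using True open_cim[OF c] by blast
    next
      case False
      have "open (- K)" using r(2) compact_imp_closed by blast
      moreover have "smooth_on (- K) F"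
        by (rule smooth_on_cong[OF \<open>open (- K)\<close> smooth_on_const[OF \<open>open (- K)\<close>], of 0])
          (simp add: F_def r(5))
      ultimately show ?thesis using False r(3) by blast
    qed
  qed
  then obtain G where G: "\<And>i. smooth_on UNIV (G i)"
    "\<And>x. F x = F ?a + (\<Sum>i\<in>Basis. ((x - ?a) \<bullet> i) * G i x)"
    using hadamard by metis
  define R where "R = lift_fun c r"
  define A where "A i = lift_fun c (\<lambda>x. r x * ((x - ?a) \<bullet> i))" for i
  define B where "B i = lift_fun c (\<lambda>x. r x * G i x)" for i
  define k where "k = zero_off M (\<lambda>_. f p)"
  have RA: "R \<in> smooth_funs M" "A i \<in> smooth_funs M" "B i \<in> smooth_funs M" "k \<in> smooth_funs M" for i
    unfolding R_def A_def B_def k_def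
    by (intro smooth_funs_const lift_fun_smooth[OF c _ r(2,3)] smooth_on_mult smooth_on_inner smooth_on_minus
        smooth_on_const smooth_on_id r(1) G(1) open_UNIV; simp add: r(5))+
  \<comment> \<open>One factor \<open>R\<close> comes from \<open>F\<close>, the other two from the
    cut-offs inside \<open>A i\<close> and \<open>B i\<close>. A derivation at \<open>p\<close> does
    not notice the cube: \<open>R p = 1\<close>, and \<open>f - k\<close> vanishes at
    \<open>p\<close>.\<close>
  have id: "R * R * R * (f - k) = (\<Sum>i\<in>Basis. A i * B i)"
  proof
    fix q
    have "(\<Sum>i\<in>Basis. A i * B i) q = (\<Sum>i\<in>Basis. A i q * B i q)"
      by (simp add: sum_fun_apply)
    also have "\<dots> = (R * R * R * (f - k)) q"
    proof (cases "q \<in> cdom c")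
      case True
      let ?x = "cmap c q"
      have Fx: "F ?x = (\<Sum>i\<in>Basis. ((?x - ?a) \<bullet> i) * G i ?x)"
        using G(2)[of ?x] by (simp add: F_def cinv_cmap[OF c p])
      have "(\<Sum>i\<in>Basis. A i q * B i q) = r ?x * r ?x * F ?x"
        unfolding Fx sum_distrib_left using True by (intro sum.cong) (auto simp: A_def B_def lift_fun_def)
      then show ?thesis using True cdom_subset[OF c True]
        by (simp add: F_def R_def lift_fun_def k_def zero_off_def cinv_cmap[OF c])
    qed (simp add: A_def R_def lift_fun_def)
    finally show "(R * R * R * (f - k)) q = (\<Sum>i\<in>Basis. A i * B i) q" by simp
  qed
  have val: "R p = 1" "k p = f p" "A i p = 0" for i
    using p pM r(4) by (auto simp: R_def A_def lift_fun_def k_def zero_off_def)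
  have main: "u f = (\<Sum>i\<in>Basis. B i p * u (A i))" if u: "u \<in> tangent_space M p" for u
  proof -
    have "u (R * R * R * (f - k)) = u (f - k)"
      by (simp add: tangentD(3)[OF u] RA f smooth_funs_mult smooth_funs_minus val)
    also have "\<dots> = u f"
      using tangent_apply_minus[OF u f RA(4)] tangent_apply_const[OF u pM, of "f p"] by (simp add: k_def)
    finally have "u f = u (\<Sum>i\<in>Basis. A i * B i)" using id by simp
    also have "\<dots> = (\<Sum>i\<in>Basis. B i p * u (A i))"
      by (simp add: tangent_apply_sum[OF u] smooth_funs_mult RA tangentD(3)[OF u] val)
    finally show ?thesis .
  qed
  show "v f = w f" using main[OF v] main[OF w] eq by (simp add: A_def)
qed

lemma coord_vector_lift:
  assumes c: "c \<in> matlas M" and q: "q \<in> cdom c" "cmap c q \<in> W" and W: "open W" "W \<subseteq> cim c"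
    and L: "lift_fun c u \<in> smooth_funs M" "\<And>x. x \<in> W \<Longrightarrow> u x = u' x"
    and d: "(u' has_derivative D) (at (cmap c q))"
  shows "coord_vector M c q w (lift_fun c u) = D w"
proof (rule coord_vector_apply_eq[OF L(1)])
  show "((\<lambda>x. lift_fun c u (cinv c x)) has_derivative D) (at (cmap c q))"
  proof (rule has_derivative_transform_within_open[OF d W(1) q(2)])
    fix x assume x: "x \<in> W"
    then have "x \<in> cim c" using W(2) by blast
    then show "u' x = lift_fun c u (cinv c x)"
      using cinv_in[of x c] cmap_cinv[of x c] L(2)[OF x] by (simp add: lift_fun_def)
  qed
qed

text \<open>The coefficients are the values on the cut-off coordinate functions \<open>A i\<close>,
  and by \<open>tangent_determined\<close> these values decide the vector.\<close>

lemma tangent_coord_vector: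
  assumes c: "c \<in> matlas M" and p: "p \<in> cdom c" and v: "v \<in> tangent_space M p"
  obtains w where "v = coord_vector M c p w"
proof -
  let ?a = "cmap c p"
  obtain r W K where r: "smooth_on UNIV r" "open W" "?a \<in> W" "W \<subseteq> K" "compact K"
    "K \<subseteq> cim c" "\<And>x. x \<in> W \<Longrightarrow> r x = (1::real)" "\<And>x. x \<notin> K \<Longrightarrow> r x = 0"
    using plateau[OF c openin_cdom[OF c] p p] by (metis Int_absorb)
  define A where "A i = lift_fun c (\<lambda>x. r x * ((x - ?a) \<bullet> i))" for i
  have A: "A i \<in> smooth_funs M" for i
    unfolding A_def
    by (intro lift_fun_smooth[OF c _ r(5,6)] smooth_on_mult smooth_on_inner smooth_on_minus
        smooth_on_const smooth_on_id r(1) open_UNIV) (simp add: r(8))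
  define w where "w = (\<Sum>i\<in>Basis. v (A i) *\<^sub>R i)"
  have "v = coord_vector M c p w"
  proof (rule tangent_determined[OF c p r(1,5,6) _ r(8) v coord_vector_tangent[OF c p]])
    show "r ?a = 1" using r(3,7) by simp
    fix i :: 'e assume i: "i \<in> Basis"
    have "coord_vector M c p w (A i) = w \<bullet> i" unfolding A_def
    proof (rule coord_vector_lift[OF c p r(3,2)])
      show "((\<lambda>x. (x - ?a) \<bullet> i) has_derivative (\<lambda>w. w \<bullet> i)) (at ?a)" by (auto intro!: derivative_eq_intros)
    qed (use r A[unfolded A_def] in auto)
    then show "v (lift_fun c (\<lambda>x. r x * ((x - ?a) \<bullet> i))) = coord_vector M c p w (lift_fun c (\<lambda>x. r x * ((x - ?a) \<bullet> i)))"
      using i by (simp add: A_def w_def)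
  qed
  then show thesis using that by blast
qed

text \<open>Global functions that agree with the coordinates on a whole neighbourhood. Since they
  are global, the coefficients of a vector field in the coordinate frame become smooth functions
  there.\<close>

lemma dual_functions:
  assumes c: "c \<in> matlas M" and p: "p \<in> cdom c"
  obtains W h where "open W" "cmap c p \<in> W" "W \<subseteq> cim c" "\<And>i. h i \<in> smooth_funs M"
    "\<And>q w i. q \<in> cdom c \<Longrightarrow> cmap c q \<in> W \<Longrightarrow> coord_vector M c q w (h i) = w \<bullet> i"
    "\<And>q v. q \<in> cdom c \<Longrightarrow> cmap c q \<in> W \<Longrightarrow> v \<in> tangent_space M q \<Longrightarrow>
      v = coord_vector M c q (\<Sum>i\<in>Basis. v (h i) *\<^sub>R i)"
    "\<And>q i. q \<in> cdom c \<Longrightarrow> cmap c q \<in> W \<Longrightarrow> h i q = cmap c q \<bullet> i"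
proof -
  let ?a = "cmap c p"
  obtain r W K where r: "smooth_on UNIV r" "open W" "?a \<in> W" "W \<subseteq> K" "compact K"
    "K \<subseteq> cim c" "\<And>x. x \<in> W \<Longrightarrow> r x = (1::real)" "\<And>x. x \<notin> K \<Longrightarrow> r x = 0"
    using plateau[OF c openin_cdom[OF c] p p] by (metis Int_absorb)
  define h where "h i = lift_fun c (\<lambda>x. r x * (x \<bullet> i))" for i
  have h: "h i \<in> smooth_funs M" for i
    unfolding h_def
    by (intro lift_fun_smooth[OF c _ r(5,6)] smooth_on_mult smooth_on_inner
        smooth_on_const smooth_on_id r(1) open_UNIV) (simp add: r(8))
  have co: "coord_vector M c q w (h i) = w \<bullet> i" if "q \<in> cdom c" "cmap c q \<in> W" for q w i
    unfolding h_def
  proof (rule coord_vector_lift[OF c that r(2)])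
    show "((\<lambda>x. x \<bullet> i) has_derivative (\<lambda>w. w \<bullet> i)) (at (cmap c q))" by (auto intro!: derivative_eq_intros)
  qed (use r h[unfolded h_def] in auto)
  show thesis
  proof (rule that[OF r(2,3) _ h co])
    show "W \<subseteq> cim c" using r by blast
    show "v = coord_vector M c q (\<Sum>i\<in>Basis. v (h i) *\<^sub>R i)"
      if q: "q \<in> cdom c" "cmap c q \<in> W" and v: "v \<in> tangent_space M q" for q v
    proof -
      obtain w where w: "v = coord_vector M c q w" using tangent_coord_vector[OF c q(1) v] .
      then show ?thesis by (simp add: co[OF q] euclidean_representation)
    qed
    show "h i q = cmap c q \<bullet> i" if "q \<in> cdom c" "cmap c q \<in> W" for q i
      using that r(7) by (simp add: h_def lift_fun_def)
  qed
qed

lemma coord_vector_inj: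
  assumes "c \<in> matlas M" "q \<in> cdom c" "coord_vector M c q w = coord_vector M c q w'"
  shows "w = w'"
  using dual_functions[OF assms(1,2)] assms(2,3) by (metis euclidean_eqI)

lemma tangent_basis:
  assumes "p \<in> points M"
  shows "\<exists>(h :: 'e \<Rightarrow> 'm \<Rightarrow> real) (e :: 'e \<Rightarrow> 'm tvec).
    (\<forall>i. h i \<in> smooth_funs M) \<and> (\<forall>i. e i \<in> tangent_space M p) \<and>
    (\<forall>v\<in>tangent_space M p. v = (\<Sum>i\<in>Basis. v (h i) *\<^sub>R e i))"
proof -
  obtain c where c: "c \<in> matlas M" "p \<in> cdom c" using chart_at[OF assms] .
  obtain W h where h: "cmap c p \<in> W" "\<And>i. h i \<in> smooth_funs M"
    "\<And>q v. q \<in> cdom c \<Longrightarrow> cmap c q \<in> W \<Longrightarrow> v \<in> tangent_space M q \<Longrightarrow>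
      v = coord_vector M c q (\<Sum>i\<in>Basis. v (h i) *\<^sub>R i)"
    by (rule dual_functions[OF c]) (rule that, assumption+)
  have sum: "coord_vector M c p (\<Sum>i\<in>I. k i *\<^sub>R i) = (\<Sum>i\<in>I. k i *\<^sub>R coord_vector M c p i)"
    if "finite I" for k and I :: "'e set"
    using that
  proof (induction I rule: finite_induct)
    case empty
    then show ?case using coord_vector_linear(2)[OF c, of 0 0] by (simp add: scaleR_fun_def zero_fun_def)
  qed (simp add: coord_vector_linear[OF c])
  show ?thesis
  proof (intro exI[of _ h] exI[of _ "coord_vector M c p"] conjI allI ballI h(2) coord_vector_tangent[OF c])
    show "v = (\<Sum>i\<in>Basis. v (h i) *\<^sub>R coord_vector M c p i)" if "v \<in> tangent_space M p" for v
      using h(3)[OF c(2) h(1) that] sum[OF finite_Basis, of "\<lambda>i. v (h i)"] by simp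
  qed
qed

lemma zero_derivative_imp_constant:
  assumes conn: "connected_space (mtop M)" and f: "f \<in> smooth_funs M"
    and zero: "\<And>p v. p \<in> points M \<Longrightarrow> v \<in> tangent_space M p \<Longrightarrow> v f = 0"
    and pq: "p \<in> points M" "q \<in> points M"
  shows "f p = f q"
proof -
  have loc: "\<exists>T. openin (mtop M) T \<and> a \<in> T \<and> (\<forall>b\<in>T. f b = f a)" if a: "a \<in> points M" for a
  proof -
    obtain c where c: "c \<in> matlas M" "a \<in> cdom c" using chart_at[OF a] .
    obtain e where e: "e > 0" "ball (cmap c a) e \<subseteq> cim c"
      using open_cim[OF c(1)] c(2) open_contains_ball by (metis imageI)
    have der: "((\<lambda>x. f (cinv c x)) has_derivative (\<lambda>_. 0)) (at x)" if x: "x \<in> cim c" for x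
    proof -
      have q: "cinv c x \<in> cdom c" "cmap c (cinv c x) = x" using cinv_in[OF x] cmap_cinv[OF x] by auto
      have "frechet_derivative (\<lambda>x. f (cinv c x)) (at x) w = 0" for w
        using zero[OF cdom_subset[OF c(1) q(1)] coord_vector_tangent[OF c(1) q(1), of w]]
          coord_vector_apply[OF f, of c "cinv c x" w] q(2) by simp
      then show ?thesis using chart_has_derivative[OF c(1) q(1) f] q(2)
        by (simp add: has_derivative_eq_rhs[of _ "frechet_derivative (\<lambda>x. f (cinv c x)) (at x)"] fun_eq_iff)
    qed
    have "f b = f a" if b: "b \<in> cdom c" "cmap c b \<in> ball (cmap c a) e" for b
    proof -
      have "f (cinv c (cmap c b)) = f (cinv c (cmap c a))"
        by (rule has_derivative_zero_unique[OF convex_ball, of "cmap c a" e])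
          (use b e in \<open>auto intro!: has_derivative_at_withinI[OF der]\<close>)
      then show ?thesis using cinv_cmap[OF c(1)] b(1) c(2) by simp
    qed
    then have "\<forall>b\<in>{q \<in> cdom c. cmap c q \<in> ball (cmap c a) e}. f b = f a" by blast
    moreover have "a \<in> {q \<in> cdom c. cmap c q \<in> ball (cmap c a) e}" using c(2) e(1) by simp
    ultimately show ?thesis using openin_cmap_preimage[OF c(1) open_ball] by blast
  qed
  \<comment> \<open>Being locally constant makes the set where \<open>f\<close> has a given property
    open. Applied to a property and to its negation, this gives a clopen set.\<close>
  have op: "openin (mtop M) {a \<in> points M. P (f a)}" for P
  proof (subst openin_subopen, intro ballI)
    fix a assume "a \<in> {a \<in> points M. P (f a)}"
    then have a: "a \<in> points M" "P (f a)" by auto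
    obtain T where T: "openin (mtop M) T" "a \<in> T" "\<And>b. b \<in> T \<Longrightarrow> f b = f a" using loc[OF a(1)] by blast
    have "P (f b)" if "b \<in> T" for b unfolding T(3)[OF that] by (rule a(2))
    then have "T \<subseteq> {a \<in> points M. P (f a)}" using openin_subset[OF T(1)] by blast
    then show "\<exists>T. openin (mtop M) T \<and> a \<in> T \<and> T \<subseteq> {a \<in> points M. P (f a)}" using T by blast
  qed
  let ?S = "{a \<in> points M. f a = f p}"
  have "points M - ?S = {a \<in> points M. f a \<noteq> f p}" by auto
  then have "closedin (mtop M) ?S" using op[of "\<lambda>y. y \<noteq> f p"] by (auto simp: closedin_def)
  then have "?S = {} \<or> ?S = points M"
    using op[of "\<lambda>y. y = f p"] conn by (auto simp: connected_space_clopen_in)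
  then have "q \<in> ?S" using pq by blast
  then show ?thesis by simp
qed

section \<open>Vector fields and their brackets\<close>

lemma vector_fieldD:
  assumes "X \<in> vector_fields M"
  shows "p \<in> points M \<Longrightarrow> X p \<in> tangent_space M p" and "p \<notin> points M \<Longrightarrow> X p = 0"
    and "f \<in> smooth_funs M \<Longrightarrow> act_on_fun X f \<in> smooth_funs M"
  using assms by (auto simp: vector_fields_def)

lemma act_mult:
  assumes Y: "Y \<in> vector_fields M" and f: "f \<in> smooth_funs M" and h: "h \<in> smooth_funs M"
  shows "act_on_fun Y (f * h) = f * act_on_fun Y h + h * act_on_fun Y f"
proof
  fix p show "act_on_fun Y (f * h) p = (f * act_on_fun Y h + h * act_on_fun Y f) p"
    using tangentD(3)[OF vector_fieldD(1)[OF Y] f h] vector_fieldD(2)[OF Y]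
    by (cases "p \<in> points M") (auto simp: act_on_fun_def)
qed

lemma act_add:
  assumes Y: "Y \<in> vector_fields M" and f: "f \<in> smooth_funs M" and h: "h \<in> smooth_funs M"
  shows "act_on_fun Y (f + h) = act_on_fun Y f + act_on_fun Y h"
proof
  fix p show "act_on_fun Y (f + h) p = (act_on_fun Y f + act_on_fun Y h) p"
    using tangentD(1)[OF vector_fieldD(1)[OF Y] f h] vector_fieldD(2)[OF Y]
    by (cases "p \<in> points M") (auto simp: act_on_fun_def)
qed

lemma act_scaleR:
  assumes Y: "Y \<in> vector_fields M" and f: "f \<in> smooth_funs M"
  shows "act_on_fun Y (a *\<^sub>R f) = a *\<^sub>R act_on_fun Y f"
proof
  fix p show "act_on_fun Y (a *\<^sub>R f) p = (a *\<^sub>R act_on_fun Y f) p"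
    using tangentD(2)[OF vector_fieldD(1)[OF Y] f] vector_fieldD(2)[OF Y]
    by (cases "p \<in> points M") (auto simp: act_on_fun_def scaleR_fun_def)
qed

lemma act_nonsmooth:
  assumes "Y \<in> vector_fields M" "f \<notin> smooth_funs M"
  shows "act_on_fun Y f = 0"
proof
  fix p show "act_on_fun Y f p = 0 p"
    using tangentD(4)[OF vector_fieldD(1)[OF assms(1)] assms(2)] vector_fieldD(2)[OF assms(1)]
    by (cases "p \<in> points M") (auto simp: act_on_fun_def)
qed

lemma lie_bracket_vector_field:
  assumes X: "X \<in> vector_fields M" and Y: "Y \<in> vector_fields M"
  shows "lie_bracket X Y \<in> vector_fields M"
  unfolding vector_fields_def
proof (intro CollectI conjI ballI allI impI)
  fix p assume p: "p \<in> points M"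
  note Xp = vector_fieldD(1)[OF X p] and Yp = vector_fieldD(1)[OF Y p]
  note sm = vector_fieldD(3)[OF X] vector_fieldD(3)[OF Y] smooth_funs_mult smooth_funs_scaleR
  have ev: "act_on_fun Z k p = Z p k" for Z :: "'m vfield" and k by (simp add: act_on_fun_def)
  show "lie_bracket X Y p \<in> tangent_space M p"
  proof (rule tangentI)
    fix f h assume f: "f \<in> smooth_funs M" and h: "h \<in> smooth_funs M"
    show "lie_bracket X Y p (f + h) = lie_bracket X Y p f + lie_bracket X Y p h"
      by (simp add: lie_bracket_def act_add[OF X f h] act_add[OF Y f h] tangentD(1)[OF Xp] tangentD(1)[OF Yp] sm f h)
    show "lie_bracket X Y p (f * h) = f p * lie_bracket X Y p h + h p * lie_bracket X Y p f"
      by (simp add: lie_bracket_def act_mult[OF X f h] act_mult[OF Y f h] tangentD(1)[OF Xp] tangentD(1)[OF Yp]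
          tangentD(3)[OF Xp] tangentD(3)[OF Yp] sm f h ev algebra_simps)
  next
    fix a f assume f: "f \<in> smooth_funs M"
    show "lie_bracket X Y p (a *\<^sub>R f) = a * lie_bracket X Y p f"
      by (simp add: lie_bracket_def act_scaleR[OF X f] act_scaleR[OF Y f] tangentD(2)[OF Xp] tangentD(2)[OF Yp]
          sm f algebra_simps)
  next
    fix f assume f: "f \<notin> smooth_funs M"
    show "lie_bracket X Y p f = 0"
      by (simp add: lie_bracket_def act_nonsmooth[OF X f] act_nonsmooth[OF Y f]
          tangent_apply_zero[OF Xp] tangent_apply_zero[OF Yp])
  qed
next
  fix p assume "p \<notin> points M"
  then show "lie_bracket X Y p = 0"
    using vector_fieldD(2)[OF X] vector_fieldD(2)[OF Y] by (auto simp: lie_bracket_def)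
next
  fix f assume f: "f \<in> smooth_funs M"
  have "act_on_fun (lie_bracket X Y) f = act_on_fun X (act_on_fun Y f) - act_on_fun Y (act_on_fun X f)"
    by (auto simp: act_on_fun_def lie_bracket_def)
  then show "act_on_fun (lie_bracket X Y) f \<in> smooth_funs M"
    using smooth_funs_minus vector_fieldD(3)[OF X] vector_fieldD(3)[OF Y] f by metis
qed

end

section \<open>Smooth families of functions\<close>

text \<open>Joint smoothness in a Euclidean parameter and a point of the manifold, so that parameter
  derivatives and derivatives along fields are partial derivatives of one function.\<close>

definition psmooth ::
    "'b::euclidean_space set \<Rightarrow> ('m, 'e::euclidean_space) manifold \<Rightarrow> ('b \<Rightarrow> 'm \<Rightarrow> real) \<Rightarrow> bool" where
  "psmooth U M R \<longleftrightarrow> (\<forall>d\<in>matlas M. smooth_on (U \<times> cim d) (\<lambda>z. R (fst z) (cinv d (snd z))))"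

text \<open>Smoothness is tested on global functions. Continuity and a smooth lift to charts are
  then consequences, see \<open>smooth_into_chart_local\<close>.\<close>

definition smooth_into ::
    "'b::euclidean_space set \<Rightarrow> ('m, 'e::euclidean_space) manifold \<Rightarrow> ('b \<Rightarrow> 'm) \<Rightarrow> bool" where
  "smooth_into U M F \<longleftrightarrow>
     (\<forall>x\<in>U. F x \<in> points M) \<and> (\<forall>h\<in>smooth_funs M. smooth_on U (\<lambda>x. h (F x)))"

definition jsmooth ::
    "('n, 'b::euclidean_space) manifold \<Rightarrow> ('m, 'e::euclidean_space) manifold \<Rightarrow> ('n \<Rightarrow> 'm \<Rightarrow> real) \<Rightarrow> bool" where
  "jsmooth N M H \<longleftrightarrow> (\<forall>c\<in>matlas N. psmooth (cim c) M (\<lambda>x. H (cinv c x)))"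

lemma smooth_into_reparam:
  assumes "open U'" "smooth_on U' k" "k ` U' \<subseteq> U" "smooth_into U M F"
  shows "smooth_into U' M (\<lambda>x. F (k x))"
  unfolding smooth_into_def
proof (intro conjI ballI)
  show "F (k x) \<in> points M" if "x \<in> U'" for x using assms that by (auto simp: smooth_into_def)
  show "smooth_on U' (\<lambda>x. h (F (k x)))" if "h \<in> smooth_funs M" for h
    using smooth_on_compose[OF assms(1,2) _ assms(3)] assms(4) that by (auto simp: smooth_into_def)
qed

lemma psmooth_reparam:
  assumes U': "open U'" and k: "smooth_on U' k" "k ` U' \<subseteq> U" and R: "psmooth U M R"
    and M: "smooth_manifold M"
  shows "psmooth U' M (\<lambda>x. R (k x))"
  unfolding psmooth_def
proof
  fix d assume d: "d \<in> matlas M"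
  have op: "open (U' \<times> cim d)"
    using U' smooth_mfd.open_cim[of M d] M d by (simp add: open_Times smooth_mfd_def)
  have "smooth_on (U' \<times> cim d) (\<lambda>z. k (fst z))"
    by (rule smooth_on_compose[OF op smooth_on_linear[OF op bounded_linear_fst] k(1)]) auto
  then have "smooth_on (U' \<times> cim d) (\<lambda>z. (k (fst z), snd z))"
    by (rule smooth_on_Pair[OF op _ smooth_on_linear[OF op bounded_linear_snd]])
  then have "smooth_on (U' \<times> cim d) (\<lambda>z. (\<lambda>z. R (fst z) (cinv d (snd z))) (k (fst z), snd z))"
    by (rule smooth_on_compose[OF op]) (use R d k(2) in \<open>auto simp: psmooth_def\<close>)
  then show "smooth_on (U' \<times> cim d) (\<lambda>z. R (k (fst z)) (cinv d (snd z)))" by simp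
qed

context smooth_mfd
begin

lemma psmoothD: "psmooth U M R \<Longrightarrow> d \<in> matlas M \<Longrightarrow> smooth_on (U \<times> cim d) (\<lambda>z. R (fst z) (cinv d (snd z)))"
  by (simp add: psmooth_def)

lemma open_times_cim: "open U \<Longrightarrow> d \<in> matlas M \<Longrightarrow> open (U \<times> cim d)"
  by (simp add: open_Times open_cim)

lemma psmooth_cong:
  assumes U: "open U" and R: "psmooth U M R"
    and eq: "\<And>x q. x \<in> U \<Longrightarrow> q \<in> points M \<Longrightarrow> R x q = R' x q"
  shows "psmooth U M R'"
  unfolding psmooth_def
proof
  fix d assume d: "d \<in> matlas M"
  show "smooth_on (U \<times> cim d) (\<lambda>z. R' (fst z) (cinv d (snd z)))"
  proof (rule smooth_on_cong[OF open_times_cim[OF U d] psmoothD[OF R d]])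
    fix z assume z: "z \<in> U \<times> cim d"
    show "R (fst z) (cinv d (snd z)) = R' (fst z) (cinv d (snd z))"
      by (rule eq) (use z cdom_subset[OF d cinv_in] in auto)
  qed
qed

lemma psmooth_section:
  assumes U: "open U" "x \<in> U" and R: "psmooth U M R"
  shows "zero_off M (R x) \<in> smooth_funs M"
proof (rule smooth_funsI)
  fix d assume d: "d \<in> matlas M"
  note op = open_cim[OF d]
  have "smooth_on (cim d) (\<lambda>y. (\<lambda>z. R (fst z) (cinv d (snd z))) (x, y))"
    by (rule smooth_on_compose[OF op smooth_on_Pair[OF op smooth_on_const[OF op] smooth_on_id[OF op]]
          psmoothD[OF R d]]) (use U in auto)
  then show "smooth_on (cim d) (\<lambda>y. zero_off M (R x) (cinv d y))"
    by (rule smooth_on_cong[OF op]) (simp add: zero_off_def cdom_subset[OF d cinv_in])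
qed (simp add: zero_off_def)

lemma psmooth_at:
  assumes U: "open U" and R: "psmooth U M R" and q: "q \<in> points M"
  shows "smooth_on U (\<lambda>x. R x q)"
proof -
  obtain d where d: "d \<in> matlas M" "q \<in> cdom d" using chart_at[OF q] .
  have "smooth_on U (\<lambda>x. (\<lambda>z. R (fst z) (cinv d (snd z))) (x, cmap d q))"
    by (rule smooth_on_compose[OF U smooth_on_Pair[OF U smooth_on_id[OF U] smooth_on_const[OF U]]
          psmoothD[OF R d(1)]]) (use d in auto)
  then show ?thesis by (simp add: cinv_cmap[OF d])
qed

lemma psmooth_partials:
  assumes U: "open U" "x \<in> U" and R: "psmooth U M R" and d: "d \<in> matlas M" and y: "y \<in> cim d"
  shows "frechet_derivative (\<lambda>x. R x (cinv d y)) (at x)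
      = (\<lambda>v. frechet_derivative (\<lambda>z. R (fst z) (cinv d (snd z))) (at (x, y)) (v, 0))"
    and "frechet_derivative (\<lambda>y. R x (cinv d y)) (at y)
      = (\<lambda>v. frechet_derivative (\<lambda>z. R (fst z) (cinv d (snd z))) (at (x, y)) (0, v))"
proof -
  have "(\<lambda>z. R (fst z) (cinv d (snd z))) differentiable (at (x, y))"
    using smooth_on_has_derivative[OF psmoothD[OF R d], of "(x, y)"] U y
    by (auto simp: differentiable_def)
  from frechet_derivative_partial[OF this]
  show "frechet_derivative (\<lambda>x. R x (cinv d y)) (at x)
      = (\<lambda>v. frechet_derivative (\<lambda>z. R (fst z) (cinv d (snd z))) (at (x, y)) (v, 0))"
    "frechet_derivative (\<lambda>y. R x (cinv d y)) (at y)
      = (\<lambda>v. frechet_derivative (\<lambda>z. R (fst z) (cinv d (snd z))) (at (x, y)) (0, v))"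
    by simp_all
qed

lemma psmooth_deriv:
  assumes U: "open U" and R: "psmooth U M R"
  shows "psmooth U M (\<lambda>x q. frechet_derivative (\<lambda>x. R x q) (at x) w)"
  unfolding psmooth_def
proof
  fix d assume d: "d \<in> matlas M"
  show "smooth_on (U \<times> cim d) (\<lambda>z. frechet_derivative (\<lambda>x. R x (cinv d (snd z))) (at (fst z)) w)"
    by (rule smooth_on_cong[OF open_times_cim[OF U d] smooth_on_frechet_derivative[OF psmoothD[OF R d], of "(w, 0)"]])
      (auto simp: psmooth_partials(1)[OF U _ R d])
qed

lemma field_on_family:
  assumes U: "open U" "x \<in> U" and R: "psmooth U M R" and c: "c \<in> matlas M" and q: "q \<in> cdom c"
    and v: "v = coord_vector M c q (\<Sum>i\<in>Basis. a i *\<^sub>R i)"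
  shows "v (zero_off M (R x))
    = (\<Sum>i\<in>Basis. a i * frechet_derivative (\<lambda>z. R (fst z) (cinv c (snd z))) (at (x, cmap c q)) (0, i))"
proof -
  let ?D = "frechet_derivative (\<lambda>y. zero_off M (R x) (cinv c y)) (at (cmap c q))"
  note sec = psmooth_section[OF U R]
  have lin: "linear ?D" using has_derivative_linear[OF chart_has_derivative[OF c q sec]] .
  have "?D = frechet_derivative (\<lambda>y. R x (cinv c y)) (at (cmap c q))"
    by (rule frechet_derivative_cong_open[OF open_cim[OF c]])
      (use q cdom_subset[OF c cinv_in] in \<open>auto simp: zero_off_def\<close>)
  also have "\<dots> = (\<lambda>v. frechet_derivative (\<lambda>z. R (fst z) (cinv c (snd z))) (at (x, cmap c q)) (0, v))"
    using psmooth_partials(2)[OF U R c] q by blast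
  finally have D: "?D = (\<lambda>v. frechet_derivative (\<lambda>z. R (fst z) (cinv c (snd z))) (at (x, cmap c q)) (0, v))" .
  have "v (zero_off M (R x)) = ?D (\<Sum>i\<in>Basis. a i *\<^sub>R i)" by (simp add: v coord_vector_apply[OF sec])
  also have "\<dots> = (\<Sum>i\<in>Basis. a i * ?D i)" by (simp add: linear_sum[OF lin] linear_scale[OF lin])
  finally show ?thesis unfolding D .
qed

text \<open>Near a point the field is a combination of coordinate vectors whose coefficients
  \<open>Y q (h i)\<close> are smooth, and a partial derivative of a jointly smooth function is
  jointly smooth.\<close>

lemma psmooth_field:
  assumes U: "open U" and R: "psmooth U M R" and Y: "Y \<in> vector_fields M"
  shows "psmooth U M (\<lambda>x q. Y q (zero_off M (R x)))"
  unfolding psmooth_def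
proof
  fix c assume c: "c \<in> matlas M"
  let ?F = "\<lambda>z. R (fst z) (cinv c (snd z))"
  show "smooth_on (U \<times> cim c) (\<lambda>z. Y (cinv c (snd z)) (zero_off M (R (fst z))))"
  proof (rule smooth_on_local)
    fix z0 assume "z0 \<in> U \<times> cim c"
    then have p: "cinv c (snd z0) \<in> cdom c" "cmap c (cinv c (snd z0)) = snd z0" and z0: "fst z0 \<in> U"
      using cinv_in[of "snd z0" c] cmap_cinv[of "snd z0" c] by auto
    obtain W h where W: "open W" "cmap c (cinv c (snd z0)) \<in> W" "W \<subseteq> cim c" and h: "\<And>i. h i \<in> smooth_funs M"
      and dual: "\<And>q v. q \<in> cdom c \<Longrightarrow> cmap c q \<in> W \<Longrightarrow> v \<in> tangent_space M q \<Longrightarrow>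
        v = coord_vector M c q (\<Sum>i\<in>Basis. v (h i) *\<^sub>R i)"
      by (rule dual_functions[OF c p(1)]) (rule that, assumption+)
    let ?T = "U \<times> W"
    have T: "open ?T" "z0 \<in> ?T" using U W p z0 by (auto simp: open_Times mem_Times_iff)
    have "smooth_on ?T (\<lambda>z. \<Sum>i\<in>Basis. act_on_fun Y (h i) (cinv c (snd z)) * frechet_derivative ?F (at z) (0, i))"
    proof (intro smooth_on_sum smooth_on_mult T(1) finite_Basis)
      fix i :: 'e
      show "smooth_on ?T (\<lambda>z. act_on_fun Y (h i) (cinv c (snd z)))"
        by (rule smooth_on_compose[OF T(1) smooth_on_linear[OF T(1) bounded_linear_snd]
              smooth_funsD(2)[OF vector_fieldD(3)[OF Y h] c]]) (use W(3) in auto)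
      show "smooth_on ?T (\<lambda>z. frechet_derivative ?F (at z) (0, i))"
        by (rule smooth_on_subset[OF smooth_on_frechet_derivative[OF psmoothD[OF R c]]]) (use W(3) in auto)
    qed
    then have "smooth_on ?T (\<lambda>z. Y (cinv c (snd z)) (zero_off M (R (fst z))))"
    proof (rule smooth_on_cong[OF T(1)])
      fix z assume z: "z \<in> ?T"
      then have yim: "snd z \<in> cim c" and x: "fst z \<in> U" and yW: "snd z \<in> W" using W(3) by auto
      let ?q = "cinv c (snd z)"
      have q: "?q \<in> cdom c" "cmap c ?q = snd z" using cinv_in[OF yim] cmap_cinv[OF yim] by auto
      have "Y ?q (zero_off M (R (fst z)))
        = (\<Sum>i\<in>Basis. Y ?q (h i) * frechet_derivative ?F (at (fst z, cmap c ?q)) (0, i))"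
        by (rule field_on_family[OF U x R c q(1) dual[OF q(1) _ vector_fieldD(1)[OF Y cdom_subset[OF c q(1)]]]])
          (simp add: q(2) yW)
      then show "(\<Sum>i\<in>Basis. act_on_fun Y (h i) ?q * frechet_derivative ?F (at z) (0, i))
        = Y ?q (zero_off M (R (fst z)))"
        by (simp add: act_on_fun_def q(2))
    qed
    then show "\<exists>T. open T \<and> z0 \<in> T \<and> smooth_on T (\<lambda>z. Y (cinv c (snd z)) (zero_off M (R (fst z))))"
      using T by blast
  qed
qed

text \<open>The coefficients of \<open>v\<close> do not depend on the parameter, so everything
  reduces to \<open>mixed_partials\<close> for a parameter direction \<open>(w, 0)\<close> and a
  space direction \<open>(0, i)\<close>.\<close>

lemma tangent_deriv_commute:
  assumes U: "open U" "x \<in> U" and R: "psmooth U M R" and q: "q \<in> points M" and v: "v \<in> tangent_space M q"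
  shows "v (zero_off M (\<lambda>q. frechet_derivative (\<lambda>x. R x q) (at x) w))
    = frechet_derivative (\<lambda>x. v (zero_off M (R x))) (at x) w"
    and "smooth_on U (\<lambda>x. v (zero_off M (R x)))"
proof -
  obtain c where c: "c \<in> matlas M" and qc: "q \<in> cdom c" using chart_at[OF q] .
  obtain W h where "cmap c q \<in> W"
    and dual: "\<And>p v. p \<in> cdom c \<Longrightarrow> cmap c p \<in> W \<Longrightarrow> v \<in> tangent_space M p \<Longrightarrow>
      v = coord_vector M c p (\<Sum>i\<in>Basis. v (h i) *\<^sub>R i)"
    by (rule dual_functions[OF c qc]) (rule that, assumption+)
  note vv = dual[OF qc this(1) v]
  let ?F = "\<lambda>z. R (fst z) (cinv c (snd z))"
  let ?y = "cmap c q"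
  let ?S = "U \<times> cim c"
  have y: "?y \<in> cim c" using qc by blast
  have S: "open ?S" "(x, ?y) \<in> ?S" using open_times_cim[OF U(1) c] U y by auto
  note F = psmoothD[OF R c]
  have formula: "v (zero_off M (R x)) = (\<Sum>i\<in>Basis. v (h i) * frechet_derivative ?F (at (x, ?y)) (0, i))"
    if "x \<in> U" for x
    by (rule field_on_family[OF U(1) that R c qc vv])
  have sm: "smooth_on U (\<lambda>x. frechet_derivative ?F (at (x, ?y)) (0, i))" for i
    using smooth_on_compose[OF U(1) smooth_on_Pair[OF U(1) smooth_on_id[OF U(1)] smooth_on_const[OF U(1)]]
        smooth_on_frechet_derivative[OF F], of ?y "(0, i)"] y by auto
  then have sm': "smooth_on U (\<lambda>x. \<Sum>i\<in>Basis. v (h i) * frechet_derivative ?F (at (x, ?y)) (0, i))"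
    by (intro smooth_on_sum smooth_on_mult smooth_on_const U(1) finite_Basis)
  show "smooth_on U (\<lambda>x. v (zero_off M (R x)))"
    by (rule smooth_on_cong[OF U(1) sm']) (simp add: formula)
  have part: "frechet_derivative (\<lambda>x. frechet_derivative ?F (at (x, ?y)) (0, i)) (at x) w
      = frechet_derivative (\<lambda>z. frechet_derivative ?F (at z) (0, i)) (at (x, ?y)) (w, 0)" for i
  proof -
    have "(\<lambda>z. frechet_derivative ?F (at z) (0, i)) differentiable (at (x, ?y))"
      using smooth_on_has_derivative[OF smooth_on_frechet_derivative[OF F] S(2)] by (auto simp: differentiable_def)
    from frechet_derivative_partial(1)[OF this] show ?thesis by simp
  qed
  have "frechet_derivative (\<lambda>x. v (zero_off M (R x))) (at x)
      = frechet_derivative (\<lambda>x. \<Sum>i\<in>Basis. v (h i) * frechet_derivative ?F (at (x, ?y)) (0, i)) (at x)"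
    by (rule frechet_derivative_cong_open[OF U]) (simp add: formula)
  also have "\<dots> = (\<lambda>w. \<Sum>i\<in>Basis. v (h i) * frechet_derivative (\<lambda>x. frechet_derivative ?F (at (x, ?y)) (0, i)) (at x) w)"
    by (intro frechet_derivative_eqI has_derivative_sum has_derivative_mult_right
        smooth_on_has_derivative[OF sm U(2)])
  finally have rhs: "frechet_derivative (\<lambda>x. v (zero_off M (R x))) (at x) w
      = (\<Sum>i\<in>Basis. v (h i) * frechet_derivative (\<lambda>z. frechet_derivative ?F (at z) (0, i)) (at (x, ?y)) (w, 0))"
    by (simp add: part)
  let ?R' = "\<lambda>x q. frechet_derivative (\<lambda>x. R x q) (at x) w"
  have "v (zero_off M (?R' x))
      = (\<Sum>i\<in>Basis. v (h i) * frechet_derivative (\<lambda>z. ?R' (fst z) (cinv c (snd z))) (at (x, ?y)) (0, i))"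
    by (rule field_on_family[OF U psmooth_deriv[OF U(1) R] c qc vv])
  also have "frechet_derivative (\<lambda>z. ?R' (fst z) (cinv c (snd z))) (at (x, ?y))
      = frechet_derivative (\<lambda>z. frechet_derivative ?F (at z) (w, 0)) (at (x, ?y))"
    by (rule frechet_derivative_cong_open[OF S]) (auto simp: psmooth_partials(1)[OF U(1) _ R c])
  finally show "v (zero_off M (?R' x)) = frechet_derivative (\<lambda>x. v (zero_off M (R x))) (at x) w"
    unfolding rhs by (simp only: mixed_partials[OF S F, of "(w, 0)"])
qed

text \<open>Continuity of \<open>F\<close> is replaced by a bump function:
  \<open>\<rho> \<circ> F\<close> is continuous by hypothesis, and where it is nonzero
  \<open>F\<close> stays in the region on which the global functions \<open>h i\<close> are the
  coordinates.\<close>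

lemma smooth_into_chart_local:
  assumes U: "open U" "x \<in> U" and F: "smooth_into U M F" and c: "c \<in> matlas M" and qc: "F x \<in> cdom c"
  obtains T where "open T" "x \<in> T" "T \<subseteq> U" "smooth_on T (\<lambda>t. cmap c (F t))" "\<And>t. t \<in> T \<Longrightarrow> F t \<in> cdom c"
proof -
  obtain W h where W: "open W" "cmap c (F x) \<in> W" and h: "\<And>i. h i \<in> smooth_funs M"
    and co: "\<And>q i. q \<in> cdom c \<Longrightarrow> cmap c q \<in> W \<Longrightarrow> h i q = cmap c q \<bullet> i"
    by (rule dual_functions[OF c qc]) (rule that, assumption+)
  let ?V = "{q \<in> cdom c. cmap c q \<in> W}"
  obtain \<rho> where \<rho>: "\<rho> \<in> smooth_funs M" "\<rho> (F x) = 1" "\<And>q. \<rho> q \<noteq> 0 \<Longrightarrow> q \<in> ?V"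
    using bump[OF openin_cmap_preimage[OF c W(1)], of "F x"] qc W(2) by blast
  define T where "T = U \<inter> (\<lambda>x. \<rho> (F x)) -` (- {0})"
  have "continuous_on U (\<lambda>x. \<rho> (F x))"
    using F \<rho>(1) smooth_on_continuous_on by (auto simp: smooth_into_def)
  then have T: "open T" unfolding T_def by (intro continuous_open_preimage U) auto
  have xT: "x \<in> T" using U \<rho>(2) by (simp add: T_def)
  have TV: "F t \<in> cdom c" "cmap c (F t) \<in> W" if "t \<in> T" for t using \<rho>(3) that by (auto simp: T_def)
  have "smooth_on T (\<lambda>t. \<Sum>i\<in>Basis. h i (F t) *\<^sub>R i)"
  proof (intro smooth_on_sum smooth_on_scaleR smooth_on_const T finite_Basis)
    show "smooth_on T (\<lambda>x. h i (F x))" for i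
      using F h by (intro smooth_on_subset[of U _ T]) (auto simp: smooth_into_def T_def)
  qed
  then have sm: "smooth_on T (\<lambda>t. cmap c (F t))"
    by (rule smooth_on_cong[OF T]) (simp add: co[OF TV] euclidean_representation)
  have TU: "T \<subseteq> U" by (auto simp: T_def)
  show thesis by (rule that[OF T xT TU sm TV(1)])
qed

lemma smooth_into_local:
  assumes U: "open U" "x \<in> U" and F: "smooth_into U M F"
  obtains T c k where "open T" "x \<in> T" "T \<subseteq> U" "c \<in> matlas M" "smooth_on T k" "k ` T \<subseteq> cim c"
    "\<And>t. t \<in> T \<Longrightarrow> F t = cinv c (k t)"
proof -
  have "F x \<in> points M" using F U by (auto simp: smooth_into_def)
  then obtain c where c: "c \<in> matlas M" and qc: "F x \<in> cdom c" by (rule chart_at)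
  obtain T where T: "open T" "x \<in> T" "T \<subseteq> U" "smooth_on T (\<lambda>t. cmap c (F t))"
    and Tc: "\<And>t. t \<in> T \<Longrightarrow> F t \<in> cdom c"
    by (rule smooth_into_chart_local[OF U F c qc]) (rule that, assumption+)
  show thesis
    by (rule that[OF T(1-3) c T(4)]) (simp_all add: image_subset_iff Tc cinv_cmap[OF c])
qed

lemma psmooth_diagonal:
  assumes U: "open U" and Q: "psmooth U M Q" and F: "smooth_into U M F"
  shows "smooth_on U (\<lambda>x. Q x (F x))"
proof (rule smooth_on_local)
  fix x assume x: "x \<in> U"
  obtain T c k where T: "open T" "x \<in> T" "T \<subseteq> U" and c: "c \<in> matlas M" and k: "smooth_on T k" "k ` T \<subseteq> cim c"
    and Fk: "\<And>t. t \<in> T \<Longrightarrow> F t = cinv c (k t)"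
    by (rule smooth_into_local[OF U x F]) (rule that, assumption+)
  have "smooth_on T (\<lambda>t. (\<lambda>z. Q (fst z) (cinv c (snd z))) (t, k t))"
    by (rule smooth_on_compose[OF T(1) smooth_on_Pair[OF T(1) smooth_on_id[OF T(1)] k(1)] psmoothD[OF Q c]])
      (use T k in auto)
  then have "smooth_on T (\<lambda>x. Q x (F x))"
    by (rule smooth_on_cong[OF T(1)]) (simp add: Fk)
  then show "\<exists>T. open T \<and> x \<in> T \<and> smooth_on T (\<lambda>x. Q x (F x))" using T by blast
qed

end

lemma jsmooth_swap:
  assumes N: "smooth_mfd N" and M: "smooth_mfd M" and H: "jsmooth N M H"
  shows "jsmooth M N (\<lambda>p a. H a p)"
  unfolding jsmooth_def psmooth_def
proof (intro ballI)
  fix d c assume d: "d \<in> matlas M" and c: "c \<in> matlas N"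
  have op: "open (cim d \<times> cim c)"
    using smooth_mfd.open_cim[OF M d] smooth_mfd.open_cim[OF N c] by (simp add: open_Times)
  have swap: "smooth_on (cim d \<times> cim c) (\<lambda>z. (snd z, fst z))"
    by (rule smooth_on_Pair[OF op smooth_on_linear[OF op bounded_linear_snd] smooth_on_linear[OF op bounded_linear_fst]])
  have "smooth_on (cim c \<times> cim d) (\<lambda>z. H (cinv c (fst z)) (cinv d (snd z)))"
    using H c d by (auto simp: jsmooth_def psmooth_def)
  moreover have "(\<lambda>z. (snd z, fst z)) ` (cim d \<times> cim c) \<subseteq> cim c \<times> cim d" by auto
  ultimately
  show "smooth_on (cim d \<times> cim c) (\<lambda>z. H (cinv c (snd z)) (cinv d (fst z)))"
    using smooth_on_compose[OF op swap] by fastforce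
qed

lemma psmooth_smooth_into:
  assumes N: "smooth_mfd N" and M: "smooth_mfd M" and H: "jsmooth N M H"
    and U: "open U" and F: "smooth_into U N F"
  shows "psmooth U M (\<lambda>x. H (F x))"
  unfolding psmooth_def
proof
  fix d assume d: "d \<in> matlas M"
  show "smooth_on (U \<times> cim d) (\<lambda>z. H (F (fst z)) (cinv d (snd z)))"
  proof (rule smooth_on_local)
    fix z0 assume z0: "z0 \<in> U \<times> cim d"
    then have x: "fst z0 \<in> U" by auto
    obtain T c k where T: "open T" "fst z0 \<in> T" "T \<subseteq> U" and c: "c \<in> matlas N" and k: "smooth_on T k" "k ` T \<subseteq> cim c"
      and Fk: "\<And>t. t \<in> T \<Longrightarrow> F t = cinv c (k t)"
      by (rule smooth_mfd.smooth_into_local[OF N U x F]) (rule that, assumption+)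
    have "psmooth (cim c) M (\<lambda>x. H (cinv c x))" using H c by (simp add: jsmooth_def)
    then have "psmooth T M (\<lambda>t. H (cinv c (k t)))"
      by (rule psmooth_reparam[OF T(1) k]) (rule smooth_mfd.smooth_manifold[OF M])
    then have "psmooth T M (\<lambda>t. H (F t))"
      by (rule smooth_mfd.psmooth_cong[OF M T(1)]) (simp add: Fk)
    then have "smooth_on (T \<times> cim d) (\<lambda>z. H (F (fst z)) (cinv d (snd z)))" using d by (simp add: psmooth_def)
    moreover have "open (T \<times> cim d)" using smooth_mfd.open_cim[OF M d] T(1) by (simp add: open_Times)
    moreover have "z0 \<in> T \<times> cim d" using z0 T by (auto simp: mem_Times_iff)
    ultimately show "\<exists>T. open T \<and> z0 \<in> T \<and> smooth_on T (\<lambda>z. H (F (fst z)) (cinv d (snd z)))" by blast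
  qed
qed

lemma jsmooth_smooth_into:
  assumes N: "smooth_mfd N" and M: "smooth_mfd M" and H: "jsmooth N M H" and p: "p \<in> points M"
  shows "zero_off N (\<lambda>a. H a p) \<in> smooth_funs N"
proof (rule smooth_mfd.smooth_funsI[OF N])
  fix c assume c: "c \<in> matlas N"
  have "smooth_on (cim c) (\<lambda>x. H (cinv c x) p)"
    using smooth_mfd.psmooth_at[OF M smooth_mfd.open_cim[OF N c] _ p] H c by (auto simp: jsmooth_def)
  then show "smooth_on (cim c) (\<lambda>x. zero_off N (\<lambda>a. H a p) (cinv c x))"
    by (rule smooth_on_cong[OF smooth_mfd.open_cim[OF N c]])
      (simp add: zero_off_def smooth_mfd.cdom_subset[OF N c smooth_mfd.cinv_in[OF N]])
qed (simp add: zero_off_def)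

section \<open>Families arising from smooth maps\<close>

lemma smooth_map_smooth_funs:
  assumes N: "smooth_mfd N" and L: "smooth_mfd L" and \<Psi>: "smooth_map N L \<Psi>" and h: "h \<in> smooth_funs L"
  shows "zero_off N (\<lambda>a. h (\<Psi> a)) \<in> smooth_funs N"
proof (rule smooth_mfd.smooth_funsI[OF N])
  fix c assume c: "c \<in> matlas N"
  have cont: "continuous_map (mtop N) (mtop L) \<Psi>" using \<Psi> by (simp add: smooth_map_def)
  show "smooth_on (cim c) (\<lambda>x. zero_off N (\<lambda>a. h (\<Psi> a)) (cinv c x))"
  proof (rule smooth_on_local)
    fix x assume x: "x \<in> cim c"
    have a: "cinv c x \<in> cdom c" "cmap c (cinv c x) = x"
      using smooth_mfd.cinv_in[OF N x] smooth_mfd.cmap_cinv[OF N x] by auto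
    have "\<Psi> (cinv c x) \<in> points L"
      using cont smooth_mfd.cdom_subset[OF N c a(1)] by (auto simp: continuous_map_def)
    then obtain e where e: "e \<in> matlas L" "\<Psi> (cinv c x) \<in> cdom e" using smooth_mfd.chart_at[OF L] by blast
    let ?V = "{a \<in> points N. \<Psi> a \<in> cdom e}"
    have V: "openin (mtop N) ?V"
      using openin_continuous_map_preimage[OF cont smooth_mfd.openin_cdom[OF L e(1)]] .
    have eqV: "cdom c \<inter> ?V = {p \<in> cdom c. \<Psi> p \<in> cdom e}" using smooth_mfd.cdom_subset[OF N c] by auto
    let ?T = "cmap c ` {p \<in> cdom c. \<Psi> p \<in> cdom e}"
    have T: "open ?T" using smooth_mfd.open_cmap_image[OF N c V] eqV by simp
    have xT: "x \<in> ?T" using a e(2) by (intro image_eqI[of _ _ "cinv c x"]) auto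
    have "smooth_on ?T (\<lambda>x. cmap e (\<Psi> (cinv c x)))" using \<Psi> c e(1) by (simp add: smooth_map_def comp_def)
    then have "smooth_on ?T (\<lambda>x. h (cinv e (cmap e (\<Psi> (cinv c x)))))"
      by (rule smooth_on_compose[OF T _ smooth_mfd.smooth_funsD(2)[OF L h e(1)]])
        (auto simp: smooth_mfd.cinv_cmap[OF N c])
    then have "smooth_on ?T (\<lambda>x. zero_off N (\<lambda>a. h (\<Psi> a)) (cinv c x))"
      by (rule smooth_on_cong[OF T])
        (auto simp: smooth_mfd.cinv_cmap[OF N c] smooth_mfd.cinv_cmap[OF L e(1)] zero_off_def
          smooth_mfd.cdom_subset[OF N c])
    then show "\<exists>T. open T \<and> x \<in> T \<and> smooth_on T (\<lambda>x. zero_off N (\<lambda>a. h (\<Psi> a)) (cinv c x))" using T xT by blast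
  qed
qed (simp add: zero_off_def)

lemma smooth_map_jsmooth:
  assumes N: "smooth_mfd N" and M: "smooth_mfd M" and L: "smooth_mfd L"
    and \<Psi>: "smooth_map (prod_manifold N M) L \<Psi>" and h: "h \<in> smooth_funs L"
  shows "jsmooth N M (\<lambda>a p. h (\<Psi> (a, p)))"
  unfolding jsmooth_def psmooth_def
proof (intro ballI)
  fix c d assume c: "c \<in> matlas N" and d: "d \<in> matlas M"
  define C where "C = (cdom c \<times> cdom d, map_prod (cmap c) (cmap d))"
  have C: "C \<in> matlas (prod_manifold N M)"
    using c d by (force simp: prod_manifold_def C_def)
  have inj: "inj_on (cmap C) (cdom C)"
    using smooth_mfd.inj_on_cmap[OF N c] smooth_mfd.inj_on_cmap[OF M d] by (auto simp: C_def inj_on_def)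
  have cinvC: "cinv C (cmap c a, cmap d p) = (a, p)" if "a \<in> cdom c" "p \<in> cdom d" for a p
    using inv_into_f_f[OF inj, of "(a, p)"] that by (simp add: cinv_def C_def)
  have cont: "continuous_map (prod_topology (mtop N) (mtop M)) (mtop L) \<Psi>"
    using \<Psi> by (simp add: smooth_map_def prod_manifold_def)
  show "smooth_on (cim c \<times> cim d) (\<lambda>z. h (\<Psi> (cinv c (fst z), cinv d (snd z))))"
  proof (rule smooth_on_local)
    fix z0 assume "z0 \<in> cim c \<times> cim d"
    then obtain a p where a: "a \<in> cdom c" and p: "p \<in> cdom d" and z0: "z0 = (cmap c a, cmap d p)" by auto
    have aN: "a \<in> points N" and pM: "p \<in> points M"
      using smooth_mfd.cdom_subset[OF N c a] smooth_mfd.cdom_subset[OF M d p] by auto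
    have "\<Psi> (a, p) \<in> points L" using cont aN pM by (auto simp: continuous_map_def)
    then obtain e where e: "e \<in> matlas L" "\<Psi> (a, p) \<in> cdom e" using smooth_mfd.chart_at[OF L] by blast
    have "openin (prod_topology (mtop N) (mtop M))
        {P \<in> topspace (prod_topology (mtop N) (mtop M)). \<Psi> P \<in> cdom e}"
      using openin_continuous_map_preimage[OF cont smooth_mfd.openin_cdom[OF L e(1)]] .
    moreover have "(a, p) \<in> {P \<in> topspace (prod_topology (mtop N) (mtop M)). \<Psi> P \<in> cdom e}"
      using aN pM e(2) by simp
    ultimately obtain A B where A: "openin (mtop N) A" "a \<in> A" and B: "openin (mtop M) B" "p \<in> B"
      and AB: "A \<times> B \<subseteq> {P \<in> topspace (prod_topology (mtop N) (mtop M)). \<Psi> P \<in> cdom e}"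
      unfolding openin_prod_topology_alt by blast
    \<comment> \<open>A product of open sets on which \<Psi> stays in the chart \<open>e\<close>;
      smoothness of \<Psi> in coordinates is available on such a set.\<close>
    let ?T = "cmap c ` (cdom c \<inter> A) \<times> cmap d ` (cdom d \<inter> B)"
    have T: "open ?T"
      using smooth_mfd.open_cmap_image[OF N c A(1)] smooth_mfd.open_cmap_image[OF M d B(1)] by (simp add: open_Times)
    have zT: "z0 \<in> ?T" using a p A(2) B(2) z0 by simp
    have "smooth_on (cmap C ` {P \<in> cdom C. \<Psi> P \<in> cdom e}) (\<lambda>z. cmap e (\<Psi> (cinv C z)))"
      using \<Psi> C e(1) by (simp add: smooth_map_def comp_def)
    moreover have "?T \<subseteq> cmap C ` {P \<in> cdom C. \<Psi> P \<in> cdom e}"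
    proof
      fix z assume "z \<in> ?T"
      then obtain a' p' where "a' \<in> cdom c" "a' \<in> A" "p' \<in> cdom d" "p' \<in> B" "z = (cmap c a', cmap d p')" by auto
      then show "z \<in> cmap C ` {P \<in> cdom C. \<Psi> P \<in> cdom e}"
        using AB by (intro image_eqI[of _ _ "(a', p')"]) (auto simp: C_def)
    qed
    ultimately have "smooth_on ?T (\<lambda>z. cmap e (\<Psi> (cinv C z)))" by (rule smooth_on_subset)
    then have "smooth_on ?T (\<lambda>z. h (cinv e (cmap e (\<Psi> (cinv C z)))))"
      by (rule smooth_on_compose[OF T _ smooth_mfd.smooth_funsD(2)[OF L h e(1)]])
        (use AB cinvC in auto)
    then have "smooth_on ?T (\<lambda>z. h (\<Psi> (cinv c (fst z), cinv d (snd z))))"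
    proof (rule smooth_on_cong[OF T])
      fix z assume "z \<in> ?T"
      then obtain a' p' where z: "a' \<in> cdom c" "a' \<in> A" "p' \<in> cdom d" "p' \<in> B" "z = (cmap c a', cmap d p')" by auto
      then have "\<Psi> (a', p') \<in> cdom e" using AB by blast
      then show "h (cinv e (cmap e (\<Psi> (cinv C z)))) = h (\<Psi> (cinv c (fst z), cinv d (snd z)))"
        using z by (simp add: cinvC smooth_mfd.cinv_cmap[OF N c] smooth_mfd.cinv_cmap[OF M d]
            smooth_mfd.cinv_cmap[OF L e(1)])
    qed
    then show "\<exists>T. open T \<and> z0 \<in> T \<and> smooth_on T (\<lambda>z. h (\<Psi> (cinv c (fst z), cinv d (snd z))))"
      using T zT by blast
  qed
qed

section \<open>Lie derivatives along smooth families of diffeomorphisms\<close>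

lemma linear_on_subspace_sum:
  assumes f: "linear_on_subspace V f" and V: "0 \<in> V" "\<And>u v. u \<in> V \<Longrightarrow> v \<in> V \<Longrightarrow> u + v \<in> V"
    "\<And>a v. v \<in> V \<Longrightarrow> a *\<^sub>R v \<in> V"
    and e: "finite I" "\<And>i. i \<in> I \<Longrightarrow> e i \<in> V"
  shows "f (\<Sum>i\<in>I. a i *\<^sub>R e i) = (\<Sum>i\<in>I. a i *\<^sub>R f (e i))"
proof -
  have f0: "f 0 = 0"
  proof -
    have "f (0 *\<^sub>R 0) = 0 *\<^sub>R f 0" using f V(1) unfolding linear_on_subspace_def by blast
    then show ?thesis by simp
  qed
  have "(\<Sum>i\<in>I. a i *\<^sub>R e i) \<in> V \<and> f (\<Sum>i\<in>I. a i *\<^sub>R e i) = (\<Sum>i\<in>I. a i *\<^sub>R f (e i))"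
    using e
  proof (induction I rule: finite_induct)
    case empty
    then show ?case using V(1) f0 by simp
  next
    case (insert j I)
    then have IH: "(\<Sum>i\<in>I. a i *\<^sub>R e i) \<in> V" "f (\<Sum>i\<in>I. a i *\<^sub>R e i) = (\<Sum>i\<in>I. a i *\<^sub>R f (e i))"
      and ej: "e j \<in> V" by auto
    have "f (a j *\<^sub>R e j + (\<Sum>i\<in>I. a i *\<^sub>R e i)) = a j *\<^sub>R f (e j) + f (\<Sum>i\<in>I. a i *\<^sub>R e i)"
      using f V(3)[OF ej] IH(1) ej unfolding linear_on_subspace_def by metis
    then show ?case using insert.hyps IH V(2)[OF V(3)[OF ej] IH(1)] by simp
  qed
  then show ?thesis by blast
qed

context smooth_mfd
begin

lemma differential_apply: "h \<in> smooth_funs M \<Longrightarrow> differential L M F v h = v (zero_off L (\<lambda>q. h (F q)))"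
  by (simp add: differential_def comp_def)

lemma differential_tangent:
  assumes F: "\<And>h. h \<in> smooth_funs M \<Longrightarrow> zero_off M (\<lambda>q. h (F q)) \<in> smooth_funs M"
    and p: "p \<in> points M" and v: "v \<in> tangent_space M p"
  shows "differential M M F v \<in> tangent_space M (F p)"
proof (rule tangentI)
  fix f h assume f: "f \<in> smooth_funs M" and h: "h \<in> smooth_funs M"
  let ?z = "\<lambda>f. zero_off M (\<lambda>q. f (F q))"
  have "?z (f + h) = ?z f + ?z h" by (rule ext) (simp add: zero_off_def)
  then show "differential M M F v (f + h) = differential M M F v f + differential M M F v h"
    by (simp only: differential_apply smooth_funs_add f h tangentD(1)[OF v F[OF f] F[OF h]])
  have "?z (f * h) = ?z f * ?z h" by (rule ext) (simp add: zero_off_def)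
  moreover have "?z f p = f (F p)" "?z h p = h (F p)" using p by (simp_all add: zero_off_def)
  ultimately show "differential M M F v (f * h) = f (F p) * differential M M F v h + h (F p) * differential M M F v f"
    by (simp only: differential_apply smooth_funs_mult f h tangentD(3)[OF v F[OF f] F[OF h]])
next
  fix a f assume f: "f \<in> smooth_funs M"
  have "zero_off M (\<lambda>q. (a *\<^sub>R f) (F q)) = a *\<^sub>R zero_off M (\<lambda>q. f (F q))"
    by (rule ext) (simp add: zero_off_def scaleR_fun_def)
  then show "differential M M F v (a *\<^sub>R f) = a * differential M M F v f"
    by (simp only: differential_apply smooth_funs_scaleR f tangentD(2)[OF v F[OF f]])
qed (simp add: differential_def)

end

text \<open>A substitute for flows: the parameter runs through an open set of any Euclidean space,
  and the derivative at the base point in direction \<open>w\<close> plays the role of the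
  generator. It is instantiated below by the action on \<open>M\<close> and by right translations of
  the group.\<close>

locale smooth_family = smooth_mfd M for M :: "('m, 'e::euclidean_space) manifold" +
  fixes U :: "'b::euclidean_space set" and x0 :: 'b and \<Phi> \<Psi> :: "'b \<Rightarrow> 'm \<Rightarrow> 'm"
  assumes U: "open U" "x0 \<in> U"
    and \<Phi>_in: "\<And>x q. x \<in> U \<Longrightarrow> q \<in> points M \<Longrightarrow> \<Phi> x q \<in> points M"
    and \<Psi>_\<Phi>: "\<And>x q. x \<in> U \<Longrightarrow> q \<in> points M \<Longrightarrow> \<Psi> x (\<Phi> x q) = q"
    and \<Phi>_0: "\<And>q. q \<in> points M \<Longrightarrow> \<Phi> x0 q = q"
    and psmooth_\<Phi>: "\<And>h. h \<in> smooth_funs M \<Longrightarrow> psmooth U M (\<lambda>x q. h (\<Phi> x q))"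
    and psmooth_\<Psi>: "\<And>h. h \<in> smooth_funs M \<Longrightarrow> psmooth U M (\<lambda>x q. h (\<Psi> x q))"
begin

definition fund :: "'b \<Rightarrow> 'm vfield" where
  "fund w = (\<lambda>q f. if q \<in> points M \<and> f \<in> smooth_funs M
     then frechet_derivative (\<lambda>x. f (\<Phi> x q)) (at x0) w else 0)"

text \<open>The pullback of \<open>Y\<close> under \<open>\<Phi> x\<close>. For fixed
  \<open>p\<close> its values lie in one tangent space, so they can be differentiated in
  \<open>x\<close>.\<close>

definition pull :: "'b \<Rightarrow> 'm vfield \<Rightarrow> 'm vfield" where
  "pull x Y p = differential M M (\<Psi> x) (Y (\<Phi> x p))"

lemma \<Psi>_0: "q \<in> points M \<Longrightarrow> \<Psi> x0 q = q"
  using \<Psi>_\<Phi>[OF U(2), of q] \<Phi>_0 by simp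

lemma fund_has_derivative:
  assumes "q \<in> points M" "f \<in> smooth_funs M"
  shows "((\<lambda>x. f (\<Phi> x q)) has_derivative (\<lambda>w. fund w q f)) (at x0)"
  using smooth_on_has_derivative[OF psmooth_at[OF U(1) psmooth_\<Phi>[OF assms(2)] assms(1)] U(2)] assms
  by (simp add: fund_def)

lemma fund_eqI:
  assumes "q \<in> points M" "f \<in> smooth_funs M" "((\<lambda>x. f (\<Phi> x q)) has_derivative D) (at x0)"
  shows "fund w q f = D w"
  using has_derivative_unique[OF fund_has_derivative[OF assms(1,2)] assms(3)] by metis

lemma fund_add: "fund (w + w') = fund w + fund w'"
proof (intro ext)
  fix q f
  show "fund (w + w') q f = (fund w + fund w') q f"
  proof (cases "q \<in> points M \<and> f \<in> smooth_funs M")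
    case True
    then show ?thesis using linear_add[OF has_derivative_linear[OF fund_has_derivative]] by simp
  qed (auto simp: fund_def)
qed

lemma fund_scaleR: "fund (a *\<^sub>R w) = a *\<^sub>R fund w"
proof (intro ext)
  fix q f
  show "fund (a *\<^sub>R w) q f = (a *\<^sub>R fund w) q f"
  proof (cases "q \<in> points M \<and> f \<in> smooth_funs M")
    case True
    then show ?thesis
      using linear_scale[OF has_derivative_linear[OF fund_has_derivative]] by (simp add: scaleR_fun_def)
  qed (auto simp add: fund_def scaleR_fun_def)
qed

lemma fund_vector_field: "fund w \<in> vector_fields M"
  unfolding vector_fields_def
proof (intro CollectI conjI ballI allI impI)
  fix p assume p: "p \<in> points M"
  show "fund w p \<in> tangent_space M p"
  proof (rule tangentI)
    fix f h assume f: "f \<in> smooth_funs M" and h: "h \<in> smooth_funs M"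
    note df = fund_has_derivative[OF p f] and dh = fund_has_derivative[OF p h]
    show "fund w p (f + h) = fund w p f + fund w p h"
      using fund_eqI[OF p smooth_funs_add[OF f h]] has_derivative_add[OF df dh] by simp
    show "fund w p (f * h) = f p * fund w p h + h p * fund w p f"
      using fund_eqI[OF p smooth_funs_mult[OF f h]] has_derivative_mult[OF df dh] \<Phi>_0[OF p]
      by (simp add: mult.commute)
  next
    fix a f assume f: "f \<in> smooth_funs M"
    have "((\<lambda>x. (a *\<^sub>R f) (\<Phi> x p)) has_derivative (\<lambda>w. a *\<^sub>R fund w p f)) (at x0)"
      using has_derivative_scaleR_right[OF fund_has_derivative[OF p f]] by (simp add: scaleR_fun_def)
    from fund_eqI[OF p smooth_funs_scaleR[OF f] this]
    show "fund w p (a *\<^sub>R f) = a * fund w p f" by simp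
  qed (simp add: fund_def)
next
  show "fund w p = 0" if "p \<notin> points M" for p using that by (auto simp: fund_def)
next
  fix f assume f: "f \<in> smooth_funs M"
  have "act_on_fun (fund w) f = zero_off M (\<lambda>q. frechet_derivative (\<lambda>x. f (\<Phi> x q)) (at x0) w)"
    by (auto simp: act_on_fun_def fund_def zero_off_def f)
  then show "act_on_fun (fund w) f \<in> smooth_funs M"
    using psmooth_section[OF U psmooth_deriv[OF U(1) psmooth_\<Phi>[OF f]]] by simp
qed

lemma smooth_into_\<Phi>: "q \<in> points M \<Longrightarrow> smooth_into U M (\<lambda>x. \<Phi> x q)"
  using \<Phi>_in psmooth_at[OF U(1) psmooth_\<Phi>] by (simp add: smooth_into_def)

lemma smooth_two_parameters:
  assumes Q: "psmooth U M Q" and q: "q \<in> points M"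
  shows "smooth_on (U \<times> U) (\<lambda>z. Q (fst z) (\<Phi> (snd z) q))"
proof -
  have op: "open (U \<times> U)" using U(1) by (simp add: open_Times)
  have sub: "fst ` (U \<times> U) \<subseteq> U" "snd ` (U \<times> U) \<subseteq> U" by auto
  show ?thesis
    by (rule psmooth_diagonal[OF op
          psmooth_reparam[OF op smooth_on_linear[OF op bounded_linear_fst] sub(1) Q smooth_manifold]
          smooth_into_reparam[OF op smooth_on_linear[OF op bounded_linear_snd] sub(2) smooth_into_\<Phi>[OF q]]])
qed

lemma two_parameter_derivative:
  assumes Q: "psmooth U M Q" and q: "q \<in> points M"
  shows "frechet_derivative (\<lambda>x. Q x (\<Phi> x q)) (at x0) w
    = frechet_derivative (\<lambda>x. Q x q) (at x0) w + frechet_derivative (\<lambda>x. Q x0 (\<Phi> x q)) (at x0) w"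
proof -
  have "(\<lambda>z. Q (fst z) (\<Phi> (snd z) q)) differentiable (at (x0, x0))"
    using smooth_on_has_derivative[OF smooth_two_parameters[OF Q q], of "(x0, x0)"] U(2)
    by (auto simp: differentiable_def)
  from frechet_derivative_diagonal[OF this] show ?thesis by (simp add: \<Phi>_0[OF q])
qed

text \<open>Differentiating \<open>\<Psi> x (\<Phi> x q) = q\<close> in both occurrences of
  \<open>x\<close>: the contributions cancel.\<close>

lemma inverse_family_derivative:
  assumes h: "h \<in> smooth_funs M" and q: "q \<in> points M"
  shows "frechet_derivative (\<lambda>x. h (\<Psi> x q)) (at x0) w = - fund w q h"
proof -
  have "frechet_derivative (\<lambda>x. h (\<Psi> x (\<Phi> x q))) (at x0) = frechet_derivative (\<lambda>x. h q) (at x0)"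
    by (rule frechet_derivative_cong_open[OF U]) (simp add: \<Psi>_\<Phi> q)
  then have "frechet_derivative (\<lambda>x. h (\<Psi> x (\<Phi> x q))) (at x0) w = 0" by simp
  moreover have "frechet_derivative (\<lambda>x. h (\<Psi> x0 (\<Phi> x q))) (at x0)
      = frechet_derivative (\<lambda>x. h (\<Phi> x q)) (at x0)"
    by (rule frechet_derivative_cong_open[OF U]) (simp add: \<Psi>_0 \<Phi>_in q)
  ultimately show ?thesis
    using two_parameter_derivative[OF psmooth_\<Psi>[OF h] q, of w] h q by (simp add: fund_def)
qed

lemma zero_off_\<Psi>: "x \<in> U \<Longrightarrow> h \<in> smooth_funs M \<Longrightarrow> zero_off M (\<lambda>q. h (\<Psi> x q)) \<in> smooth_funs M"
  using psmooth_section[OF U(1) _ psmooth_\<Psi>] by blast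

lemma pull_apply: "h \<in> smooth_funs M \<Longrightarrow> pull x Y p h = Y (\<Phi> x p) (zero_off M (\<lambda>q. h (\<Psi> x q)))"
  by (simp add: pull_def differential_apply)

lemma pull_tangent:
  assumes x: "x \<in> U" and p: "p \<in> points M" and Y: "Y \<in> vector_fields M"
  shows "pull x Y p \<in> tangent_space M p"
  using differential_tangent[OF zero_off_\<Psi>[OF x] \<Phi>_in[OF x p] vector_fieldD(1)[OF Y \<Phi>_in[OF x p]]]
    \<Psi>_\<Phi>[OF x p] by (simp add: pull_def)

lemma zero_off_\<Psi>_0: "h \<in> smooth_funs M \<Longrightarrow> zero_off M (\<lambda>q. h (\<Psi> x0 q)) = h"
  by (rule ext) (auto simp: zero_off_def \<Psi>_0 smooth_funsD(1))

lemma pull_0: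
  assumes p: "p \<in> points M" and Y: "Y \<in> vector_fields M"
  shows "pull x0 Y p = Y p"
  by (rule tangent_eqI[OF pull_tangent[OF U(2) p Y] vector_fieldD(1)[OF Y p]])
    (simp add: pull_apply zero_off_\<Psi>_0 \<Phi>_0[OF p])

text \<open>The pulled-back field depends on \<open>x\<close> twice. Moving the point by \<Phi>
  differentiates the function \<open>Y h\<close> along the fundamental field, while moving the
  argument by \<Psi> gives \<open>Y\<close> applied to minus the derivative of \<open>h\<close>. The
  sum is the bracket.\<close>

lemma
  assumes p: "p \<in> points M" and Y: "Y \<in> vector_fields M" and h: "h \<in> smooth_funs M"
  shows smooth_on_pull: "smooth_on U (\<lambda>x. pull x Y p h)"
    and pull_derivative: "frechet_derivative (\<lambda>x. pull x Y p h) (at x0) w = lie_bracket (fund w) Y p h"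
proof -
  let ?Q = "\<lambda>x q. Y q (zero_off M (\<lambda>q. h (\<Psi> x q)))"
  have Q: "psmooth U M ?Q" by (rule psmooth_field[OF U(1) psmooth_\<Psi>[OF h] Y])
  have pull: "pull x Y p h = ?Q x (\<Phi> x p)" for x by (rule pull_apply[OF h])
  show "smooth_on U (\<lambda>x. pull x Y p h)"
    unfolding pull by (rule psmooth_diagonal[OF U(1) Q smooth_into_\<Phi>[OF p]])
  note Yp = vector_fieldD(1)[OF Y p]
  have "zero_off M (\<lambda>q. frechet_derivative (\<lambda>x. h (\<Psi> x q)) (at x0) w) = (-1) *\<^sub>R act_on_fun (fund w) h"
    by (rule ext) (simp add: zero_off_def inverse_family_derivative[OF h] scaleR_fun_def act_on_fun_def fund_def)
  then have "frechet_derivative (\<lambda>x. ?Q x p) (at x0) w = Y p ((-1) *\<^sub>R act_on_fun (fund w) h)"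
    by (simp only: tangent_deriv_commute(1)[OF U psmooth_\<Psi>[OF h] p Yp, of w, symmetric])
  also have "\<dots> = - Y p (act_on_fun (fund w) h)"
    by (subst tangentD(2)[OF Yp vector_fieldD(3)[OF fund_vector_field h]]) simp
  finally have 1: "frechet_derivative (\<lambda>x. ?Q x p) (at x0) w = - Y p (act_on_fun (fund w) h)" .
  have 2: "frechet_derivative (\<lambda>x. ?Q x0 (\<Phi> x p)) (at x0) w = fund w p (act_on_fun Y h)"
    using p vector_fieldD(3)[OF Y h] by (simp add: zero_off_\<Psi>_0[OF h] fund_def act_on_fun_def)
  show "frechet_derivative (\<lambda>x. pull x Y p h) (at x0) w = lie_bracket (fund w) Y p h"
    unfolding pull two_parameter_derivative[OF Q p] 1 2 by (simp add: lie_bracket_def)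
qed

lemma pull_has_derivative:
  assumes p: "p \<in> points M" and Y: "Y \<in> vector_fields M" and h: "h \<in> smooth_funs M"
  shows "((\<lambda>x. pull x Y p h) has_derivative (\<lambda>w. lie_bracket (fund w) Y p h)) (at x0)"
proof -
  have "frechet_derivative (\<lambda>x. pull x Y p h) (at x0) = (\<lambda>w. lie_bracket (fund w) Y p h)"
    by (rule ext) (rule pull_derivative[OF assms])
  then show ?thesis using smooth_on_has_derivative[OF smooth_on_pull[OF assms] U(2)] by (simp only:)
qed

lemma invariant_field_commutes:
  assumes Y: "Y \<in> vector_fields M" and inv: "\<And>x p. x \<in> U \<Longrightarrow> p \<in> points M \<Longrightarrow> pull x Y p = Y p"
  shows "lie_bracket (fund w) Y = 0"
proof (intro ext)
  note br = lie_bracket_vector_field[OF fund_vector_field Y]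
  fix p h
  show "lie_bracket (fund w) Y p h = 0 p h"
  proof (cases "p \<in> points M \<and> h \<in> smooth_funs M")
    case True
    then have p: "p \<in> points M" and h: "h \<in> smooth_funs M" by auto
    have "frechet_derivative (\<lambda>x. pull x Y p h) (at x0) = frechet_derivative (\<lambda>x. Y p h) (at x0)"
      by (rule frechet_derivative_cong_open[OF U]) (simp add: inv p)
    then show ?thesis using pull_derivative[OF p Y h, of w] by simp
  next
    case False
    then show ?thesis
      using vector_fieldD(2)[OF br] tangentD(4)[OF vector_fieldD(1)[OF br]] by (cases "p \<in> points M") auto
  qed
qed

text \<open>By invariance the function at \<open>\<Phi> x p\<close> equals \<open>b p\<close> on the
  pulled-back fields at the fixed point \<open>p\<close>. In a basis of that one tangent space it is
  a polynomial in the values \<open>pull x Y p (h i)\<close>, and the product rule with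
  \<open>pull_has_derivative\<close> finishes.\<close>

lemma lie_derivative_2form:
  assumes b: "smooth_bilinear M b"
    and inv: "\<And>x p u v. x \<in> U \<Longrightarrow> p \<in> points M \<Longrightarrow> u \<in> tangent_space M (\<Phi> x p) \<Longrightarrow> v \<in> tangent_space M (\<Phi> x p)
      \<Longrightarrow> b p (differential M M (\<Psi> x) u) (differential M M (\<Psi> x) v) = b (\<Phi> x p) u v"
    and Y: "Y \<in> vector_fields M" and Z: "Z \<in> vector_fields M" and p: "p \<in> points M"
  shows "fund w p (eval2 M b Y Z)
    = b p (lie_bracket (fund w) Y p) (Z p) + b p (Y p) (lie_bracket (fund w) Z p)"
proof -
  from tangent_basis[OF p] obtain h :: "'e \<Rightarrow> 'm \<Rightarrow> real" and e :: "'e \<Rightarrow> 'm tvec" where "(\<forall>i. h i \<in> smooth_funs M) \<and> (\<forall>i. e i \<in> tangent_space M p) \<and>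
    (\<forall>v\<in>tangent_space M p. v = (\<Sum>i\<in>Basis. v (h i) *\<^sub>R e i))" by (elim exE)
  then have h: "h i \<in> smooth_funs M" and e: "e i \<in> tangent_space M p"
    and ex: "v \<in> tangent_space M p \<Longrightarrow> v = (\<Sum>i\<in>Basis. v (h i) *\<^sub>R e i)" for i v by blast+
  have lin: "linear_on_subspace (tangent_space M p) (b p u)" "linear_on_subspace (tangent_space M p) (\<lambda>v. b p v u)"
    if "u \<in> tangent_space M p" for u
    using b p that by (auto simp: smooth_bilinear_def)
  have B: "b p u v = (\<Sum>i\<in>Basis. \<Sum>j\<in>Basis. u (h i) * v (h j) * b p (e i) (e j))"
    if u: "u \<in> tangent_space M p" and v: "v \<in> tangent_space M p" for u v
  proof -
    have "b p u v = b p (\<Sum>i\<in>Basis. u (h i) *\<^sub>R e i) v" using ex[OF u] by simp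
    also have "\<dots> = (\<Sum>i\<in>Basis. u (h i) *\<^sub>R b p (e i) v)"
      by (rule linear_on_subspace_sum[OF lin(2)[OF v] tangent_zero tangent_add tangent_scaleR finite_Basis e])
    also have "\<dots> = (\<Sum>i\<in>Basis. u (h i) * (\<Sum>j\<in>Basis. v (h j) * b p (e i) (e j)))"
    proof (rule sum.cong[OF refl])
      fix i :: 'e
      have "b p (e i) v = b p (e i) (\<Sum>j\<in>Basis. v (h j) *\<^sub>R e j)" using ex[OF v] by simp
      also have "\<dots> = (\<Sum>j\<in>Basis. v (h j) *\<^sub>R b p (e i) (e j))"
        by (rule linear_on_subspace_sum[OF lin(1)[OF e] tangent_zero tangent_add tangent_scaleR finite_Basis e])
      finally show "u (h i) *\<^sub>R b p (e i) v = u (h i) * (\<Sum>j\<in>Basis. v (h j) * b p (e i) (e j))" by simp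
    qed
    finally show ?thesis by (simp add: sum_distrib_left mult.assoc)
  qed
  have F: "eval2 M b Y Z \<in> smooth_funs M" using b Y Z by (simp add: smooth_bilinear_def)
  note Yp = vector_fieldD(1)[OF Y p] and Zp = vector_fieldD(1)[OF Z p]
  let ?BY = "lie_bracket (fund w) Y p" and ?BZ = "lie_bracket (fund w) Z p"
  have BY: "?BY \<in> tangent_space M p" and BZ: "?BZ \<in> tangent_space M p"
    using vector_fieldD(1)[OF lie_bracket_vector_field[OF fund_vector_field] p] Y Z by auto
  let ?D = "\<lambda>w. \<Sum>i\<in>Basis. \<Sum>j\<in>Basis.
      (pull x0 Y p (h i) * lie_bracket (fund w) Z p (h j) + lie_bracket (fund w) Y p (h i) * pull x0 Z p (h j)) * b p (e i) (e j)"
  have "((\<lambda>x. \<Sum>i\<in>Basis. \<Sum>j\<in>Basis. pull x Y p (h i) * pull x Z p (h j) * b p (e i) (e j)) has_derivative ?D) (at x0)"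
    by (intro has_derivative_sum has_derivative_mult_left has_derivative_mult pull_has_derivative p Y Z h)
  then have "((\<lambda>x. eval2 M b Y Z (\<Phi> x p)) has_derivative ?D) (at x0)"
  proof (rule has_derivative_transform_within_open[OF _ U])
    fix x assume x: "x \<in> U"
    note qx = \<Phi>_in[OF x p]
    have "b p (pull x Y p) (pull x Z p) = b (\<Phi> x p) (Y (\<Phi> x p)) (Z (\<Phi> x p))"
      unfolding pull_def by (rule inv[OF x p vector_fieldD(1)[OF Y qx] vector_fieldD(1)[OF Z qx]])
    then show "(\<Sum>i\<in>Basis. \<Sum>j\<in>Basis. pull x Y p (h i) * pull x Z p (h j) * b p (e i) (e j)) = eval2 M b Y Z (\<Phi> x p)"
      using B[OF pull_tangent[OF x p Y] pull_tangent[OF x p Z]] qx by (simp add: eval2_def zero_off_def)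
  qed
  from fund_eqI[OF p F this, of w]
  have "fund w p (eval2 M b Y Z) = (\<Sum>i\<in>Basis. \<Sum>j\<in>Basis.
      (Y p (h i) * ?BZ (h j) + ?BY (h i) * Z p (h j)) * b p (e i) (e j))"
    by (simp add: pull_0[OF p Y] pull_0[OF p Z])
  also have "\<dots> = b p ?BY (Z p) + b p (Y p) ?BZ"
    unfolding B[OF BY Zp] B[OF Yp BZ] by (simp add: sum.distrib distrib_right add.commute)
  finally show ?thesis .
qed

lemma lie_derivative_1form:
  assumes \<theta>: "smooth_1form M \<theta>"
    and inv: "\<And>x p u. x \<in> U \<Longrightarrow> p \<in> points M \<Longrightarrow> u \<in> tangent_space M (\<Phi> x p)
      \<Longrightarrow> \<theta> p (differential M M (\<Psi> x) u) = \<theta> (\<Phi> x p) u"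
    and Y: "Y \<in> vector_fields M" and p: "p \<in> points M"
  shows "fund w p (eval1 M \<theta> Y) = \<theta> p (lie_bracket (fund w) Y p)"
proof -
  from tangent_basis[OF p] obtain h :: "'e \<Rightarrow> 'm \<Rightarrow> real" and e :: "'e \<Rightarrow> 'm tvec" where "(\<forall>i. h i \<in> smooth_funs M) \<and> (\<forall>i. e i \<in> tangent_space M p) \<and>
    (\<forall>v\<in>tangent_space M p. v = (\<Sum>i\<in>Basis. v (h i) *\<^sub>R e i))" by (elim exE)
  then have h: "h i \<in> smooth_funs M" and e: "e i \<in> tangent_space M p"
    and ex: "v \<in> tangent_space M p \<Longrightarrow> v = (\<Sum>i\<in>Basis. v (h i) *\<^sub>R e i)" for i v by blast+
  have lin: "linear_on_subspace (tangent_space M p) (\<theta> p)" using \<theta> p by (simp add: smooth_1form_def)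
  have B: "\<theta> p u = (\<Sum>i\<in>Basis. u (h i) * \<theta> p (e i))" if u: "u \<in> tangent_space M p" for u
  proof -
    have "\<theta> p u = \<theta> p (\<Sum>i\<in>Basis. u (h i) *\<^sub>R e i)" using ex[OF u] by simp
    also have "\<dots> = (\<Sum>i\<in>Basis. u (h i) *\<^sub>R \<theta> p (e i))"
      by (rule linear_on_subspace_sum[OF lin tangent_zero tangent_add tangent_scaleR finite_Basis e])
    finally show ?thesis by simp
  qed
  have F: "eval1 M \<theta> Y \<in> smooth_funs M" using \<theta> Y by (simp add: smooth_1form_def)
  have BY: "lie_bracket (fund w) Y p \<in> tangent_space M p"
    using vector_fieldD(1)[OF lie_bracket_vector_field[OF fund_vector_field Y] p] .
  have "((\<lambda>x. \<Sum>i\<in>Basis. pull x Y p (h i) * \<theta> p (e i)) has_derivative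
      (\<lambda>w. \<Sum>i\<in>Basis. lie_bracket (fund w) Y p (h i) * \<theta> p (e i))) (at x0)"
    by (intro has_derivative_sum has_derivative_mult_left pull_has_derivative p Y h)
  then have "((\<lambda>x. eval1 M \<theta> Y (\<Phi> x p)) has_derivative
      (\<lambda>w. \<Sum>i\<in>Basis. lie_bracket (fund w) Y p (h i) * \<theta> p (e i))) (at x0)"
  proof (rule has_derivative_transform_within_open[OF _ U])
    fix x assume x: "x \<in> U"
    note qx = \<Phi>_in[OF x p]
    have "\<theta> p (pull x Y p) = \<theta> (\<Phi> x p) (Y (\<Phi> x p))"
      unfolding pull_def by (rule inv[OF x p vector_fieldD(1)[OF Y qx]])
    then show "(\<Sum>i\<in>Basis. pull x Y p (h i) * \<theta> p (e i)) = eval1 M \<theta> Y (\<Phi> x p)"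
      using B[OF pull_tangent[OF x p Y]] qx by (simp add: eval1_def zero_off_def)
  qed
  from fund_eqI[OF p F this, of w] show ?thesis using B[OF BY] by simp
qed

end

section \<open>Smooth actions of Lie groups\<close>

text \<open>The chart \<open>c0\<close> at the identity is fixed once and for all: its inverse
  parametrises group elements near the identity and takes the place of the exponential map.\<close>

locale lie_action = group G for G (structure) +
  fixes N :: "('a, 'b::euclidean_space) manifold" and M :: "('m, 'e::euclidean_space) manifold"
    and \<phi> :: "'a \<Rightarrow> 'm \<Rightarrow> 'm" and c0 :: "('a, 'b) chart"
  assumes lie_group: "lie_group G N" and smooth_M: "smooth_manifold M"
    and smooth_action: "smooth_action G N M \<phi>"
    and c0: "c0 \<in> matlas N" "\<one> \<in> cdom c0"
begin

lemma points_N: "points N = carrier G"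
  using lie_group by (simp add: lie_group_def)

lemma smooth_mfd_N: "smooth_mfd N"
  using lie_group by (simp add: lie_group_def smooth_mfd_def)

lemma smooth_mfd_M: "smooth_mfd M"
  using smooth_M by (simp add: smooth_mfd_def)

sublocale N: smooth_mfd N by (rule smooth_mfd_N)
sublocale M: smooth_mfd M by (rule smooth_mfd_M)

lemma group_action: "group_action G (points M) \<phi>"
  using smooth_action by (simp add: smooth_action_def)

lemma action_in: "a \<in> carrier G \<Longrightarrow> p \<in> points M \<Longrightarrow> \<phi> a p \<in> points M"
  using group_action.element_image[OF group_action] by blast

lemma action_mult:
  "a \<in> carrier G \<Longrightarrow> b \<in> carrier G \<Longrightarrow> p \<in> points M \<Longrightarrow> \<phi> (a \<otimes> b) p = \<phi> a (\<phi> b p)"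
  using group_action.composition_rule[OF group_action] by blast

lemma action_one: "p \<in> points M \<Longrightarrow> \<phi> \<one> p = p"
  using group_action.id_eq_one[OF group_action] by (metis restrict_apply')

lemma action_inv: "a \<in> carrier G \<Longrightarrow> p \<in> points M \<Longrightarrow> \<phi> (inv a) (\<phi> a p) = p"
  using group_action.orbit_sym_aux[OF group_action] by blast

lemma chart_carrier: "c \<in> matlas N \<Longrightarrow> x \<in> cim c \<Longrightarrow> cinv c x \<in> carrier G"
  using N.cdom_subset[OF _ N.cinv_in] points_N by blast

lemma c0_one: "cinv c0 (cmap c0 \<one>) = \<one>" "cmap c0 \<one> \<in> cim c0"
  using N.cinv_cmap[OF c0] c0(2) by auto

lemma jsmooth_action: "h \<in> smooth_funs M \<Longrightarrow> jsmooth N M (\<lambda>a p. h (\<phi> a p))"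
  using smooth_map_jsmooth[OF smooth_mfd_N smooth_mfd_M smooth_mfd_M, of "\<lambda>(a, p). \<phi> a p" h] smooth_action
  by (simp add: smooth_action_def)

lemma jsmooth_mult: "k \<in> smooth_funs N \<Longrightarrow> jsmooth N N (\<lambda>a b. k (a \<otimes> b))"
  using smooth_map_jsmooth[OF smooth_mfd_N smooth_mfd_N smooth_mfd_N, of "\<lambda>(a, b). a \<otimes> b" k] lie_group
  by (simp add: lie_group_def)

lemma jsmooth_mult_right: "k \<in> smooth_funs N \<Longrightarrow> jsmooth N N (\<lambda>b a. k (a \<otimes> b))"
  by (rule jsmooth_swap[OF smooth_mfd_N smooth_mfd_N jsmooth_mult])

lemma smooth_into_chart: "c \<in> matlas N \<Longrightarrow> smooth_into (cim c) N (cinv c)"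
  using N.cdom_subset[OF _ N.cinv_in] N.smooth_funsD(2) by (simp add: smooth_into_def)

lemma smooth_into_inv:
  assumes c: "c \<in> matlas N"
  shows "smooth_into (cim c) N (\<lambda>x. inv (cinv c x))"
  unfolding smooth_into_def
proof (intro conjI ballI)
  show "inv (cinv c x) \<in> points N" if "x \<in> cim c" for x
    using chart_carrier[OF c that] by (simp add: points_N)
  fix k assume k: "k \<in> smooth_funs N"
  have "smooth_map N N (\<lambda>a. inv a)" using lie_group by (simp add: lie_group_def)
  from N.smooth_funsD(2)[OF smooth_map_smooth_funs[OF smooth_mfd_N smooth_mfd_N this k] c]
  show "smooth_on (cim c) (\<lambda>x. k (inv (cinv c x)))"
    by (rule smooth_on_cong[OF N.open_cim[OF c]]) (simp add: zero_off_def points_N chart_carrier[OF c])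
qed

sublocale A: smooth_family M "cim c0" "cmap c0 \<one>" "\<lambda>x. \<phi> (cinv c0 x)" "\<lambda>x. \<phi> (inv (cinv c0 x))"
proof unfold_locales
  show "open (cim c0)" "cmap c0 \<one> \<in> cim c0" using N.open_cim[OF c0(1)] c0_one by auto
  show "\<phi> (cinv c0 x) q \<in> points M" if "x \<in> cim c0" "q \<in> points M" for x q
    using action_in[OF chart_carrier[OF c0(1)]] that by blast
  show "\<phi> (inv (cinv c0 x)) (\<phi> (cinv c0 x) q) = q" if "x \<in> cim c0" "q \<in> points M" for x q
    using action_inv[OF chart_carrier[OF c0(1)]] that by blast
  show "\<phi> (cinv c0 (cmap c0 \<one>)) q = q" if "q \<in> points M" for q
    using action_one[OF that] by (simp add: c0_one)
  show "psmooth (cim c0) M (\<lambda>x q. h (\<phi> (cinv c0 x) q))" if "h \<in> smooth_funs M" for h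
    by (rule psmooth_smooth_into[OF smooth_mfd_N smooth_mfd_M jsmooth_action[OF that]
          N.open_cim[OF c0(1)] smooth_into_chart[OF c0(1)]])
  show "psmooth (cim c0) M (\<lambda>x q. h (\<phi> (inv (cinv c0 x)) q))" if "h \<in> smooth_funs M" for h
    by (rule psmooth_smooth_into[OF smooth_mfd_N smooth_mfd_M jsmooth_action[OF that]
          N.open_cim[OF c0(1)] smooth_into_inv[OF c0(1)]])
qed

lemma psmooth_right_inv:
  assumes "c \<in> matlas N" "k \<in> smooth_funs N"
  shows "psmooth (cim c) N (\<lambda>x q. k (q \<otimes> inv (cinv c x)))"
  by (rule psmooth_smooth_into[OF smooth_mfd_N smooth_mfd_N jsmooth_mult_right[OF assms(2)]
        N.open_cim[OF assms(1)] smooth_into_inv[OF assms(1)]])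

text \<open>Right translations are chosen because they commute with left ones: their fundamental
  fields are left-invariant and so lie in \<open>lie_algebra G N\<close>.\<close>

sublocale R: smooth_family N "cim c0" "cmap c0 \<one>" "\<lambda>x b. b \<otimes> cinv c0 x" "\<lambda>x b. b \<otimes> inv (cinv c0 x)"
proof unfold_locales
  note cc = chart_carrier[OF c0(1)]
  show "open (cim c0)" "cmap c0 \<one> \<in> cim c0" using N.open_cim[OF c0(1)] c0_one by auto
  show "q \<otimes> cinv c0 x \<in> points N" if "x \<in> cim c0" "q \<in> points N" for x q
    using cc[OF that(1)] that(2) by (simp add: points_N)
  show "q \<otimes> cinv c0 x \<otimes> inv (cinv c0 x) = q" if "x \<in> cim c0" "q \<in> points N" for x q
    using cc[OF that(1)] that(2) by (simp add: points_N m_assoc)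
  show "q \<otimes> cinv c0 (cmap c0 \<one>) = q" if "q \<in> points N" for q
    using that by (simp add: c0_one points_N)
  show "psmooth (cim c0) N (\<lambda>x q. h (q \<otimes> cinv c0 x))" if "h \<in> smooth_funs N" for h
    by (rule psmooth_smooth_into[OF smooth_mfd_N smooth_mfd_N jsmooth_mult_right[OF that]
          N.open_cim[OF c0(1)] smooth_into_chart[OF c0(1)]])
  show "psmooth (cim c0) N (\<lambda>x q. h (q \<otimes> inv (cinv c0 x)))" if "h \<in> smooth_funs N" for h
    by (rule psmooth_right_inv[OF c0(1) that])
qed

section \<open>Translations and orbit functions\<close>

lemma jsmooth_first:
  assumes H: "jsmooth N L H" and L: "smooth_mfd L" and a: "a \<in> carrier G"
  shows "zero_off L (H a) \<in> smooth_funs L"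
proof -
  obtain c where c: "c \<in> matlas N" "a \<in> cdom c" using N.chart_at a points_N by blast
  have "psmooth (cim c) L (\<lambda>x. H (cinv c x))" using H c(1) by (simp add: jsmooth_def)
  from smooth_mfd.psmooth_section[OF L N.open_cim[OF c(1)] _ this, of "cmap c a"]
  show ?thesis using c by (simp add: N.cinv_cmap)
qed

lemma translate_left: "a \<in> carrier G \<Longrightarrow> k \<in> smooth_funs N \<Longrightarrow> zero_off N (\<lambda>b. k (a \<otimes> b)) \<in> smooth_funs N"
  using jsmooth_first[OF jsmooth_mult smooth_mfd_N] by blast

lemma translate_right: "a \<in> carrier G \<Longrightarrow> k \<in> smooth_funs N \<Longrightarrow> zero_off N (\<lambda>b. k (b \<otimes> a)) \<in> smooth_funs N"
  using jsmooth_first[OF jsmooth_mult_right smooth_mfd_N] by blast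

lemma translate_action: "a \<in> carrier G \<Longrightarrow> h \<in> smooth_funs M \<Longrightarrow> zero_off M (\<lambda>p. h (\<phi> a p)) \<in> smooth_funs M"
  using jsmooth_first[OF jsmooth_action smooth_mfd_M] by blast

lemma orbit_fun: "p \<in> points M \<Longrightarrow> h \<in> smooth_funs M \<Longrightarrow> zero_off N (\<lambda>a. h (\<phi> a p)) \<in> smooth_funs N"
  using jsmooth_smooth_into[OF smooth_mfd_N smooth_mfd_M jsmooth_action] by blast

lemma R_fund_apply:
  assumes "a \<in> carrier G" "k \<in> smooth_funs N"
  shows "R.fund w a k = frechet_derivative (\<lambda>x. k (a \<otimes> cinv c0 x)) (at (cmap c0 \<one>)) w"
  using assms by (simp add: R.fund_def points_N)

lemma frechet_derivative_c0_cong: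
  assumes "\<And>x. x \<in> cim c0 \<Longrightarrow> f x = g x"
  shows "frechet_derivative f (at (cmap c0 \<one>)) = frechet_derivative g (at (cmap c0 \<one>))"
  by (rule frechet_derivative_cong_open[OF N.open_cim[OF c0(1)] c0_one(2) assms])

section \<open>Left-invariant vector fields\<close>

lemma R_fund_left_invariant:
  assumes a: "a \<in> carrier G" and b: "b \<in> carrier G"
  shows "differential N N (\<lambda>x. a \<otimes> x) (R.fund w b) = R.fund w (a \<otimes> b)"
proof
  fix k
  show "differential N N (\<lambda>x. a \<otimes> x) (R.fund w b) k = R.fund w (a \<otimes> b) k"
  proof (cases "k \<in> smooth_funs N")
    case k: True
    have "frechet_derivative (\<lambda>x. zero_off N (\<lambda>y. k (a \<otimes> y)) (b \<otimes> cinv c0 x)) (at (cmap c0 \<one>))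
        = frechet_derivative (\<lambda>x. k (a \<otimes> b \<otimes> cinv c0 x)) (at (cmap c0 \<one>))"
      by (rule frechet_derivative_c0_cong)
        (simp add: zero_off_def points_N m_assoc a b chart_carrier[OF c0(1)])
    then show ?thesis
      by (simp add: N.differential_apply k R_fund_apply translate_left a b)
  qed (simp add: differential_def R.fund_def)
qed

lemma R_fund_lie_algebra: "R.fund w \<in> lie_algebra G N"
  using R.fund_vector_field R_fund_left_invariant by (simp add: lie_algebra_def)

lemma R_fund_one: "R.fund w \<one> = coord_vector N c0 \<one> w"
proof
  fix k :: "'a \<Rightarrow> real"
  have "frechet_derivative (\<lambda>x. k (\<one> \<otimes> cinv c0 x)) (at (cmap c0 \<one>))
      = frechet_derivative (\<lambda>x. k (cinv c0 x)) (at (cmap c0 \<one>))"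
    by (rule frechet_derivative_c0_cong) (simp add: chart_carrier[OF c0(1)])
  then show "R.fund w \<one> k = coord_vector N c0 \<one> w k"
    by (simp add: R.fund_def points_N coord_vector_def comp_def)
qed

lemma translation_tangent:
  assumes a: "a \<in> carrier G" and b: "b \<in> carrier G" and v: "v \<in> tangent_space N b"
  shows "differential N N (\<lambda>x. a \<otimes> x) v \<in> tangent_space N (a \<otimes> b)"
proof (rule N.differential_tangent[OF _ _ v])
  show "zero_off N (\<lambda>q. h (a \<otimes> q)) \<in> smooth_funs N" if "h \<in> smooth_funs N" for h
    by (rule translate_left[OF a that])
qed (simp add: points_N b)

lemma R_fund_span:
  assumes a: "a \<in> carrier G" and v: "v \<in> tangent_space N a"
  obtains w where "v = R.fund w a"
proof -
  let ?u = "differential N N (\<lambda>x. inv a \<otimes> x) v"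
  have u: "?u \<in> tangent_space N \<one>" using translation_tangent[of "inv a" a v] a v by simp
  obtain w where w: "?u = coord_vector N c0 \<one> w" using N.tangent_coord_vector[OF c0 u] .
  have "differential N N (\<lambda>x. a \<otimes> x) ?u = R.fund w a"
    using R_fund_left_invariant[OF a one_closed, of w] a by (simp add: w R_fund_one)
  moreover have "differential N N (\<lambda>x. a \<otimes> x) ?u = v"
  proof
    fix k
    show "differential N N (\<lambda>x. a \<otimes> x) ?u k = v k"
    proof (cases "k \<in> smooth_funs N")
      case k: True
      have "zero_off N (\<lambda>x. zero_off N (\<lambda>x. k (a \<otimes> x)) (inv a \<otimes> x)) = k"
        by (rule ext) (use a N.smooth_funsD(1)[OF k] in \<open>auto simp: zero_off_def points_N m_assoc[symmetric]\<close>)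
      then show ?thesis by (simp add: N.differential_apply k translate_left a)
    qed (simp add: differential_def N.tangentD(4)[OF v])
  qed
  ultimately show thesis using that by metis
qed

lemma constant_if_killed:
  assumes conn: "connected_space (mtop N)" and E: "E \<in> smooth_funs N"
    and kill: "\<And>a w. a \<in> carrier G \<Longrightarrow> R.fund w a E = 0" and ab: "a \<in> carrier G" "b \<in> carrier G"
  shows "E a = E b"
proof (rule N.zero_derivative_imp_constant[OF conn E])
  show "v E = 0" if pN: "p \<in> points N" and v: "v \<in> tangent_space N p" for p v
  proof -
    have p: "p \<in> carrier G" using pN points_N by simp
    obtain w where "v = R.fund w p" using R_fund_span[OF p v] .
    then show ?thesis using kill[OF p] by simp
  qed
qed (use ab points_N in auto)

section \<open>Central elements and their fundamental fields\<close>

lemma lie_centerD: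
  assumes "Z \<in> lie_center G N"
  shows "Z \<in> vector_fields N"
    and "a \<in> carrier G \<Longrightarrow> b \<in> carrier G \<Longrightarrow> differential N N (\<lambda>x. a \<otimes> x) (Z b) = Z (a \<otimes> b)"
    and "lie_bracket (R.fund w) Z = 0"
proof -
  show "Z \<in> vector_fields N" "a \<in> carrier G \<Longrightarrow> b \<in> carrier G \<Longrightarrow> differential N N (\<lambda>x. a \<otimes> x) (Z b) = Z (a \<otimes> b)"
    using assms by (auto simp: lie_center_def lie_algebra_def)
  have "lie_bracket Z (R.fund w) = 0"
    using assms R_fund_lie_algebra by (simp add: lie_center_def)
  then have "Z p (act_on_fun (R.fund w) f) - R.fund w p (act_on_fun Z f) = 0" for p f
    by (metis (no_types, lifting) lie_bracket_def zero_fun_apply)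
  then show "lie_bracket (R.fund w) Z = 0"
    by (intro ext) (simp add: lie_bracket_def)
qed

text \<open>The value at \<open>b\<close> of \<open>Z\<close> transported by the right translation
  with \<open>inv a\<close>, as a function \<open>E\<close> of \<open>a\<close>, has derivatives
  given by brackets of \<open>Z\<close> with left-invariant fields. These vanish for a central
  \<open>Z\<close>, and the group is connected, so \<open>E\<close> keeps its value at the
  identity.\<close>

lemma central_right_invariant:
  assumes conn: "connected_space (mtop N)" and Z: "Z \<in> lie_center G N"
    and a: "a \<in> carrier G" and b: "b \<in> carrier G" and k: "k \<in> smooth_funs N"
  shows "Z (b \<otimes> a) (zero_off N (\<lambda>y. k (y \<otimes> inv a))) = Z b k"
proof -
  define E where "E = zero_off N (\<lambda>a. Z (b \<otimes> a) (zero_off N (\<lambda>y. k (y \<otimes> inv a))))"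
  have E: "E \<in> smooth_funs N"
  proof (rule N.smooth_funsI)
    fix c assume c: "c \<in> matlas N"
    note op = N.open_cim[OF c]
    have "smooth_into (cim c) N (\<lambda>x. b \<otimes> cinv c x)"
      unfolding smooth_into_def
    proof (intro conjI ballI)
      show "b \<otimes> cinv c x \<in> points N" if "x \<in> cim c" for x using b chart_carrier[OF c that] by (simp add: points_N)
      show "smooth_on (cim c) (\<lambda>x. h (b \<otimes> cinv c x))" if "h \<in> smooth_funs N" for h
        by (rule smooth_on_cong[OF op N.smooth_funsD(2)[OF translate_left[OF b that] c]])
          (simp add: zero_off_def points_N chart_carrier[OF c])
    qed
    from N.psmooth_diagonal[OF op N.psmooth_field[OF op psmooth_right_inv[OF c k] lie_centerD(1)[OF Z]] this]
    show "smooth_on (cim c) (\<lambda>x. E (cinv c x))"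
      by (rule smooth_on_cong[OF op]) (simp add: E_def zero_off_def points_N chart_carrier[OF c])
  qed (simp add: E_def zero_off_def)
  have "R.fund w a E = 0" if a: "a \<in> carrier G" for a w
  proof -
    let ?k = "zero_off N (\<lambda>y. k (y \<otimes> inv a))"
    have k': "?k \<in> smooth_funs N" using translate_right[OF _ k, of "inv a"] a by simp
    have ba: "b \<otimes> a \<in> points N" using a b by (simp add: points_N)
    \<comment> \<open>Moving \<open>a\<close> to \<open>a \<otimes> cinv c0 x\<close> pulls
      \<open>Z\<close> back by one more right translation, with base point
      \<open>b \<otimes> a\<close> and the test function already translated by
      \<open>inv a\<close>.\<close>
    have "R.fund w a E = frechet_derivative (\<lambda>x. R.pull x Z (b \<otimes> a) ?k) (at (cmap c0 \<one>)) w"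
      unfolding R_fund_apply[OF a E]
    proof (rule fun_cong[OF frechet_derivative_c0_cong])
      fix x assume x: "x \<in> cim c0"
      note g = chart_carrier[OF c0(1) x]
      have "zero_off N (\<lambda>q. ?k (q \<otimes> inv (cinv c0 x))) = zero_off N (\<lambda>y. k (y \<otimes> inv (a \<otimes> cinv c0 x)))"
        by (rule ext) (use a g in \<open>simp add: zero_off_def points_N m_assoc inv_mult_group\<close>)
      then show "E (a \<otimes> cinv c0 x) = R.pull x Z (b \<otimes> a) ?k"
        unfolding R.pull_apply[OF k'] using a b g by (simp add: E_def zero_off_def points_N m_assoc)
    qed
    also have "\<dots> = 0"
      using R.pull_derivative[OF ba lie_centerD(1)[OF Z] k', of w] lie_centerD(3)[OF Z, of w] by simp
    finally show ?thesis .
  qed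
  from constant_if_killed[OF conn E this a one_closed] have "E a = E \<one>" .
  moreover have "E a = Z (b \<otimes> a) (zero_off N (\<lambda>y. k (y \<otimes> inv a)))" using a by (simp add: E_def zero_off_def points_N)
  moreover have "zero_off N (\<lambda>y. k (y \<otimes> inv \<one>)) = k"
    by (rule ext) (use N.smooth_funsD(1)[OF k] in \<open>auto simp: zero_off_def points_N\<close>)
  moreover have "E \<one> = Z (b \<otimes> \<one>) (zero_off N (\<lambda>y. k (y \<otimes> inv \<one>)))"
    unfolding E_def zero_off_def[of N "\<lambda>a. Z (b \<otimes> a) (zero_off N (\<lambda>y. k (y \<otimes> inv a)))"]
    by (simp only: points_N one_closed if_True)
  ultimately have "E \<one> = Z b k" by (simp only: r_one[OF b])
  moreover note \<open>E a = E \<one>\<close> \<open>E a = Z (b \<otimes> a) (zero_off N (\<lambda>y. k (y \<otimes> inv a)))\<close>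
  ultimately show ?thesis by simp
qed

lemma A_fund_apply:
  assumes p: "p \<in> points M" and h: "h \<in> smooth_funs M"
  shows "A.fund w p h = R.fund w \<one> (zero_off N (\<lambda>a. h (\<phi> a p)))"
proof -
  have "frechet_derivative (\<lambda>x. zero_off N (\<lambda>a. h (\<phi> a p)) (\<one> \<otimes> cinv c0 x)) (at (cmap c0 \<one>))
      = frechet_derivative (\<lambda>x. h (\<phi> (cinv c0 x) p)) (at (cmap c0 \<one>))"
    by (rule frechet_derivative_c0_cong) (simp add: zero_off_def points_N chart_carrier[OF c0(1)])
  then show ?thesis using p h by (simp add: A.fund_def R_fund_apply orbit_fun)
qed

lemma action_tangent:
  assumes a: "a \<in> carrier G" and p: "p \<in> points M" and v: "v \<in> tangent_space M p"
  shows "differential M M (\<phi> a) v \<in> tangent_space M (\<phi> a p)"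
  by (rule M.differential_tangent[OF translate_action[OF a] p v])

text \<open>The orbit map of \<open>p\<close> intertwines left translation by \<open>a\<close> with
  \<open>\<phi> a\<close>, so it carries a left-invariant field at \<open>a\<close> to the image
  under \<open>\<phi> a\<close> of the fundamental vector at \<open>p\<close>.\<close>

lemma orbit_fun_derivative:
  assumes inv: "\<And>a. a \<in> carrier G \<Longrightarrow> differential N N (\<lambda>x. a \<otimes> x) (Z \<one>) = Z a"
    and z: "Z \<one> = R.fund z \<one>" and a: "a \<in> carrier G" and p: "p \<in> points M" and h: "h \<in> smooth_funs M"
  shows "Z a (zero_off N (\<lambda>b. h (\<phi> b p))) = A.fund z p (zero_off M (\<lambda>p. h (\<phi> a p)))"
proof -
  let ?k = "zero_off N (\<lambda>b. h (\<phi> b p))"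
  have "zero_off N (\<lambda>b. zero_off M (\<lambda>p. h (\<phi> a p)) (\<phi> b p)) = zero_off N (\<lambda>b. ?k (a \<otimes> b))"
    by (rule ext) (simp add: zero_off_def points_N action_in action_mult a p)
  then have "A.fund z p (zero_off M (\<lambda>p. h (\<phi> a p))) = Z \<one> (zero_off N (\<lambda>b. ?k (a \<otimes> b)))"
    by (simp add: A_fund_apply[OF p translate_action[OF a h]] z)
  also have "\<dots> = Z a ?k"
    unfolding inv[OF a, symmetric] by (simp add: N.differential_apply[OF orbit_fun[OF p h]])
  finally show ?thesis by simp
qed

text \<open>A central field is bi-invariant. Left invariance brings the left-hand side to
  \<open>Z\<close> at \<open>a\<close>; right invariance moves it back to the identity and replaces
  the orbit of \<open>p\<close> by that of \<open>\<phi> a p\<close>.\<close>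

lemma central_field_invariant:
  assumes conn: "connected_space (mtop N)" and Z: "Z \<in> lie_center G N" and z: "Z \<one> = R.fund z \<one>"
    and a: "a \<in> carrier G" and p: "p \<in> points M"
  shows "differential M M (\<phi> a) (A.fund z p) = A.fund z (\<phi> a p)"
proof
  fix h
  show "differential M M (\<phi> a) (A.fund z p) h = A.fund z (\<phi> a p) h"
  proof (cases "h \<in> smooth_funs M")
    case h: True
    let ?k = "zero_off N (\<lambda>b. h (\<phi> b p))"
    note k = orbit_fun[OF p h]
    note ap = action_in[OF a p]
    have left: "differential N N (\<lambda>x. b \<otimes> x) (Z \<one>) = Z b" if "b \<in> carrier G" for b
      using lie_centerD(2)[OF Z that one_closed] that by simp
    have "differential M M (\<phi> a) (A.fund z p) h = Z a ?k"
      by (simp add: M.differential_apply h orbit_fun_derivative[of Z z, OF left z a p h])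
    also have "\<dots> = Z \<one> (zero_off N (\<lambda>y. ?k (y \<otimes> a)))"
      using central_right_invariant[OF conn Z inv_closed[OF a] a k] a by simp
    also have "zero_off N (\<lambda>y. ?k (y \<otimes> a)) = zero_off N (\<lambda>b. h (\<phi> b (\<phi> a p)))"
      by (rule ext) (simp add: zero_off_def points_N action_mult a p)
    finally show ?thesis by (simp add: A_fund_apply[OF ap h] z)
  qed (simp add: differential_def A.fund_def)
qed

end

section \<open>Effective and transitive actions\<close>

context smooth_mfd
begin

lemma coord_vector_chain:
  assumes d: "d \<in> matlas M" and h: "h \<in> smooth_funs M" and q: "q \<in> cdom d" "cmap d q = f x"
    and f: "(f has_derivative D) (at x)"
  shows "((\<lambda>t. h (cinv d (f t))) has_derivative (\<lambda>v. coord_vector M d q (D v) h)) (at x)"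
proof -
  have "((\<lambda>y. h (cinv d y)) has_derivative (\<lambda>w. coord_vector M d q w h)) (at (f x))"
    using chart_has_derivative[OF d q(1) h] by (simp add: coord_vector_apply[OF h] q(2))
  from diff_chain_at[OF f this] show ?thesis by (simp add: comp_def)
qed

text \<open>If the field were nonzero at \<open>p\<close>, then
  \<open>killed_functions_not_separating\<close>, applied in a chart, would give a second point on
  which all of \<open>K\<close> agrees with \<open>p\<close>.\<close>

lemma vector_field_zero_if_killing_separating:
  assumes Z: "Z \<in> vector_fields M" and K: "\<And>k. k \<in> K \<Longrightarrow> k \<in> smooth_funs M"
    and kill: "\<And>k q. k \<in> K \<Longrightarrow> q \<in> points M \<Longrightarrow> Z q k = 0"
    and p: "p \<in> points M" and sep: "\<And>q. q \<in> points M \<Longrightarrow> (\<And>k. k \<in> K \<Longrightarrow> k q = k p) \<Longrightarrow> q = p"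
  shows "Z p = 0"
proof (rule ccontr)
  assume nz: "Z p \<noteq> 0"
  obtain c where c: "c \<in> matlas M" and pc: "p \<in> cdom c" using chart_at[OF p] .
  obtain W h where W: "open W" "cmap c p \<in> W" "W \<subseteq> cim c" and h: "\<And>i. h i \<in> smooth_funs M"
    and dual: "\<And>q v. q \<in> cdom c \<Longrightarrow> cmap c q \<in> W \<Longrightarrow> v \<in> tangent_space M q \<Longrightarrow>
      v = coord_vector M c q (\<Sum>i\<in>Basis. v (h i) *\<^sub>R i)"
    by (rule dual_functions[OF c pc]) (rule that, assumption+)
  define \<zeta> where "\<zeta> x = (\<Sum>i\<in>Basis. Z (cinv c x) (h i) *\<^sub>R i)" for x
  have "smooth_on W (\<lambda>x. Z (cinv c x) (h i))" for i
    using smooth_on_subset[OF smooth_funsD(2)[OF vector_fieldD(3)[OF Z h] c] W(3)] by (simp add: act_on_fun_def)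
  then have "smooth_on W \<zeta>" unfolding \<zeta>_def
    by (intro smooth_on_sum smooth_on_scaleR smooth_on_const W finite_Basis)
  then have cont: "continuous_on W \<zeta>" by (rule smooth_on_continuous_on)
  have at: "Z (cinv c x) = coord_vector M c (cinv c x) (\<zeta> x)" "cinv c x \<in> cdom c" "cmap c (cinv c x) = x"
    if "x \<in> W" for x
  proof -
    have x: "x \<in> cim c" using W(3) that by blast
    show q: "cinv c x \<in> cdom c" "cmap c (cinv c x) = x" using cinv_in[OF x] cmap_cinv[OF x] by auto
    show "Z (cinv c x) = coord_vector M c (cinv c x) (\<zeta> x)"
      unfolding \<zeta>_def by (rule dual[OF q(1) _ vector_fieldD(1)[OF Z cdom_subset[OF c q(1)]]]) (simp add: q(2) that)
  qed
  have nz': "\<zeta> (cmap c p) \<noteq> 0"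
  proof
    assume "\<zeta> (cmap c p) = 0"
    then have "Z p = coord_vector M c p (0 *\<^sub>R 0)" using at(1)[OF W(2)] cinv_cmap[OF c pc] by simp
    then show False using nz coord_vector_linear(2)[OF c pc, of 0 0] by simp
  qed
  obtain x where x: "x \<in> W" "x \<noteq> cmap c p" and eq: "\<And>k. k \<in> (\<lambda>k x. k (cinv c x)) ` K \<Longrightarrow> k x = k (cmap c p)"
  proof (rule killed_functions_not_separating[OF W(1,2) cont nz', of "(\<lambda>k x. k (cinv c x)) ` K"])
    fix k' x assume k': "k' \<in> (\<lambda>k x. k (cinv c x)) ` K" and x: "x \<in> W"
    then obtain k where k: "k \<in> K" "k' = (\<lambda>x. k (cinv c x))" by blast
    note q = at[OF x]
    show "k' differentiable (at x)"
      using chart_has_derivative[OF c q(2) K[OF k(1)]] unfolding k(2) q(3) differentiable_def by blast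
    have "frechet_derivative k' (at x) (\<zeta> x) = Z (cinv c x) k"
      unfolding q(1) k(2) by (simp add: coord_vector_apply[OF K[OF k(1)]] q(3))
    then show "frechet_derivative k' (at x) (\<zeta> x) = 0"
      using kill[OF k(1) cdom_subset[OF c q(2)]] by simp
  qed (rule that)
  have "cinv c x = p"
  proof (rule sep[OF cdom_subset[OF c at(2)[OF x(1)]]])
    fix k assume "k \<in> K"
    from eq[OF imageI[OF this]] show "k (cinv c x) = k p" by (simp add: cinv_cmap[OF c pc])
  qed
  then show False using at(3)[OF x(1)] x(2) by simp
qed

end

text \<open>The finite case of Baire's theorem, valid in every space: removing one closed piece from
  \<open>V\<close> leaves an open set covered by the others.\<close>

lemma open_subset_finite_union_nowhere_dense:
  assumes "finite \<G>" and "\<And>T. T \<in> \<G> \<Longrightarrow> closedin X T"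
    and "\<And>T V. T \<in> \<G> \<Longrightarrow> openin X V \<Longrightarrow> V \<subseteq> T \<Longrightarrow> V = {}"
  shows "openin X V \<Longrightarrow> V \<subseteq> \<Union>\<G> \<Longrightarrow> V = {}"
  using assms
proof (induction \<G> arbitrary: V rule: finite_induct)
  case (insert T \<G>)
  have cl: "closedin X T" using insert.prems(3) by blast
  have "openin X (V - T)" by (rule openin_diff[OF insert.prems(1) cl])
  moreover have "V - T \<subseteq> \<Union>\<G>" using insert.prems(2) by blast
  ultimately have "V - T = {}"
    by (rule insert.IH) (use insert.prems(3,4) in blast)+
  then show ?case using insert.prems(4)[of T V] insert.prems(1) by blast
qed simp

context lie_action
begin

text \<open>If the fundamental field vanishes, \<open>Z\<close> annihilates all orbit functions. By
  effectiveness these functions separate the identity from every other group element, so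
  \<open>Z\<close> is zero at the identity, and left invariance spreads this.\<close>

lemma central_field_zero:
  assumes faithful: "faithful_action G (points M) \<phi>"
    and Z: "Z \<in> lie_center G N" and z: "Z \<one> = R.fund z \<one>"
    and zero: "\<And>p. p \<in> points M \<Longrightarrow> A.fund z p = 0"
  shows "Z = 0"
proof -
  have left: "differential N N (\<lambda>x. a \<otimes> x) (Z \<one>) = Z a" if "a \<in> carrier G" for a
    using lie_centerD(2)[OF Z that one_closed] that by simp
  let ?K = "{zero_off N (\<lambda>b. h (\<phi> b p)) |h p. h \<in> smooth_funs M \<and> p \<in> points M}"
  have "Z \<one> = 0"
  proof (rule N.vector_field_zero_if_killing_separating[OF lie_centerD(1)[OF Z], of ?K])
    show "k \<in> smooth_funs N" if "k \<in> ?K" for k using that orbit_fun by blast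
    show "Z q k = 0" if k: "k \<in> ?K" and q: "q \<in> points N" for k q
    proof -
      obtain h p where h: "h \<in> smooth_funs M" and p: "p \<in> points M" and keq: "k = zero_off N (\<lambda>b. h (\<phi> b p))"
        using k by blast
      show ?thesis
        using orbit_fun_derivative[of Z z q, OF left z _ p h] q by (simp add: keq points_N zero[OF p])
    qed
    show "\<one> \<in> points N" by (simp add: points_N)
    fix a assume aN: "a \<in> points N" and eq: "\<And>k. k \<in> ?K \<Longrightarrow> k a = k \<one>"
    have a: "a \<in> carrier G" using aN points_N by simp
    have "\<phi> a p = \<phi> \<one> p" if p: "p \<in> points M" for p
    proof (rule M.smooth_funs_separate[OF action_in[OF a p] action_in[OF one_closed p]])
      fix h assume "h \<in> smooth_funs M"
      then have "zero_off N (\<lambda>b. h (\<phi> b p)) a = zero_off N (\<lambda>b. h (\<phi> b p)) \<one>"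
        using p by (intro eq) blast
      then show "h (\<phi> a p) = h (\<phi> \<one> p)" using a by (simp add: zero_off_def points_N)
    qed
    \<comment> \<open>The maps of an action are fixed off \<open>points M\<close>, so agreement on
      \<open>points M\<close> is equality of functions, the form in which \<open>faithful\<close>
      can be applied.\<close>
    moreover have "\<phi> a \<in> extensional (points M)" "\<phi> \<one> \<in> extensional (points M)"
      using group_action.bij_prop0[OF group_action] a by (auto simp: Bij_def)
    ultimately have "\<phi> a = \<phi> \<one>" by (intro extensionalityI[where A = "points M"]) auto
    then show "a = \<one>"
      using faithful_action.faithful[OF faithful] a by (simp add: inj_on_eq_iff)
  qed
  have "Z a f = 0" for a f
  proof (cases "a \<in> carrier G")
    case True
    have "Z a f = differential N N (\<lambda>x. a \<otimes> x) (Z \<one>) f" by (simp add: left[OF True])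
    then show ?thesis by (simp add: \<open>Z \<one> = 0\<close> differential_def)
  next
    case False
    then show ?thesis using N.vector_fieldD(2)[OF lie_centerD(1)[OF Z], of a] points_N by simp
  qed
  then show ?thesis by (intro ext) simp
qed

section \<open>Transitivity and the span of the fundamental fields\<close>

lemma continuous_action: "a \<in> carrier G \<Longrightarrow> continuous_map (mtop M) (mtop M) (\<phi> a)"
proof -
  assume a: "a \<in> carrier G"
  have "continuous_map (prod_topology (mtop N) (mtop M)) (mtop M) (\<lambda>(a, p). \<phi> a p)"
    using smooth_action by (simp add: smooth_action_def smooth_map_def prod_manifold_def)
  moreover have "continuous_map (mtop M) (prod_topology (mtop N) (mtop M)) (\<lambda>p. (a, p))"
    using a points_N by (simp add: continuous_map_pairedI)
  ultimately have "continuous_map (mtop M) (mtop M) ((\<lambda>(a, p). \<phi> a p) \<circ> (\<lambda>p. (a, p)))"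
    by (rule continuous_map_compose[rotated])
  then show ?thesis by (simp add: comp_def)
qed

lemma continuous_translation: "a \<in> carrier G \<Longrightarrow> continuous_map (mtop N) (mtop N) (\<lambda>b. a \<otimes> b)"
proof -
  assume a: "a \<in> carrier G"
  have "continuous_map (prod_topology (mtop N) (mtop N)) (mtop N) (\<lambda>(a, b). a \<otimes> b)"
    using lie_group by (simp add: lie_group_def smooth_map_def prod_manifold_def)
  moreover have "continuous_map (mtop N) (prod_topology (mtop N) (mtop N)) (\<lambda>b. (a, b))"
    using a points_N by (simp add: continuous_map_pairedI)
  ultimately have "continuous_map (mtop N) (mtop N) ((\<lambda>(a, b). a \<otimes> b) \<circ> (\<lambda>b. (a, b)))"
    by (rule continuous_map_compose[rotated])
  then show ?thesis by (simp add: comp_def)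
qed

text \<open>If the fundamental fields did not span, the orbit map would have constant rank less than the
  dimension, so a compact neighbourhood of the identity would have a nowhere dense image; but
  finitely many translates of that image cover \<open>M\<close>.\<close>

lemma nowhere_dense_orbit_piece:
  assumes p: "p \<in> points M" and v: "v \<in> tangent_space M p" and ns: "\<And>w. v \<noteq> A.fund w p"
  obtains r where "r > 0" "cball (cmap c0 \<one>) r \<subseteq> cim c0"
    "closedin (mtop M) ((\<lambda>x. \<phi> (cinv c0 x) p) ` cball (cmap c0 \<one>) r)"
    "\<And>V. openin (mtop M) V \<Longrightarrow> V \<subseteq> (\<lambda>x. \<phi> (cinv c0 x) p) ` cball (cmap c0 \<one>) r \<Longrightarrow> V = {}"
proof -
  let ?x0 = "cmap c0 \<one>"
  let ?F = "\<lambda>x. \<phi> (cinv c0 x) p"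
  obtain d where d: "d \<in> matlas M" and pd: "p \<in> cdom d" using M.chart_at[OF p] .
  have F0: "?F ?x0 = p" by (rule A.\<Phi>_0[OF p])
  obtain T where T: "open T" "?x0 \<in> T" "T \<subseteq> cim c0" and smk: "smooth_on T (\<lambda>t. cmap d (?F t))"
    and Td: "\<And>t. t \<in> T \<Longrightarrow> ?F t \<in> cdom d"
    by (rule M.smooth_into_chart_local[OF A.U A.smooth_into_\<Phi>[OF p] d]) (simp only: F0 pd, rule that, assumption+)
  define k where "k t = cmap d (?F t)" for t
  have k: "smooth_on T k" using smk by (simp add: k_def[abs_def])
  have Fk: "cinv d (k t) = ?F t" if "t \<in> T" for t using M.cinv_cmap[OF d Td[OF that]] by (simp add: k_def)
  have k0: "k ?x0 = cmap d p" by (simp only: k_def F0)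
  define k' where "k' x = frechet_derivative k (at x)" for x
  have dk: "(k has_derivative k' x) (at x)" if "x \<in> T" for x
    using smooth_on_has_derivative[OF k that] by (simp add: k'_def)
  let ?S2 = "cim c0 \<times> cim d"
  let ?F2 = "\<lambda>z. \<phi> (cinv c0 (fst z)) (cinv d (snd z))"
  have S2: "open ?S2" "(?x0, cmap d p) \<in> ?S2"
    using M.open_times_cim[OF A.U(1) d] c0_one(2) pd by auto
  have into: "smooth_into ?S2 M ?F2"
    unfolding smooth_into_def
  proof (intro conjI ballI)
    show "?F2 z \<in> points M" if "z \<in> ?S2" for z
      using A.\<Phi>_in M.cdom_subset[OF d M.cinv_in] that by auto
    show "smooth_on ?S2 (\<lambda>z. h (?F2 z))" if "h \<in> smooth_funs M" for h
      using A.psmooth_\<Phi>[OF that] d by (simp add: psmooth_def)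
  qed
  have F20: "?F2 (?x0, cmap d p) \<in> cdom d" using A.\<Phi>_0[OF p] pd by (simp add: M.cinv_cmap[OF d pd])
  obtain T2 where T2: "open T2" "(?x0, cmap d p) \<in> T2" "T2 \<subseteq> ?S2" and smk2: "smooth_on T2 (\<lambda>z. cmap d (?F2 z))"
    and T2d: "\<And>z. z \<in> T2 \<Longrightarrow> ?F2 z \<in> cdom d"
    by (rule M.smooth_into_chart_local[OF S2 into d F20]) (rule that, assumption+)
  define k2 where "k2 z = cmap d (?F2 z)" for z
  have k2: "smooth_on T2 k2" using smk2 by (simp add: k2_def[abs_def])
  \<comment> \<open>In the chart \<open>d\<close>, the differential at \<open>p\<close> of the
    diffeomorphism \<open>\<phi> (cinv c0 x)\<close>. It serves as \<open>A\<close> in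
    \<open>constant_rank_image_interior_empty\<close>.\<close>
  define D where "D x u = frechet_derivative k2 (at (x, cmap d p)) (0, u)" for x u
  define S where "S = T \<inter> (\<lambda>x. (x, cmap d p)) -` T2"
  have S: "open S" "?x0 \<in> S"
    unfolding S_def by (intro open_Int T open_vimage T2 continuous_intros) (use T T2 in simp)
  have dk2: "((\<lambda>y. k2 (x, y)) has_derivative D x) (at (cmap d p))" if "x \<in> S" for x
  proof -
    have "((\<lambda>y. (x, y)) has_derivative (\<lambda>u. (0, u))) (at (cmap d p))" by (auto intro!: derivative_eq_intros)
    from diff_chain_at[OF this smooth_on_has_derivative[OF k2]] that
    show ?thesis by (simp add: S_def D_def[abs_def] comp_def)
  qed
  have A1: "linear (D x)" if "x \<in> S" for x using has_derivative_linear[OF dk2[OF that]] .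
  have A2: "continuous_on S (\<lambda>x. D x u)" for u
  proof -
    have "continuous_on S (\<lambda>x. (x, cmap d p))" by (intro continuous_intros)
    from continuous_on_compose2[OF smooth_on_continuous_on[OF smooth_on_frechet_derivative[OF k2]] this]
    show ?thesis by (auto simp: D_def S_def)
  qed
  have A3: "D ?x0 u = u" for u
  proof -
    have "((\<lambda>y. y) has_derivative D ?x0) (at (cmap d p))"
    proof (rule has_derivative_transform_within_open[OF dk2[OF S(2)]])
      show "open (cim d)" "cmap d p \<in> cim d" using M.open_cim[OF d] pd by auto
      show "k2 (?x0, y) = y" if y: "y \<in> cim d" for y
        using A.\<Phi>_0[OF M.cdom_subset[OF d M.cinv_in[OF y]]] by (simp add: k2_def M.cmap_cinv[OF y])
    qed
    from has_derivative_unique[OF this has_derivative_ident] show ?thesis by simp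
  qed
  have nonsurj: "range (k' ?x0) \<noteq> UNIV"
  proof
    assume surj: "range (k' ?x0) = UNIV"
    obtain u where u: "v = coord_vector M d p u" using M.tangent_coord_vector[OF d pd v] .
    obtain w where w: "u = k' ?x0 w" using surj by (metis rangeE UNIV_I)
    have "v = A.fund w p"
    proof (rule M.tangent_eqI[OF v M.vector_fieldD(1)[OF A.fund_vector_field p]])
      fix h assume h: "h \<in> smooth_funs M"
      have "((\<lambda>t. h (cinv d (k t))) has_derivative (\<lambda>w. coord_vector M d p (k' ?x0 w) h)) (at ?x0)"
        by (rule M.coord_vector_chain[OF d h pd _ dk[OF T(2)]]) (simp add: k0)
      then have "((\<lambda>t. h (?F t)) has_derivative (\<lambda>w. coord_vector M d p (k' ?x0 w) h)) (at ?x0)"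
        by (rule has_derivative_transform_within_open[OF _ T(1,2)]) (simp only: Fk)
      from A.fund_eqI[OF p h this] show "v h = A.fund w p h" by (simp add: u w)
    qed
    then show False using ns by blast
  qed
  \<comment> \<open>Equivariance bounds the rank. Since
    \<open>\<phi> (a \<otimes> b) p = \<phi> a (\<phi> b p)\<close>, the derivative of the orbit map
    at \<open>a\<close> is the differential of \<open>\<phi> a\<close> after the derivative at the
    identity; \<open>w\<close> is the left-invariant direction that equals \<open>u\<close> at
    \<open>a\<close>.\<close>
  have sub: "\<exists>w. k' x u = D x (k' ?x0 w)" if x: "x \<in> S" for x u
  proof -
    have xT: "x \<in> T" and xT2: "(x, cmap d p) \<in> T2" using x by (auto simp: S_def)
    have xc: "x \<in> cim c0" using T(3) xT by blast
    let ?a = "cinv c0 x"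
    have a: "?a \<in> carrier G" "?a \<in> cdom c0" "cmap c0 ?a = x"
      using chart_carrier[OF c0(1) xc] N.cinv_in[OF xc] N.cmap_cinv[OF xc] by auto
    let ?q = "\<phi> ?a p"
    have q: "?q \<in> cdom d" "cmap d ?q = k x" using Td[OF xT] by (auto simp: k_def)
    obtain w where w: "coord_vector N c0 ?a u = R.fund w ?a"
      using R_fund_span[OF a(1) N.coord_vector_tangent[OF c0(1) a(2)]] .
    have "coord_vector M d ?q (k' x u) = coord_vector M d ?q (D x (k' ?x0 w))"
    proof (rule M.tangent_eqI[OF M.coord_vector_tangent[OF d q(1)] M.coord_vector_tangent[OF d q(1)]])
      fix h assume h: "h \<in> smooth_funs M"
      let ?o = "zero_off N (\<lambda>b. h (\<phi> b p))"
      note o = orbit_fun[OF p h]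
      have "((\<lambda>t. h (cinv d (k t))) has_derivative (\<lambda>u. coord_vector M d ?q (k' x u) h)) (at x)"
        by (rule M.coord_vector_chain[OF d h q dk[OF xT]])
      then have "((\<lambda>t. ?o (cinv c0 t)) has_derivative (\<lambda>u. coord_vector M d ?q (k' x u) h)) (at x)"
      proof (rule has_derivative_transform_within_open[OF _ T(1) xT])
        show "h (cinv d (k t)) = ?o (cinv c0 t)" if t: "t \<in> T" for t
          using chart_carrier[OF c0(1) subsetD[OF T(3) t]] by (simp add: Fk[OF t] zero_off_def points_N)
      qed
      then have "coord_vector M d ?q (k' x u) h = coord_vector N c0 ?a u ?o"
        using N.coord_vector_apply_eq[OF o, where c = c0 and q = ?a] by (simp add: a(3))
      also have "\<dots> = frechet_derivative (\<lambda>t. ?o (?a \<otimes> cinv c0 t)) (at ?x0) w"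
        unfolding w by (rule R_fund_apply[OF a(1) o])
      also have "\<dots> = coord_vector M d ?q (D x (k' ?x0 w)) h"
      proof -
        have k2x: "k2 (x, k ?x0) = cmap d ?q" by (simp add: k2_def k0 M.cinv_cmap[OF d pd])
        have "((\<lambda>y. k2 (x, y)) has_derivative D x) (at (k ?x0))" using dk2[OF x] by (simp add: k0)
        from diff_chain_at[OF dk[OF T(2)] this]
        have "((\<lambda>t. k2 (x, k t)) has_derivative (\<lambda>w. D x (k' ?x0 w))) (at ?x0)" by (simp add: comp_def)
        then have der: "((\<lambda>t. h (cinv d (k2 (x, k t)))) has_derivative (\<lambda>w. coord_vector M d ?q (D x (k' ?x0 w)) h)) (at ?x0)"
          by (rule M.coord_vector_chain[OF d h q(1), rotated]) (simp add: k2x)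
        have contk: "continuous_on T (\<lambda>t. (x, k t))"
          by (intro continuous_intros smooth_on_continuous_on[OF k])
        have op: "open (T \<inter> (\<lambda>t. (x, k t)) -` T2)" by (rule continuous_open_preimage[OF contk T(1) T2(1)])
        have mem: "?x0 \<in> T \<inter> (\<lambda>t. (x, k t)) -` T2" using T(2) xT2 by (simp add: k0)
        from der have "((\<lambda>t. ?o (?a \<otimes> cinv c0 t)) has_derivative (\<lambda>w. coord_vector M d ?q (D x (k' ?x0 w)) h)) (at ?x0)"
        proof (rule has_derivative_transform_within_open[OF _ op mem])
          fix t assume t: "t \<in> T \<inter> (\<lambda>t. (x, k t)) -` T2"
          then have tT: "t \<in> T" and tT2: "(x, k t) \<in> T2" by auto
          have g: "cinv c0 t \<in> carrier G" using chart_carrier[OF c0(1) subsetD[OF T(3) tT]] .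
          have "cinv d (k2 (x, k t)) = ?F2 (x, k t)"
            unfolding k2_def by (rule M.cinv_cmap[OF d T2d[OF tT2]])
          then show "h (cinv d (k2 (x, k t))) = ?o (?a \<otimes> cinv c0 t)"
            using g a(1) by (simp add: Fk[OF tT] zero_off_def points_N action_mult p)
        qed
        from frechet_derivative_eqI[OF this] show ?thesis by simp
      qed
      finally show "coord_vector M d ?q (k' x u) h = coord_vector M d ?q (D x (k' ?x0 w)) h" .
    qed
    from M.coord_vector_inj[OF d q(1) this] show ?thesis by blast
  qed
  have dkS: "(k has_derivative k' x) (at x)" if "x \<in> S" for x using dk that by (simp add: S_def)
  have contS: "continuous_on S (\<lambda>x. k' x u)" for u
    unfolding k'_def
    by (rule continuous_on_subset[OF smooth_on_continuous_on[OF smooth_on_frechet_derivative[OF k]]])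
      (simp add: S_def)
  obtain U where U: "open U" "?x0 \<in> U" "U \<subseteq> S" "interior (k ` U) = {}"
    by (rule constant_rank_image_interior_empty[OF S dkS contS nonsurj A1 A2 A3 sub]) (assumption, assumption, assumption, rule that, assumption+)
  obtain r where r: "r > 0" "cball ?x0 r \<subseteq> U" using U(1,2) open_contains_cball by blast
  have rT: "cball ?x0 r \<subseteq> T" using r(2) U(3) by (auto simp: S_def)
  have im: "?F ` cball ?x0 r = cinv d ` k ` cball ?x0 r"
    unfolding image_image using Fk rT by (intro image_cong) auto
  have kd: "k ` cball ?x0 r \<subseteq> cim d" using Td rT by (auto simp: k_def)
  show thesis
  proof (rule that[OF r(1)])
    show "cball ?x0 r \<subseteq> cim c0" using rT T(3) by blast
    have "compact (k ` cball ?x0 r)"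
      by (rule compact_continuous_image[OF continuous_on_subset[OF smooth_on_continuous_on[OF k] rT]]) simp
    then show "closedin (mtop M) (?F ` cball ?x0 r)" unfolding im by (rule M.closedin_cinv_image[OF d _ kd])
    fix V assume V: "openin (mtop M) V" "V \<subseteq> ?F ` cball ?x0 r"
    show "V = {}"
    proof (rule ccontr)
      assume "V \<noteq> {}"
      then obtain q where qV: "q \<in> V" by blast
      have VF: "\<exists>x \<in> cball ?x0 r. q = ?F x" if "q \<in> V" for q using V(2) that by blast
      have "cmap d ` (cdom d \<inter> V) \<subseteq> k ` U"
      proof
        fix y assume "y \<in> cmap d ` (cdom d \<inter> V)"
        then obtain q where "q \<in> V" "y = cmap d q" by blast
        then obtain x where "x \<in> cball ?x0 r" "y = k x" using VF[of q] by (auto simp: k_def)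
        then show "y \<in> k ` U" using r(2) by blast
      qed
      then have "cmap d ` (cdom d \<inter> V) \<subseteq> interior (k ` U)"
        using interior_maximal M.open_cmap_image[OF d V(1)] by blast
      moreover have "q \<in> cdom d" using VF[OF qV] Td rT by blast
      ultimately show False using qV U(4) by blast
    qed
  qed
qed

lemma fund_span:
  assumes trans: "transitive_action G (points M) \<phi>" and compact: "compact_space (mtop N)"
    and p: "p \<in> points M" and v: "v \<in> tangent_space M p"
  shows "\<exists>w. v = A.fund w p"
proof (rule ccontr)
  assume "\<nexists>w. v = A.fund w p"
  then have ns: "v \<noteq> A.fund w p" for w by blast
  let ?x0 = "cmap c0 \<one>"
  obtain r where r: "r > 0" "cball ?x0 r \<subseteq> cim c0"
    and cl: "closedin (mtop M) ((\<lambda>x. \<phi> (cinv c0 x) p) ` cball ?x0 r)"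
    and nd: "\<And>V. openin (mtop M) V \<Longrightarrow> V \<subseteq> (\<lambda>x. \<phi> (cinv c0 x) p) ` cball ?x0 r \<Longrightarrow> V = {}"
    by (rule nowhere_dense_orbit_piece[OF p v ns]) (rule that, assumption+)
  define B where "B = (\<lambda>x. \<phi> (cinv c0 x) p) ` cball ?x0 r"
  have BM: "B \<subseteq> points M" using cl closedin_subset by (auto simp: B_def)
  define Q where "Q = {a \<in> cdom c0. cmap c0 a \<in> ball ?x0 r}"
  have Q: "openin (mtop N) Q" "\<one> \<in> Q"
    using N.openin_cmap_preimage[OF c0(1) open_ball] c0(2) r(1) by (auto simp: Q_def)
  have QB: "\<phi> a p \<in> B" if "a \<in> Q" for a
    unfolding B_def using that N.cinv_cmap[OF c0(1)] by (intro image_eqI[of _ _ "cmap c0 a"]) (auto simp: Q_def)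
  \<comment> \<open>The left translate of \<open>Q\<close> by \<open>a\<close>, written as a
    preimage so that openness follows from continuity.\<close>
  define Qa where "Qa a = {b \<in> points N. inv a \<otimes> b \<in> Q}" for a
  have Qa: "openin (mtop N) (Qa a)" if "a \<in> carrier G" for a
    unfolding Qa_def by (rule openin_continuous_map_preimage[OF continuous_translation Q(1)]) (use that in simp)
  have "points N \<subseteq> \<Union>(Qa ` carrier G)"
    using Q(2) by (auto simp: Qa_def points_N)
  then obtain \<F> where "finite \<F>" "\<F> \<subseteq> Qa ` carrier G" "points N \<subseteq> \<Union>\<F>"
    using compact Qa unfolding compact_space_def compactin_def by (metis (no_types, lifting) imageE)
  then obtain I where I: "finite I" "I \<subseteq> carrier G" "points N \<subseteq> \<Union>(Qa ` I)"
    by (metis finite_subset_image)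
  \<comment> \<open>The translate of \<open>B\<close> by \<open>a\<close>, again as a preimage: this
    gives closedness. It has no interior because \<open>\<phi> a\<close> is a homeomorphism.\<close>
  define C where "C a = {q \<in> points M. \<phi> (inv a) q \<in> B}" for a
  have "points M = {}"
  proof (rule open_subset_finite_union_nowhere_dense[of "C ` I" "mtop M"])
    show "finite (C ` I)" using I(1) by simp
    show "closedin (mtop M) T" if T: "T \<in> C ` I" for T
    proof -
      obtain a where a: "a \<in> carrier G" "T = C a" using T I(2) by blast
      show ?thesis unfolding a(2) C_def
        by (rule closedin_continuous_map_preimage[OF continuous_action cl[folded B_def]]) (use a(1) in simp)
    qed
    show "V = {}" if T: "T \<in> C ` I" and V: "openin (mtop M) V" "V \<subseteq> T" for T V
    proof -
      obtain a where a: "a \<in> carrier G" "T = C a" using T I(2) by blast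
      let ?W = "{q \<in> points M. \<phi> a q \<in> V}"
      have "openin (mtop M) ?W" by (rule openin_continuous_map_preimage[OF continuous_action[OF a(1)] V(1)])
      moreover have "?W \<subseteq> B"
      proof
        fix q assume "q \<in> ?W"
        then have q: "q \<in> points M" "\<phi> (inv a) (\<phi> a q) \<in> B" using V(2) a(2) by (auto simp: C_def)
        then show "q \<in> B" using action_inv[OF a(1) q(1)] by simp
      qed
      ultimately have W: "?W = {}" unfolding B_def by (rule nd)
      show "V = {}"
      proof (rule ccontr)
        assume "V \<noteq> {}"
        then obtain q where q: "q \<in> V" by blast
        then have qM: "q \<in> points M" using openin_subset[OF V(1)] by blast
        have "\<phi> a (\<phi> (inv a) q) = q" using action_inv[of "inv a" q] a(1) qM by simp
        then have "\<phi> (inv a) q \<in> ?W" using q qM a(1) action_in by simp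
        then show False using W by blast
      qed
    qed
    show "openin (mtop M) (points M)" by simp
    show "points M \<subseteq> \<Union>(C ` I)"
    proof
      fix q assume q: "q \<in> points M"
      obtain b where b: "b \<in> carrier G" "\<phi> b p = q"
        using transitive_action.unique_orbit[OF trans p q] by blast
      then obtain a where a: "a \<in> I" "b \<in> Qa a" using I(3) points_N by blast
      have aG: "a \<in> carrier G" using a(1) I(2) by blast
      have "\<phi> (inv a) q = \<phi> (inv a \<otimes> b) p" using b aG p by (simp add: action_mult)
      also have "\<dots> \<in> B" using QB a(2) by (simp add: Qa_def)
      finally show "q \<in> \<Union>(C ` I)" using a(1) q by (auto simp: C_def)
    qed
  qed
  then show False using p by simp
qed

end

section \<open>Homogeneous locally conformally Kaehler manifolds\<close>

lemma scaleR_fun_apply: "(a *\<^sub>R f) x = a *\<^sub>R f x"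
  by (simp add: scaleR_fun_def)

lemma zero_off_in: "p \<in> points M \<Longrightarrow> zero_off M f p = f p"
  and zero_off_out: "p \<notin> points M \<Longrightarrow> zero_off M f p = 0"
  by (simp_all add: zero_off_def)

text \<open>The space \<open>V\<close> is a set of functions not known in advance to be
  finite-dimensional, and \<open>f\<close> is linear on \<open>V\<close> alone. A basis of
  \<open>V\<close> is therefore transported by a linear map \<open>g\<close> agreeing with
  \<open>f\<close> on it; independence of the image in the Euclidean space bounds its size.\<close>

lemma dim_le_of_injective:
  fixes V :: "'a::real_vector set" and f :: "'a \<Rightarrow> 'c::euclidean_space"
  assumes V: "subspace V" and f: "linear_on_subspace V f" and inj: "\<And>x. x \<in> V \<Longrightarrow> f x = 0 \<Longrightarrow> x = 0"
  shows "dim V \<le> DIM('c)"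
proof -
  obtain B where B: "B \<subseteq> V" "independent B" "V \<subseteq> span B" "card B = dim V"
    using basis_exists by blast
  have sp: "span B \<subseteq> V" using B(1) V by (simp add: span_minimal)
  obtain g where g: "linear g" "\<And>x. x \<in> B \<Longrightarrow> g x = f x"
    using linear_independent_extend[OF B(2)] by blast
  have f0: "f 0 = 0"
  proof -
    have "f (0 *\<^sub>R 0) = 0 *\<^sub>R f 0" using f subspace_0[OF V] unfolding linear_on_subspace_def by blast
    then show ?thesis by simp
  qed
  have fg': "x \<in> V \<and> f x = g x" if "x \<in> span B" for x
    using that
  proof (induction rule: span_induct_alt)
    case base
    then show ?case using f0 linear_0[OF g(1)] subspace_0[OF V] by simp
  next
    case (step c x y)
    then have xy: "x \<in> V" "y \<in> V" "c *\<^sub>R x \<in> V" using B(1) subspace_scale[OF V] by auto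
    then have "f (c *\<^sub>R x + y) = c *\<^sub>R f x + f y" using f unfolding linear_on_subspace_def by metis
    then show ?case using step g(2) subspace_add[OF V xy(3,2)] by (simp add: linear_add[OF g(1)] linear_scale[OF g(1)])
  qed
  then have fg: "f x = g x" if "x \<in> span B" for x using that by blast
  have inj_g: "inj_on g (span B)"
  proof (rule inj_onI)
    fix x y assume x: "x \<in> span B" and y: "y \<in> span B" and eq: "g x = g y"
    have xy: "x - y \<in> span B" using x y by (rule span_diff)
    have "f (x - y) = 0" using fg[OF xy] eq by (simp add: linear_diff[OF g(1)])
    then show "x = y" using inj[of "x - y"] xy sp by auto
  qed
  have "independent (g ` B)" by (rule linear_independent_injective_image[OF g(1) B(2) inj_g])
  then have "card (g ` B) \<le> DIM('c)" using independent_bound by blast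
  moreover have "card (g ` B) = card B"
    by (rule card_image) (rule inj_on_subset[OF inj_g span_superset])
  ultimately show ?thesis using B(4) by simp
qed

lemma nontrivial_kernel:
  fixes f :: "'a::euclidean_space \<Rightarrow> 'c::euclidean_space"
  assumes f: "linear f" and less: "DIM('c) < DIM('a)"
  obtains x where "x \<noteq> 0" "f x = 0"
proof -
  have "\<not> inj f"
  proof
    assume "inj f"
    then have "dim (f ` UNIV) = dim (UNIV :: 'a set)"
      by (intro dim_image_eq[OF f]) (simp add: span_UNIV)
    then show False using dim_subset_UNIV[of "range f"] less by (simp add: dim_UNIV)
  qed
  then show thesis using that linear_injective_0[OF f] by blast
qed

context smooth_mfd
begin

lemma smooth_funs_continuous:
  assumes f: "f \<in> smooth_funs M"
  shows "continuous_map (mtop M) euclideanreal f"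
  unfolding continuous_map_def
proof (intro conjI allI impI)
  fix W :: "real set" assume "openin euclideanreal W"
  then have W: "open W" by simp
  show "openin (mtop M) {p \<in> points M. f p \<in> W}"
  proof (subst openin_subopen, intro ballI)
    fix p assume "p \<in> {p \<in> points M. f p \<in> W}"
    then have p: "p \<in> points M" "f p \<in> W" by auto
    obtain c where c: "c \<in> matlas M" "p \<in> cdom c" using chart_at[OF p(1)] .
    let ?V = "cim c \<inter> (\<lambda>x. f (cinv c x)) -` W"
    have V: "open ?V"
      by (rule continuous_open_preimage[OF smooth_on_continuous_on[OF smooth_funsD(2)[OF f c(1)]] open_cim[OF c(1)] W])
    let ?T = "{q \<in> cdom c. cmap c q \<in> ?V}"
    have "openin (mtop M) ?T" by (rule openin_cmap_preimage[OF c(1) V])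
    moreover have "p \<in> ?T" using c p by (simp add: cinv_cmap)
    moreover have "?T \<subseteq> {p \<in> points M. f p \<in> W}"
    proof
      fix q assume "q \<in> ?T"
      then have "q \<in> cdom c" "f (cinv c (cmap c q)) \<in> W" by simp_all
      then show "q \<in> {p \<in> points M. f p \<in> W}" using cdom_subset[OF c(1)] cinv_cmap[OF c(1)] by simp
    qed
    ultimately show "\<exists>T. openin (mtop M) T \<and> p \<in> T \<and> T \<subseteq> {p \<in> points M. f p \<in> W}" by blast
  qed
qed simp

lemma tangent_zero_at_extremum:
  assumes f: "f \<in> smooth_funs M" and p: "p \<in> points M"
    and ext: "(\<forall>q\<in>points M. f q \<le> f p) \<or> (\<forall>q\<in>points M. f p \<le> f q)" and v: "v \<in> tangent_space M p"
  shows "v f = 0"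
proof -
  obtain c where c: "c \<in> matlas M" "p \<in> cdom c" using chart_at[OF p] .
  obtain w where w: "v = coord_vector M c p w" using tangent_coord_vector[OF c v] .
  have q: "cinv c x \<in> points M" if "x \<in> cim c" for x using cdom_subset[OF c(1) cinv_in[OF that]] .
  have "(\<forall>x\<in>cim c. f (cinv c x) \<le> f (cinv c (cmap c p))) \<or> (\<forall>x\<in>cim c. f (cinv c (cmap c p)) \<le> f (cinv c x))"
    unfolding cinv_cmap[OF c] using ext q by blast
  then have "frechet_derivative (\<lambda>x. f (cinv c x)) (at (cmap c p)) = (\<lambda>v. 0)"
    by (rule differential_zero_maxmin[OF imageI[OF c(2)] open_cim[OF c(1)] chart_has_derivative[OF c f]])
  then show ?thesis by (simp add: w coord_vector_apply[OF f])
qed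

lemma attains_extrema:
  assumes f: "f \<in> smooth_funs M" and comp: "compact_space (mtop M)" and ne: "points M \<noteq> {}"
  shows "\<exists>p\<in>points M. \<forall>q\<in>points M. f q \<le> f p" and "\<exists>p\<in>points M. \<forall>q\<in>points M. f p \<le> f q"
proof -
  have "compactin euclideanreal (f ` points M)"
    by (rule image_compactin[OF _ smooth_funs_continuous[OF f]]) (use comp in \<open>simp add: compact_space_def\<close>)
  then have K: "compact (f ` points M)" "f ` points M \<noteq> {}" using ne by auto
  show "\<exists>p\<in>points M. \<forall>q\<in>points M. f q \<le> f p" using compact_attains_sup[OF K] by blast
  show "\<exists>p\<in>points M. \<forall>q\<in>points M. f p \<le> f q" using compact_attains_inf[OF K] by blast
qed

end

locale lck_action = lie_action +
  fixes g :: "'d form2" and J :: "'d endo" and \<theta> :: "'d form1"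
  assumes hermitian: "hermitian_manifold M g J" and closed: "closed_1form M \<theta>"
    and lck: "\<And>X Y Z. X \<in> vector_fields M \<Longrightarrow> Y \<in> vector_fields M \<Longrightarrow> Z \<in> vector_fields M \<Longrightarrow>
      ext_deriv2 M (fundamental_form g J) X Y Z = - 2 *\<^sub>R wedge12 M \<theta> (fundamental_form g J) X Y Z"
    and compact_M: "compact_space (mtop M)" and not_kaehler: "\<not> kaehler_manifold M g J"
    and compact_N: "compact_space (mtop N)" and connected_N: "connected_space (mtop N)"
    and faithful: "faithful_action G (points M) \<phi>" and transitive: "transitive_action G (points M) \<phi>"
    and metric: "preserves_metric G M \<phi> g" and endo: "preserves_endo G M \<phi> J"
begin

abbreviation \<omega> where "\<omega> \<equiv> fundamental_form g J"

abbreviation T where "T \<equiv> tangent_space M"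

section \<open>Pointwise algebra of the fundamental form and the Lee form\<close>

lemma J_in: "p \<in> points M \<Longrightarrow> v \<in> T p \<Longrightarrow> J p v \<in> T p"
  and J_J: "p \<in> points M \<Longrightarrow> v \<in> T p \<Longrightarrow> J p (J p v) = - v"
  and J_linear: "p \<in> points M \<Longrightarrow> linear_on_subspace (T p) (J p)"
  using hermitian by (auto simp: hermitian_manifold_def almost_complex_structure_def)

lemma g_bilinear: "smooth_bilinear M g"
  and g_sym: "p \<in> points M \<Longrightarrow> u \<in> T p \<Longrightarrow> v \<in> T p \<Longrightarrow> g p u v = g p v u"
  and g_pos: "p \<in> points M \<Longrightarrow> u \<in> T p \<Longrightarrow> u \<noteq> 0 \<Longrightarrow> g p u u > 0"
  using hermitian by (auto simp: hermitian_manifold_def riemannian_metric_def)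

lemma g_skew: "p \<in> points M \<Longrightarrow> u \<in> T p \<Longrightarrow> v \<in> T p \<Longrightarrow> g p (J p u) v = - g p u (J p v)"
  using hermitian by (simp add: hermitian_manifold_def)

lemma \<omega>_smooth: "smooth_bilinear M \<omega>"
  unfolding smooth_bilinear_def
proof (intro conjI ballI)
  fix p u assume p: "p \<in> points M" and u: "u \<in> T p"
  have g1: "linear_on_subspace (T p) (\<lambda>v. g p u v)" "linear_on_subspace (T p) (\<lambda>v. g p v u)" if "u \<in> T p" for u
    using g_bilinear p that by (auto simp: smooth_bilinear_def)
  show "linear_on_subspace (T p) (\<lambda>v. \<omega> p u v)" using g1(1)[OF J_in[OF p u]] by (simp add: fundamental_form_def)
  show "linear_on_subspace (T p) (\<lambda>v. \<omega> p v u)"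
    using g1(2)[OF u] J_linear[OF p] J_in[OF p] unfolding linear_on_subspace_def fundamental_form_def by simp
next
  fix X Y assume X: "X \<in> vector_fields M" and Y: "Y \<in> vector_fields M"
  have "zero_off M (\<lambda>p. J p (X p)) \<in> vector_fields M"
    using hermitian X by (simp add: hermitian_manifold_def almost_complex_structure_def)
  moreover have "eval2 M \<omega> X Y = eval2 M g (zero_off M (\<lambda>p. J p (X p))) Y"
    by (auto simp: eval2_def zero_off_def fundamental_form_def)
  ultimately show "eval2 M \<omega> X Y \<in> smooth_funs M" using g_bilinear Y by (simp add: smooth_bilinear_def)
qed

lemma \<omega>_add:
  assumes "p \<in> points M" "u \<in> T p" "v \<in> T p" "w \<in> T p"
  shows "\<omega> p (u + v) w = \<omega> p u w + \<omega> p v w" "\<omega> p w (u + v) = \<omega> p w u + \<omega> p w v"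
  using \<omega>_smooth assms unfolding smooth_bilinear_def linear_on_subspace_def by auto

lemma \<omega>_scaleR:
  assumes "p \<in> points M" "u \<in> T p" "w \<in> T p"
  shows "\<omega> p (a *\<^sub>R u) w = a * \<omega> p u w" "\<omega> p w (a *\<^sub>R u) = a * \<omega> p w u"
  using \<omega>_smooth assms unfolding smooth_bilinear_def linear_on_subspace_def by auto

lemma \<omega>_zero:
  assumes "p \<in> points M" "w \<in> T p"
  shows "\<omega> p 0 w = 0" "\<omega> p w 0 = 0"
proof -
  have z: "(0::'d tvec) = 0 *\<^sub>R 0" by simp
  show "\<omega> p 0 w = 0" by (subst z, subst \<omega>_scaleR(1)[OF assms(1) M.tangent_zero assms(2)]) simp
  show "\<omega> p w 0 = 0" by (subst z, subst \<omega>_scaleR(2)[OF assms(1) M.tangent_zero assms(2)]) simp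
qed

lemma \<omega>_antisym: "p \<in> points M \<Longrightarrow> u \<in> T p \<Longrightarrow> v \<in> T p \<Longrightarrow> \<omega> p u v = - \<omega> p v u"
  using g_skew[of p u v] g_sym[of p u "J p v"] J_in by (simp add: fundamental_form_def)

lemma \<omega>_self: "p \<in> points M \<Longrightarrow> u \<in> T p \<Longrightarrow> \<omega> p u u = 0"
  using \<omega>_antisym[of p u u] by simp

text \<open>The value is \<open>g p (J p u) (J p u)\<close>, and \<open>J p u\<close> is nonzero
  because \<open>J p\<close> squares to -1. This is the nondegeneracy of \<omega> in the form used
  below.\<close>

lemma \<omega>_pos:
  assumes p: "p \<in> points M" and u: "u \<in> T p" "u \<noteq> 0"
  shows "\<omega> p u (J p u) > 0"
proof -
  have "J p u \<noteq> 0"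
  proof
    assume 0: "J p u = 0"
    have "J p (0 *\<^sub>R u) = 0 *\<^sub>R J p u" using J_linear[OF p] u(1) unfolding linear_on_subspace_def by blast
    then have "J p 0 = 0" by simp
    then show False using J_J[OF p u(1)] 0 u(2) by simp
  qed
  then show ?thesis using g_pos[OF p J_in[OF p u(1)]] by (simp add: fundamental_form_def)
qed

lemma \<theta>_smooth: "smooth_1form M \<theta>"
  using closed by (simp add: closed_1form_def)

lemma \<theta>_add: "p \<in> points M \<Longrightarrow> u \<in> T p \<Longrightarrow> v \<in> T p \<Longrightarrow> \<theta> p (u + v) = \<theta> p u + \<theta> p v"
  and \<theta>_scaleR: "p \<in> points M \<Longrightarrow> u \<in> T p \<Longrightarrow> \<theta> p (a *\<^sub>R u) = a * \<theta> p u"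
  using \<theta>_smooth unfolding smooth_1form_def linear_on_subspace_def by auto

definition wedge :: "'d \<Rightarrow> 'd tvec \<Rightarrow> 'd tvec \<Rightarrow> 'd tvec \<Rightarrow> real" where
  "wedge p u v w = \<theta> p u * \<omega> p v w - \<theta> p v * \<omega> p u w + \<theta> p w * \<omega> p u v"

lemma wedge12_apply: "p \<in> points M \<Longrightarrow> wedge12 M \<theta> \<omega> X Y Z p = wedge p (X p) (Y p) (Z p)"
  by (simp add: wedge12_def wedge_def eval1_def eval2_def zero_off_def)

lemma ext_deriv2_apply:
  assumes "X \<in> vector_fields M" "Y \<in> vector_fields M" "Z \<in> vector_fields M" "p \<in> points M"
  shows "ext_deriv2 M \<omega> X Y Z p = - 2 * wedge p (X p) (Y p) (Z p)"
  using lck[OF assms(1-3)] wedge12_apply[OF assms(4)] by (simp add: scaleR_fun_def)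

lemma wedge_dependent:
  assumes p: "p \<in> points M" and uvw: "u \<in> T p" "v \<in> T p" "w \<in> T p"
    and dep: "a *\<^sub>R u + b *\<^sub>R v + c *\<^sub>R w = 0" and nz: "a \<noteq> 0 \<or> b \<noteq> 0 \<or> c \<noteq> 0"
  shows "wedge p u v w = 0"
proof -
  note sc = M.tangent_scaleR
  have lin: "\<omega> p (a *\<^sub>R u + b *\<^sub>R v + c *\<^sub>R w) x = a * \<omega> p u x + b * \<omega> p v x + c * \<omega> p w x" if x: "x \<in> T p" for x
    by (simp add: \<omega>_add[OF p] \<omega>_scaleR[OF p] uvw sc M.tangent_add x)
  have th: "a * \<theta> p u + b * \<theta> p v + c * \<theta> p w = 0"
  proof -
    have "\<theta> p (a *\<^sub>R u + b *\<^sub>R v + c *\<^sub>R w) = a * \<theta> p u + b * \<theta> p v + c * \<theta> p w"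
      by (simp add: \<theta>_add[OF p] \<theta>_scaleR[OF p] uvw sc M.tangent_add)
    moreover have "\<theta> p 0 = 0" using \<theta>_scaleR[OF p M.tangent_zero, of 0] by simp
    ultimately show ?thesis using dep by simp
  qed
  have e1: "b * \<omega> p v u + c * \<omega> p w u = 0" and e2: "a * \<omega> p u v + c * \<omega> p w v = 0"
    and e3: "a * \<omega> p u w + b * \<omega> p v w = 0"
    using lin[OF uvw(1)] lin[OF uvw(2)] lin[OF uvw(3)] dep
    by (simp_all add: \<omega>_zero[OF p] uvw \<omega>_self[OF p])
  have as: "\<omega> p v u = - \<omega> p u v" "\<omega> p w u = - \<omega> p u w" "\<omega> p w v = - \<omega> p v w"
    by (rule \<omega>_antisym[OF p uvw(2,1)], rule \<omega>_antisym[OF p uvw(3,1)], rule \<omega>_antisym[OF p uvw(3,2)])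
  \<comment> \<open>For the first: \<open>e2\<close> and \<open>e3\<close> express
    \<open>a * \<omega> p u v\<close> and \<open>a * \<omega> p u w\<close> through
    \<open>\<omega> p v w\<close>, which turns the left-hand side into the form in \<open>th\<close>
    times \<open>\<omega> p v w\<close>. The others are alike.\<close>
  have "a * wedge p u v w = 0" "b * wedge p u v w = 0" "c * wedge p u v w = 0"
    unfolding wedge_def using th e1 e2 e3 unfolding as by algebra+
  then show ?thesis using nz by auto
qed

text \<open>Not being Kaehler provides fields with d\<omega> \<noteq> 0, and there \<theta> \<and>
  \<omega> is nonzero. The lemma is also the source of a point of \<open>M\<close>.\<close>

lemma wedge_nonzero_somewhere:
  obtains X Y Z p where "X \<in> vector_fields M" "Y \<in> vector_fields M" "Z \<in> vector_fields M" "p \<in> points M"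
    "wedge p (X p) (Y p) (Z p) \<noteq> 0"
proof -
  obtain X Y Z where X: "X \<in> vector_fields M" and Y: "Y \<in> vector_fields M" and Z: "Z \<in> vector_fields M"
    and "ext_deriv2 M \<omega> X Y Z \<noteq> 0"
    using not_kaehler hermitian unfolding kaehler_manifold_def by blast
  then have "wedge12 M \<theta> \<omega> X Y Z \<noteq> 0" using lck[OF X Y Z] by auto
  then obtain p where p: "wedge12 M \<theta> \<omega> X Y Z p \<noteq> 0" by (auto simp: fun_eq_iff)
  then have "p \<in> points M" by (auto simp: wedge12_def eval1_def eval2_def zero_off_def split: if_splits)
  then show thesis using that[OF X Y Z] p wedge12_apply by simp
qed

text \<open>A 3-form vanishes on dependent vectors, so d\<omega> \<noteq> 0 needs three independent
  ones. The bound is what leaves a nonzero common kernel of two functionals in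
  \<open>wedge_injective\<close>.\<close>

lemma dimension: "DIM('e) > 2"
proof (rule ccontr)
  assume "\<not> DIM('e) > 2"
  then have small: "DIM('e) < DIM(real \<times> real \<times> real)" by simp
  obtain X Y Z p where X: "X \<in> vector_fields M" and Y: "Y \<in> vector_fields M" and Z: "Z \<in> vector_fields M"
    and p: "p \<in> points M" and nz: "wedge p (X p) (Y p) (Z p) \<noteq> 0"
    by (rule wedge_nonzero_somewhere)
  note t = M.vector_fieldD(1)[OF X p] M.vector_fieldD(1)[OF Y p] M.vector_fieldD(1)[OF Z p]
  obtain c where c: "c \<in> matlas M" "p \<in> cdom c" using M.chart_at[OF p] .
  obtain x where x: "X p = coord_vector M c p x" using M.tangent_coord_vector[OF c t(1)] .
  obtain y where y: "Y p = coord_vector M c p y" using M.tangent_coord_vector[OF c t(2)] .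
  obtain z where z: "Z p = coord_vector M c p z" using M.tangent_coord_vector[OF c t(3)] .
  have "linear (\<lambda>k::real \<times> real \<times> real. fst k *\<^sub>R x + fst (snd k) *\<^sub>R y + snd (snd k) *\<^sub>R z)"
    by (intro linearI) (auto simp: algebra_simps)
  then obtain k :: "real \<times> real \<times> real" where k: "k \<noteq> 0" "fst k *\<^sub>R x + fst (snd k) *\<^sub>R y + snd (snd k) *\<^sub>R z = 0"
    using nontrivial_kernel[OF _ small] by blast
  have "fst k *\<^sub>R X p + fst (snd k) *\<^sub>R Y p + snd (snd k) *\<^sub>R Z p
      = coord_vector M c p (fst k *\<^sub>R x + fst (snd k) *\<^sub>R y + snd (snd k) *\<^sub>R z)"
    by (simp only: M.coord_vector_linear[OF c] x y z)
  also have "\<dots> = 0" using M.coord_vector_linear(2)[OF c, of 0 0] by (simp add: k(2))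
  finally have "wedge p (X p) (Y p) (Z p) = 0"
    by (rule wedge_dependent[OF p t]) (use k(1) in \<open>auto simp: prod_eq_iff\<close>)
  then show False using nz by simp
qed

text \<open>Nondegeneracy of \<open>\<omega>\<close>: a 1-form \<open>\<beta>\<close> with \<open>\<beta> \<and> \<omega> = 0\<close> is evaluated on \<open>(u, v, J v)\<close>
  with \<open>v\<close> in the kernels of \<open>\<beta>\<close> and \<open>\<beta> \<circ> J\<close>.\<close>

lemma wedge_injective:
  assumes q: "q \<in> points M" and \<beta>: "linear_on_subspace (T q) \<beta>"
    and zero: "\<And>u v w. u \<in> T q \<Longrightarrow> v \<in> T q \<Longrightarrow> w \<in> T q \<Longrightarrow>
      \<beta> u * \<omega> q v w - \<beta> v * \<omega> q u w + \<beta> w * \<omega> q u v = (0::real)"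
    and u: "u \<in> T q"
  shows "\<beta> u = 0"
proof -
  obtain c where c: "c \<in> matlas M" "q \<in> cdom c" using M.chart_at[OF q] .
  let ?v = "coord_vector M c q"
  note vt = M.coord_vector_tangent[OF c]
  have "linear (\<lambda>x. (\<beta> (?v x), \<beta> (J q (?v x))))"
  proof (rule linearI)
    show "(\<beta> (?v (x + y)), \<beta> (J q (?v (x + y)))) = (\<beta> (?v x), \<beta> (J q (?v x))) + (\<beta> (?v y), \<beta> (J q (?v y)))" for x y
      using \<beta> J_linear[OF q] vt J_in[OF q vt] unfolding M.coord_vector_linear[OF c] linear_on_subspace_def by simp
    show "(\<beta> (?v (a *\<^sub>R x)), \<beta> (J q (?v (a *\<^sub>R x)))) = a *\<^sub>R (\<beta> (?v x), \<beta> (J q (?v x)))" for a x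
      using \<beta> J_linear[OF q] vt J_in[OF q vt] unfolding M.coord_vector_linear[OF c] linear_on_subspace_def by simp
  qed
  then obtain x where x: "x \<noteq> 0" "(\<beta> (?v x), \<beta> (J q (?v x))) = 0"
    by (rule nontrivial_kernel) (use dimension in simp)
  have "?v x \<noteq> 0"
  proof
    assume "?v x = 0"
    then have "?v x = ?v 0" using M.coord_vector_linear(2)[OF c, of 0 0] by simp
    then show False using M.coord_vector_inj[OF c] x(1) by blast
  qed
  then have "\<omega> q (?v x) (J q (?v x)) > 0" by (rule \<omega>_pos[OF q vt])
  moreover have "\<beta> u * \<omega> q (?v x) (J q (?v x)) = 0"
    using zero[OF u vt J_in[OF q vt], of x x] x(2) by (simp add: zero_prod_def)
  ultimately show ?thesis by simp
qed

section \<open>Invariance of the forms and naturality of the exterior derivative\<close>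

lemma differential_inv:
  assumes a: "a \<in> carrier G" and p: "p \<in> points M" and u: "u \<in> T (\<phi> a p)"
  shows "differential M M (\<phi> (inv a)) u \<in> T p"
  using action_tangent[OF inv_closed[OF a] action_in[OF a p] u] action_inv[OF a p] by simp

lemma \<omega>_invariant:
  assumes a: "a \<in> carrier G" and p: "p \<in> points M" and u: "u \<in> T (\<phi> a p)" and v: "v \<in> T (\<phi> a p)"
  shows "\<omega> p (differential M M (\<phi> (inv a)) u) (differential M M (\<phi> (inv a)) v) = \<omega> (\<phi> a p) u v"
proof -
  note q = action_in[OF a p] and ia = inv_closed[OF a]
  have "differential M M (\<phi> (inv a)) (J (\<phi> a p) u) = J p (differential M M (\<phi> (inv a)) u)"
    using endo q ia u action_inv[OF a p] unfolding preserves_endo_def by metis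
  moreover have "g p (differential M M (\<phi> (inv a)) (J (\<phi> a p) u)) (differential M M (\<phi> (inv a)) v) = g (\<phi> a p) (J (\<phi> a p) u) v"
    using metric q ia J_in[OF q u] v action_inv[OF a p] unfolding preserves_metric_def by metis
  ultimately show ?thesis by (simp add: fundamental_form_def)
qed

text \<open>Unlike \<open>A.pull\<close>, this is available for every group element and not just for
  those in the chart \<open>c0\<close>; transporting \<theta> between arbitrary points of
  \<open>M\<close> requires that.\<close>

definition pullback :: "'a \<Rightarrow> 'd vfield \<Rightarrow> 'd vfield" where
  "pullback a X = zero_off M (\<lambda>p. differential M M (\<phi> (inv a)) (X (\<phi> a p)))"

lemma pullback_apply:
  "p \<in> points M \<Longrightarrow> f \<in> smooth_funs M \<Longrightarrow>
    pullback a X p f = X (\<phi> a p) (zero_off M (\<lambda>q. f (\<phi> (inv a) q)))"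
  by (simp add: pullback_def zero_off_def M.differential_apply)

lemma act_pullback:
  assumes f: "f \<in> smooth_funs M"
  shows "act_on_fun (pullback a X) f
    = zero_off M (\<lambda>p. act_on_fun X (zero_off M (\<lambda>q. f (\<phi> (inv a) q))) (\<phi> a p))"
proof
  fix p
  show "act_on_fun (pullback a X) f p
      = zero_off M (\<lambda>p. act_on_fun X (zero_off M (\<lambda>q. f (\<phi> (inv a) q))) (\<phi> a p)) p"
  proof (cases "p \<in> points M")
    case True
    then show ?thesis by (simp add: act_on_fun_def pullback_apply[OF _ f] zero_off_in)
  qed (simp add: act_on_fun_def pullback_def zero_off_out)
qed

lemma pullback_vector_field:
  assumes a: "a \<in> carrier G" and X: "X \<in> vector_fields M"
  shows "pullback a X \<in> vector_fields M"
  unfolding vector_fields_def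
proof (intro CollectI conjI ballI allI impI)
  show "pullback a X p \<in> T p" if p: "p \<in> points M" for p
    using differential_inv[OF a p M.vector_fieldD(1)[OF X action_in[OF a p]]] p
    by (simp add: pullback_def zero_off_def)
  show "pullback a X p = 0" if "p \<notin> points M" for p using that by (simp add: pullback_def zero_off_def)
  show "act_on_fun (pullback a X) f \<in> smooth_funs M" if f: "f \<in> smooth_funs M" for f
    unfolding act_pullback[OF f]
    by (rule translate_action[OF a M.vector_fieldD(3)[OF X translate_action[OF inv_closed[OF a] f]]])
qed

lemma pullback_composed:
  assumes a: "a \<in> carrier G" and p: "p \<in> points M" and k: "k \<in> smooth_funs M"
  shows "pullback a X p (zero_off M (\<lambda>q. k (\<phi> a q))) = X (\<phi> a p) k"
proof -
  have "zero_off M (\<lambda>q. zero_off M (\<lambda>q. k (\<phi> a q)) (\<phi> (inv a) q)) = k"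
  proof
    fix q
    show "zero_off M (\<lambda>q. zero_off M (\<lambda>q. k (\<phi> a q)) (\<phi> (inv a) q)) q = k q"
      using a action_inv[OF inv_closed[OF a], of q] M.smooth_funsD(1)[OF k] action_in[OF inv_closed[OF a]]
      by (auto simp: zero_off_def)
  qed
  then show ?thesis by (simp add: pullback_apply[OF p translate_action[OF a k]])
qed

lemma pullback_bracket:
  assumes a: "a \<in> carrier G" and X: "X \<in> vector_fields M" and Y: "Y \<in> vector_fields M" and p: "p \<in> points M"
  shows "lie_bracket (pullback a X) (pullback a Y) p = pullback a (lie_bracket X Y) p"
proof (rule M.tangent_eqI)
  note pX = pullback_vector_field[OF a X] and pY = pullback_vector_field[OF a Y]
  show "lie_bracket (pullback a X) (pullback a Y) p \<in> T p"
    by (rule M.vector_fieldD(1)[OF M.lie_bracket_vector_field[OF pX pY] p])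
  show "pullback a (lie_bracket X Y) p \<in> T p"
    by (rule M.vector_fieldD(1)[OF pullback_vector_field[OF a M.lie_bracket_vector_field[OF X Y]] p])
  fix f assume f: "f \<in> smooth_funs M"
  note f' = translate_action[OF inv_closed[OF a] f]
  show "lie_bracket (pullback a X) (pullback a Y) p f = pullback a (lie_bracket X Y) p f"
    unfolding lie_bracket_def act_pullback[OF f]
      pullback_composed[OF a p M.vector_fieldD(3)[OF X f']] pullback_composed[OF a p M.vector_fieldD(3)[OF Y f']]
    by (simp add: pullback_apply[OF p f])
qed

lemma pullback_eval2:
  assumes a: "a \<in> carrier G" and X: "X \<in> vector_fields M" and Y: "Y \<in> vector_fields M"
  shows "eval2 M \<omega> (pullback a X) (pullback a Y) = zero_off M (\<lambda>p. eval2 M \<omega> X Y (\<phi> a p))"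
proof
  fix p
  show "eval2 M \<omega> (pullback a X) (pullback a Y) p = zero_off M (\<lambda>p. eval2 M \<omega> X Y (\<phi> a p)) p"
  proof (cases "p \<in> points M")
    case p: True
    note q = action_in[OF a p]
    show ?thesis
      using \<omega>_invariant[OF a p M.vector_fieldD(1)[OF X q] M.vector_fieldD(1)[OF Y q]] p q
      by (simp add: eval2_def zero_off_def pullback_def)
  qed (simp add: eval2_def zero_off_def)
qed

text \<open>Every ingredient of the invariant formula for d\<omega> is natural: directional
  derivatives, brackets, and values of the invariant form \<omega>.\<close>

lemma pullback_ext_deriv2:
  assumes a: "a \<in> carrier G" and X: "X \<in> vector_fields M" and Y: "Y \<in> vector_fields M"
    and Z: "Z \<in> vector_fields M" and p: "p \<in> points M"
  shows "ext_deriv2 M \<omega> (pullback a X) (pullback a Y) (pullback a Z) p = ext_deriv2 M \<omega> X Y Z (\<phi> a p)"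
proof -
  have sm: "eval2 M \<omega> X Y \<in> smooth_funs M" if "X \<in> vector_fields M" "Y \<in> vector_fields M" for X Y
    using \<omega>_smooth that by (simp add: smooth_bilinear_def)
  have act: "act_on_fun (pullback a X) (eval2 M \<omega> (pullback a Y) (pullback a Z)) p
      = act_on_fun X (eval2 M \<omega> Y Z) (\<phi> a p)"
    if "X \<in> vector_fields M" "Y \<in> vector_fields M" "Z \<in> vector_fields M" for X Y Z
    unfolding pullback_eval2[OF a that(2,3)] act_on_fun_def by (rule pullback_composed[OF a p sm[OF that(2,3)]])
  have br: "eval2 M \<omega> (lie_bracket (pullback a X) (pullback a Y)) (pullback a Z) p
      = eval2 M \<omega> (lie_bracket X Y) Z (\<phi> a p)"
    if "X \<in> vector_fields M" "Y \<in> vector_fields M" "Z \<in> vector_fields M" for X Y Z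
  proof -
    have "eval2 M \<omega> (lie_bracket (pullback a X) (pullback a Y)) (pullback a Z) p
        = eval2 M \<omega> (pullback a (lie_bracket X Y)) (pullback a Z) p"
      using pullback_bracket[OF a that(1,2) p] by (simp add: eval2_def zero_off_def)
    then show ?thesis
      using pullback_eval2[OF a M.lie_bracket_vector_field[OF that(1,2)] that(3)] p by (simp add: zero_off_def)
  qed
  show ?thesis unfolding ext_deriv2_def by (simp add: act br X Y Z)
qed

lemma span: "p \<in> points M \<Longrightarrow> v \<in> T p \<Longrightarrow> \<exists>w. v = A.fund w p"
  by (rule fund_span[OF transitive compact_N])

text \<open>Both d\<omega> = -2 \<theta> \<and> \<omega> and \<omega> are invariant, so the
  difference \<beta> between the transported and the original Lee form satisfies \<beta> \<and>
  \<omega> = 0, and \<open>wedge_injective\<close> applies.\<close>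

lemma \<theta>_invariant:
  assumes a: "a \<in> carrier G" and p: "p \<in> points M" and u: "u \<in> T (\<phi> a p)"
  shows "\<theta> p (differential M M (\<phi> (inv a)) u) = \<theta> (\<phi> a p) u"
proof -
  let ?q = "\<phi> a p" and ?d = "differential M M (\<phi> (inv a))"
  note q = action_in[OF a p]
  define \<beta> where "\<beta> u = \<theta> p (?d u) - \<theta> ?q u" for u
  have d_add: "?d (u + v) = ?d u + ?d v" for u v
    by (rule ext) (simp add: differential_def)
  have d_scale: "?d (c *\<^sub>R u) = c *\<^sub>R ?d u" for c u
    by (rule ext) (simp add: differential_def scaleR_fun_def)
  have lin: "linear_on_subspace (T ?q) \<beta>"
    unfolding linear_on_subspace_def \<beta>_def
    by (auto simp: d_add d_scale \<theta>_add[OF p] \<theta>_scaleR[OF p] \<theta>_add[OF q] \<theta>_scaleR[OF q] differential_inv[OF a p] algebra_simps)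
  have "\<beta> u = 0"
  proof (rule wedge_injective[OF q lin _ u])
    fix x y z assume xyz: "x \<in> T ?q" "y \<in> T ?q" "z \<in> T ?q"
    \<comment> \<open>The formula for d\<omega> takes vector fields; the spanning property extends
      the three vectors to global ones.\<close>
    obtain x' y' z' where eq: "x = A.fund x' ?q" "y = A.fund y' ?q" "z = A.fund z' ?q"
      using span[OF q xyz(1)] span[OF q xyz(2)] span[OF q xyz(3)] by blast
    note F = A.fund_vector_field
    note pF = pullback_vector_field[OF a F]
    have pb: "pullback a (A.fund w) p = ?d (A.fund w ?q)" for w using p by (simp add: pullback_def zero_off_def)
    have "wedge p (?d x) (?d y) (?d z) = wedge ?q x y z"
      using pullback_ext_deriv2[OF a F F F p, of x' y' z'] ext_deriv2_apply[OF F F F q, of x' y' z']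
        ext_deriv2_apply[OF pF pF pF p, of x' y' z'] unfolding eq pb by simp
    then show "\<beta> x * \<omega> ?q y z - \<beta> y * \<omega> ?q x z + \<beta> z * \<omega> ?q x y = 0"
      unfolding wedge_def \<omega>_invariant[OF a p xyz(2,3)] \<omega>_invariant[OF a p xyz(1,3)] \<omega>_invariant[OF a p xyz(1,2)]
      by (simp add: \<beta>_def algebra_simps)
  qed
  then show ?thesis by (simp add: \<beta>_def)
qed

text \<open>The Lee form is nonzero somewhere because \<theta> \<and> \<omega> is; transitivity and
  invariance transport this to every point.\<close>

lemma \<theta>_nonzero:
  assumes q: "q \<in> points M"
  obtains w where "\<theta> q (A.fund w q) \<noteq> 0"
proof -
  obtain X Y Z p where X: "X \<in> vector_fields M" and Y: "Y \<in> vector_fields M" and Z: "Z \<in> vector_fields M"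
    and p: "p \<in> points M" and nz: "wedge p (X p) (Y p) (Z p) \<noteq> 0"
    by (rule wedge_nonzero_somewhere)
  obtain u where u: "u \<in> T p" "\<theta> p u \<noteq> 0"
  proof -
    note t = M.vector_fieldD(1)[OF X p] M.vector_fieldD(1)[OF Y p] M.vector_fieldD(1)[OF Z p]
    have "\<theta> p (X p) \<noteq> 0 \<or> \<theta> p (Y p) \<noteq> 0 \<or> \<theta> p (Z p) \<noteq> 0" using nz by (auto simp: wedge_def)
    then show thesis using that t by blast
  qed
  obtain a where a: "a \<in> carrier G" "\<phi> a q = p"
    using transitive_action.unique_orbit[OF transitive q p] by blast
  let ?v = "differential M M (\<phi> (inv a)) u"
  have v: "?v \<in> T q" using differential_inv[OF a(1) q] u(1) a(2) by simp
  obtain w where w: "?v = A.fund w q" using span[OF q v] by blast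
  have "\<theta> q ?v = \<theta> p u" using \<theta>_invariant[OF a(1) q, of u] u(1) a(2) by simp
  then have "\<theta> q (A.fund w q) \<noteq> 0" using u(2) w by simp
  then show thesis by (rule that)
qed

section \<open>Consequences of invariance along fundamental fields\<close>

lemma \<theta>_lie_derivative:
  assumes Y: "Y \<in> vector_fields M" and p: "p \<in> points M"
  shows "A.fund w p (eval1 M \<theta> Y) = \<theta> p (lie_bracket (A.fund w) Y p)"
  by (rule A.lie_derivative_1form[OF \<theta>_smooth _ Y p])
    (rule \<theta>_invariant[OF chart_carrier[OF c0(1)]])

lemma \<omega>_lie_derivative:
  assumes Y: "Y \<in> vector_fields M" and Z: "Z \<in> vector_fields M" and p: "p \<in> points M"
  shows "A.fund w p (eval2 M \<omega> Y Z)
    = \<omega> p (lie_bracket (A.fund w) Y p) (Z p) + \<omega> p (Y p) (lie_bracket (A.fund w) Z p)"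
  by (rule A.lie_derivative_2form[OF \<omega>_smooth _ Y Z p])
    (rule \<omega>_invariant[OF chart_carrier[OF c0(1)]])

lemma connected_M: "connected_space (mtop M)"
proof -
  obtain X Y Z p where p: "p \<in> points M" by (rule wedge_nonzero_somewhere)
  have "continuous_map (mtop N) (mtop M) (\<lambda>a. \<phi> a p)"
  proof -
    have "continuous_map (prod_topology (mtop N) (mtop M)) (mtop M) (\<lambda>(a, p). \<phi> a p)"
      using smooth_action by (simp add: smooth_action_def smooth_map_def prod_manifold_def)
    moreover have "continuous_map (mtop N) (prod_topology (mtop N) (mtop M)) (\<lambda>a. (a, p))"
      using p by (simp add: continuous_map_pairedI)
    ultimately have "continuous_map (mtop N) (mtop M) ((\<lambda>(a, p). \<phi> a p) \<circ> (\<lambda>a. (a, p)))"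
      by (rule continuous_map_compose[rotated])
    then show ?thesis by (simp add: comp_def)
  qed
  then have "connectedin (mtop M) ((\<lambda>a. \<phi> a p) ` points N)"
    by (rule connectedin_continuous_map_image) (use connected_N in \<open>simp add: connectedin_topspace\<close>)
  moreover have "(\<lambda>a. \<phi> a p) ` points N = points M"
    using transitive_action.unique_orbit[OF transitive p] action_in[OF _ p] points_N by blast
  ultimately show ?thesis by (simp add: connectedin_topspace)
qed

text \<open>In the formula for d\<theta> on the fields of \<open>w\<close> and \<open>b\<close>,
  invariance makes the derivative of \<theta> on the field of \<open>b\<close> along that of
  \<open>w\<close> cancel the bracket term. So the derivative of the function in question along the
  field of \<open>b\<close> is 0; such fields span, and \<open>M\<close> is connected.\<close>

lemma \<theta>_fund_constant:
  assumes p: "p \<in> points M" and q: "q \<in> points M"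
  shows "\<theta> p (A.fund w p) = \<theta> q (A.fund w q)"
proof -
  note F = A.fund_vector_field
  have E: "eval1 M \<theta> (A.fund w) \<in> smooth_funs M" using \<theta>_smooth F by (simp add: smooth_1form_def)
  have "eval1 M \<theta> (A.fund w) p = eval1 M \<theta> (A.fund w) q"
  proof (rule M.zero_derivative_imp_constant[OF connected_M E _ p q])
    fix x v assume x: "x \<in> points M" and v: "v \<in> T x"
    obtain b where b: "v = A.fund b x" using span[OF x v] by blast
    have "ext_deriv1 M \<theta> (A.fund w) (A.fund b) x = 0" using closed F by (simp add: closed_1form_def)
    then show "v (eval1 M \<theta> (A.fund w)) = 0"
      using \<theta>_lie_derivative[OF F x, of w b] x
      by (simp add: b ext_deriv1_def act_on_fun_def eval1_def[of M \<theta> "lie_bracket _ _"] zero_off_def)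
  qed
  then show ?thesis using p q by (simp add: eval1_def zero_off_def)
qed

section \<open>Fundamental fields of central elements\<close>

lemma central_bracket:
  assumes Z: "Z \<in> lie_center G N" and z: "Z \<one> = R.fund z \<one>"
  shows "lie_bracket (A.fund w) (A.fund z) = 0"
proof (rule A.invariant_field_commutes[OF A.fund_vector_field])
  fix x p assume x: "x \<in> cim c0" and p: "p \<in> points M"
  note a = chart_carrier[OF c0(1) x]
  show "A.pull x (A.fund z) p = A.fund z p"
    using central_field_invariant[OF connected_N Z z inv_closed[OF a] action_in[OF a p]] action_inv[OF a p]
    by (simp add: A.pull_def)
qed

lemma lie_bracket_swap: "lie_bracket X Y p = - lie_bracket Y X p"
  by (rule ext) (simp add: lie_bracket_def)

lemma central_derivative:
  assumes Z: "Z \<in> lie_center G N" and z: "Z \<one> = R.fund z \<one>" and p: "p \<in> points M"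
  shows "A.fund a p (eval2 M \<omega> (A.fund b) (A.fund z)) = - 2 * wedge p (A.fund a p) (A.fund b p) (A.fund z p)"
proof -
  note F = A.fund_vector_field
  let ?X = "A.fund a" and ?Y = "A.fund b" and ?C = "A.fund z"
  have t: "A.fund w p \<in> T p" for w by (rule M.vector_fieldD(1)[OF F p])
  have br: "lie_bracket ?X ?Y p \<in> T p" by (rule M.vector_fieldD(1)[OF M.lie_bracket_vector_field[OF F F] p])
  have zero: "lie_bracket ?X ?C p = 0" "lie_bracket ?Y ?C p = 0" "lie_bracket ?C ?X p = 0" "lie_bracket ?C ?Y p = 0"
    using central_bracket[OF Z z] lie_bracket_swap[of ?C] by auto
  have swap: "lie_bracket ?Y ?X p = (-1) *\<^sub>R lie_bracket ?X ?Y p"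
    using lie_bracket_swap[of ?Y ?X p] by simp
  have "ext_deriv2 M \<omega> ?X ?Y ?C p = ?X p (eval2 M \<omega> ?Y ?C) - ?Y p (eval2 M \<omega> ?X ?C) + ?C p (eval2 M \<omega> ?X ?Y)
      - \<omega> p (lie_bracket ?X ?Y p) (?C p) + \<omega> p (lie_bracket ?X ?C p) (?Y p) - \<omega> p (lie_bracket ?Y ?C p) (?X p)"
    using p by (simp add: ext_deriv2_def act_on_fun_def eval2_def[of M \<omega> "lie_bracket _ _"] zero_off_def)
  \<comment> \<open>The derivative along \<open>?X\<close> and the one along \<open>?Y\<close>, with
    its sign, each contribute \<omega>([X, Y], C). The bracket term removes one of the two, and
    every term with a bracket involving \<open>?C\<close> is 0.\<close>
  also have "\<dots> = ?X p (eval2 M \<omega> ?Y ?C)"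
    unfolding \<omega>_lie_derivative[OF F F p] zero swap \<omega>_scaleR(1)[OF p br t] \<omega>_zero[OF p t] by simp
  finally show ?thesis using ext_deriv2_apply[OF F F F p] by simp
qed

lemma central_\<omega>_zero:
  assumes Z: "Z \<in> lie_center G N" and z: "Z \<one> = R.fund z \<one>"
    and p: "p \<in> points M" and \<theta>z: "\<theta> p (A.fund z p) = 0" and \<theta>b: "\<theta> p (A.fund b p) = 0"
  shows "\<omega> p (A.fund b p) (A.fund z p) = 0"
proof -
  note F = A.fund_vector_field
  define f where "f = eval2 M \<omega> (A.fund b) (A.fund z)"
  have f: "f \<in> smooth_funs M" unfolding f_def using \<omega>_smooth F by (simp add: smooth_bilinear_def)
  have zero: "f q = 0" if q: "q \<in> points M"
    and ext: "(\<forall>q'\<in>points M. f q' \<le> f q) \<or> (\<forall>q'\<in>points M. f q \<le> f q')" for q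
  proof -
    obtain a where a: "\<theta> q (A.fund a q) \<noteq> 0" using \<theta>_nonzero[OF q] .
    have "A.fund a q f = 0" by (rule M.tangent_zero_at_extremum[OF f q ext M.vector_fieldD(1)[OF F q]])
    \<comment> \<open>Both vanishing hypotheses are given at \<open>p\<close> and carried to
      \<open>q\<close> by \<open>\<theta>_fund_constant\<close>; a single term of the wedge product
      remains.\<close>
    moreover have "A.fund a q f = - 2 * (\<theta> q (A.fund a q) * f q)"
      using central_derivative[OF Z z q, of a b] \<theta>_fund_constant[OF p q, of z] \<theta>_fund_constant[OF p q, of b] \<theta>z \<theta>b q
      by (simp add: f_def wedge_def eval2_def[of M \<omega> "A.fund b" "A.fund z"] zero_off_def)
    ultimately show ?thesis using a by simp
  qed
  have ne: "points M \<noteq> {}" using p by blast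
  obtain p1 where p1: "p1 \<in> points M" "\<forall>q\<in>points M. f q \<le> f p1" using M.attains_extrema(1)[OF f compact_M ne] by blast
  obtain p2 where p2: "p2 \<in> points M" "\<forall>q\<in>points M. f p2 \<le> f q" using M.attains_extrema(2)[OF f compact_M ne] by blast
  have "f p \<le> 0" "0 \<le> f p" using p1 p2 p zero[OF p1(1)] zero[OF p2(1)] by auto
  then show ?thesis using p by (simp add: f_def eval2_def zero_off_def)
qed

section \<open>The dimension bound\<close>

lemma subspace_lie_center: "subspace (lie_center G N)"
proof (rule subspaceI)
  have lie: "X + Y \<in> lie_algebra G N" "c *\<^sub>R X \<in> lie_algebra G N"
    if X: "X \<in> lie_algebra G N" and Y: "Y \<in> lie_algebra G N" for X Y c
  proof -
    have vX: "X \<in> vector_fields N" and vY: "Y \<in> vector_fields N" using X Y by (auto simp: lie_algebra_def)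
    have a1: "act_on_fun (X + Y) f = act_on_fun X f + act_on_fun Y f"
      "act_on_fun (c *\<^sub>R X) f = c *\<^sub>R act_on_fun X f" for f
      by (auto simp: act_on_fun_def scaleR_fun_def)
    have "X + Y \<in> vector_fields N"
      using N.vector_fieldD[OF vX] N.vector_fieldD[OF vY]
      by (auto simp: vector_fields_def a1 N.tangent_add N.smooth_funs_add)
    moreover have "c *\<^sub>R X \<in> vector_fields N"
      using N.vector_fieldD[OF vX]
      by (auto simp: vector_fields_def a1 scaleR_fun_apply N.tangent_scaleR N.smooth_funs_scaleR)
    moreover have "differential N N F ((X + Y) b) = differential N N F (X b) + differential N N F (Y b)"
      "differential N N F ((c *\<^sub>R X) b) = c *\<^sub>R differential N N F (X b)" for F b
      by (auto simp: differential_def scaleR_fun_def)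
    ultimately show "X + Y \<in> lie_algebra G N" "c *\<^sub>R X \<in> lie_algebra G N"
      using X Y by (auto simp: lie_algebra_def scaleR_fun_def[of c X])
  qed
  have br: "lie_bracket (X + Y) W = lie_bracket X W + lie_bracket Y W" "lie_bracket (c *\<^sub>R X) W = c *\<^sub>R lie_bracket X W"
    if X: "X \<in> vector_fields N" and Y: "Y \<in> vector_fields N" and W: "W \<in> vector_fields N" for X Y W c
  proof -
    have a1: "act_on_fun (X + Y) f = act_on_fun X f + act_on_fun Y f"
      "act_on_fun (c *\<^sub>R X) f = c *\<^sub>R act_on_fun X f" for f
      by (auto simp: act_on_fun_def scaleR_fun_def)
    have sm: "act_on_fun X f \<in> smooth_funs N" "act_on_fun Y f \<in> smooth_funs N" for f
      using N.vector_fieldD(3)[OF X] N.vector_fieldD(3)[OF Y] N.act_nonsmooth[OF X] N.act_nonsmooth[OF Y] N.smooth_funs_zero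
      by (metis)+
    have W1: "W p (act_on_fun X f + act_on_fun Y f) = W p (act_on_fun X f) + W p (act_on_fun Y f)"
      "W p (c *\<^sub>R act_on_fun X f) = c * W p (act_on_fun X f)" for p f
      using N.tangentD(1)[OF N.vector_fieldD(1)[OF W] sm(1) sm(2)] N.tangentD(2)[OF N.vector_fieldD(1)[OF W] sm(1)]
        N.vector_fieldD(2)[OF W]
      by (cases "p \<in> points N"; simp)+
    show "lie_bracket (X + Y) W = lie_bracket X W + lie_bracket Y W"
      by (intro ext) (simp add: lie_bracket_def a1 W1)
    show "lie_bracket (c *\<^sub>R X) W = c *\<^sub>R lie_bracket X W"
      by (intro ext) (simp add: lie_bracket_def a1 W1 scaleR_fun_apply right_diff_distrib)
  qed
  have vf: "X \<in> vector_fields N" if "X \<in> lie_algebra G N" for X using that by (simp add: lie_algebra_def)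
  have zero_lie: "R.fund 0 = 0" using R.fund_scaleR[of 0 0] by simp
  show "0 \<in> lie_center G N"
  proof -
    have "(0::'a vfield) \<in> lie_algebra G N" using R_fund_lie_algebra[of 0] zero_lie by simp
    moreover have "lie_bracket 0 Y = 0" if "Y \<in> lie_algebra G N" for Y
      using br(2)[OF vf[OF that] vf[OF that] vf[OF that], of 0] by simp
    ultimately show ?thesis by (simp add: lie_center_def)
  qed
  show "X + Y \<in> lie_center G N" if "X \<in> lie_center G N" "Y \<in> lie_center G N" for X Y
    using that lie br(1)[OF vf vf vf] by (auto simp: lie_center_def)
  show "c *\<^sub>R X \<in> lie_center G N" if "X \<in> lie_center G N" for c X
    using that lie br(2)[OF vf vf vf] by (auto simp: lie_center_def)
qed

lemma dim_lie_center: "dim (lie_center G N) \<le> 2"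
proof -
  obtain X Y Z p where p: "p \<in> points M" by (rule wedge_nonzero_somewhere)
  obtain w0 where w0: "\<theta> p (A.fund w0 p) \<noteq> 0" using \<theta>_nonzero[OF p] .
  note F = A.fund_vector_field
  \<comment> \<open>The image of \<open>Z \<one>\<close> under the orbit map of \<open>p\<close>,
    that is, the value at \<open>p\<close> of the fundamental field. Defining it directly on fields,
    without choosing a direction \<open>z\<close>, makes linearity immediate.\<close>
  define ev :: "'a vfield \<Rightarrow> 'd tvec" where
    "ev Z = (\<lambda>h. if h \<in> smooth_funs M then Z \<one> (zero_off N (\<lambda>a. h (\<phi> a p))) else 0)" for Z
  have ev: "\<exists>z. Z \<one> = R.fund z \<one> \<and> ev Z = A.fund z p" if Z: "Z \<in> lie_center G N" for Z
  proof -
    have "Z \<one> \<in> tangent_space N \<one>" using N.vector_fieldD(1)[OF lie_centerD(1)[OF Z]] by (simp add: points_N)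
    then obtain z where z: "Z \<one> = R.fund z \<one>" using R_fund_span[OF one_closed] by blast
    have "ev Z = A.fund z p"
    proof
      fix h
      show "ev Z h = A.fund z p h"
        using A_fund_apply[OF p, of h z] M.tangentD(4)[OF M.vector_fieldD(1)[OF F p]] by (simp add: ev_def z)
    qed
    then show ?thesis using z by blast
  qed
  have ev_T: "ev Z \<in> T p" if "Z \<in> lie_center G N" for Z using ev[OF that] M.vector_fieldD(1)[OF F p] by metis
  have ev_add: "ev (Z + Z') = ev Z + ev Z'" for Z Z' by (rule ext) (simp add: ev_def)
  have ev_scale: "ev (c *\<^sub>R Z) = c *\<^sub>R ev Z" for c Z by (rule ext) (simp add: ev_def scaleR_fun_def)
  let ?f = "\<lambda>Z. (\<theta> p (ev Z), \<omega> p (A.fund w0 p) (ev Z))"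
  note t0 = M.vector_fieldD(1)[OF F p, of w0]
  have "linear_on_subspace (lie_center G N) ?f"
    unfolding linear_on_subspace_def
    by (simp add: ev_add ev_scale \<theta>_add[OF p] \<theta>_scaleR[OF p] \<omega>_add[OF p _ _ t0] \<omega>_scaleR[OF p _ t0] ev_T)
  moreover have "Z = 0" if Z: "Z \<in> lie_center G N" and 0: "?f Z = 0" for Z
  proof -
    obtain z where z: "Z \<one> = R.fund z \<one>" and evz: "ev Z = A.fund z p" using ev[OF Z] by blast
    have \<theta>z: "\<theta> p (A.fund z p) = 0" and \<omega>0: "\<omega> p (A.fund w0 p) (A.fund z p) = 0"
      using 0 by (auto simp: evz zero_prod_def)
    note t = M.vector_fieldD(1)[OF F p]
    have \<omega>v: "\<omega> p v (A.fund z p) = 0" if v: "v \<in> T p" for v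
    proof -
      obtain w where w: "v = A.fund w p" using span[OF p v] by blast
      \<comment> \<open>Chosen to correct \<open>v\<close> along \<open>A.fund w0 p\<close> into the
        kernel of \<theta>. There \<open>central_\<omega>_zero\<close> applies, and the correction
        itself is orthogonal to the central field by \<open>\<omega>0\<close>.\<close>
      define s where "s = - \<theta> p v / \<theta> p (A.fund w0 p)"
      have fb: "A.fund (w + s *\<^sub>R w0) p = v + s *\<^sub>R A.fund w0 p"
        by (simp add: A.fund_add A.fund_scaleR w scaleR_fun_def[of s "A.fund w0"])
      have "\<theta> p (A.fund (w + s *\<^sub>R w0) p) = \<theta> p v + s * \<theta> p (A.fund w0 p)"
        by (simp add: fb \<theta>_add[OF p] \<theta>_scaleR[OF p] v t M.tangent_scaleR)
      also have "\<dots> = 0" using w0 by (simp add: s_def)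
      finally have "\<theta> p (A.fund (w + s *\<^sub>R w0) p) = 0" .
      from central_\<omega>_zero[OF Z z p \<theta>z this]
      show ?thesis by (simp add: fb \<omega>_add[OF p] \<omega>_scaleR[OF p] v t M.tangent_scaleR \<omega>0)
    qed
    \<comment> \<open>Nondegeneracy of \<omega>, tested on
      \<open>v = J p (A.fund z p)\<close>.\<close>
    have "A.fund z p = 0"
    proof (rule ccontr)
      assume "A.fund z p \<noteq> 0"
      from \<omega>_pos[OF p t this] have "\<omega> p (A.fund z p) (J p (A.fund z p)) > 0" .
      then show False using \<omega>v[OF J_in[OF p t]] \<omega>_antisym[OF p t J_in[OF p t], of z z] by simp
    qed
    have "A.fund z q = 0" if q: "q \<in> points M" for q
    proof -
      obtain a where a: "a \<in> carrier G" "\<phi> a p = q"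
        using transitive_action.unique_orbit[OF transitive p q] by blast
      have "A.fund z q = differential M M (\<phi> a) 0"
        using central_field_invariant[OF connected_N Z z a(1) p] a(2) \<open>A.fund z p = 0\<close> by simp
      also have "\<dots> = 0" by (rule ext) (simp add: differential_def)
      finally show ?thesis .
    qed
    then show "Z = 0" by (rule central_field_zero[OF faithful Z z])
  qed
  ultimately have "dim (lie_center G N) \<le> DIM(real \<times> real)"
    by (rule dim_le_of_injective[OF subspace_lie_center])
  then show ?thesis by simp
qed

end

theorem corollary3p4:
  fixes M :: "('m, 'e::euclidean_space) manifold"
    and g :: "'m form2" and J :: "'m endo"
    and G :: "('g, 'k) monoid_scheme"
    and N :: "('g, 'b::euclidean_space) manifold"
    and \<phi> :: "'g \<Rightarrow> 'm \<Rightarrow> 'm"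
  assumes "lck_manifold M g J"
    and "compact_space (mtop M)"
    and "\<not> kaehler_manifold M g J"
    and "lie_group G N"
    and "compact_space (mtop N)"
    and "connected_space (mtop N)"
    and "smooth_action G N M \<phi>"
    and "faithful_action G (points M) \<phi>"
    and "transitive_action G (points M) \<phi>"
    and "preserves_metric G M \<phi> g"
    and "preserves_endo G M \<phi> J"
  shows "dim (lie_center G N) \<le> 2"
proof -
  have herm: "hermitian_manifold M g J" using assms(1) by (simp add: lck_manifold_def)
  obtain \<theta> where \<theta>: "closed_1form M \<theta>"
    "\<And>X Y Z. X \<in> vector_fields M \<Longrightarrow> Y \<in> vector_fields M \<Longrightarrow> Z \<in> vector_fields M \<Longrightarrow>
      ext_deriv2 M (fundamental_form g J) X Y Z = - 2 *\<^sub>R wedge12 M \<theta> (fundamental_form g J) X Y Z"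
    using assms(1) unfolding lck_manifold_def by blast
  have gr: "group G" and pN: "points N = carrier G" and sN: "smooth_manifold N"
    using assms(4) by (auto simp: lie_group_def)
  have "\<one>\<^bsub>G\<^esub> \<in> points N" using pN gr by (simp add: group.is_monoid monoid.one_closed)
  then obtain c where c: "c \<in> matlas N" "\<one>\<^bsub>G\<^esub> \<in> cdom c"
    using smooth_mfd.chart_at[of N] sN by (auto simp: smooth_mfd_def)
  have "lck_action G N M \<phi> c g J \<theta>"
    unfolding lck_action_def lck_action_axioms_def lie_action_def lie_action_axioms_def
    using assms gr herm \<theta> c by (simp add: hermitian_manifold_def)
  then show ?thesis by (rule lck_action.dim_lie_center)
qed

end
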